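(* Let $X$ be a separable Banach space. (a) If $\mathrm{SP_w}(X)$ contains a strictly decreasing sequence of length $\omega_1$, then $\mathrm{SP_w}(X)$ contains a strictly increasing sequence of length $\omega_1$. (b) If $\mathrm{SP_w}(X)$ does not contain a strictly increasing infinite sequence, then there exists a countable ordinal $\xi_X$ such that $\mathrm{SP_w}(X)$ does not contain strictly decreasing sequences of order type greater than $\xi_X$.
   Context: Banach spaces are real, and $\mathbb{N}=\{0,1,2,\dots\}$. Domination and equivalence: for Schauder basic sequences $(x_n)_n$, $(y_n)_n$ (possibly in different Banach spaces), $(x_n)_n$ is dominated by $(y_n)_n$, written $(x_n)_n\leq (y_n)_n$, if there is $C\geq 1$ with $\|\sum_{n=0}^k a_nx_n\|\leq C\|\sum_{n=0}^k a_ny_n\|$ for every $k\in\mathbb{N}$ and $a_0,\dots,a_k\in\mathbb{R}$. Two sequences are equivalent if each is dominated by the other. Spreading models: a sequence $(x_n)_n$ is seminormalized if $0<\inf_n\|x_n\|\leq\sup_n\|x_n\|<\infty$. A sequence $(y_n)_n$ in some Banach space is a spreading model generated by a seminormalized sequence $(x_n)_n$ if there is a sequence $\varepsilon_k\downarrow 0$ such that for every $k\geq 1$, all $k\leq n_0<\dots<n_{k-1}$ and all $a_0,\dots,a_{k-1}\in[-1,1]$ we have $\big|\,\|\sum_{i<k}a_ix_{n_i}\|-\|\sum_{i<k}a_iy_i\|\,\big|<\varepsilon_k$. $\mathrm{SP_w}(X)$ is the set of all spreading models generated by (seminormalized) weakly-null sequences in $X$, modulo equivalence, ordered by domination $\leq$;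 write $p<q$ if $p\leq q$ and $q\nleq p$. For an ordinal $\xi$, a strictly increasing (respectively strictly decreasing) sequence of length, or order type, $\xi$ in $\mathrm{SP_w}(X)$ is a family $(p_\zeta)_{\zeta<\xi}$ with $p_\zeta<p_\eta$ (respectively $p_\eta<p_\zeta$) whenever $\zeta<\eta<\xi$. A strictly increasing infinite sequence is one of length $\omega$. *)

theory Defs
  imports "HOL-Analysis.Analysis"
begin

unbundle cardinal_syntax

subsection \<open>Sequences in normed spaces\<close>

definition weakly_null :: "(nat \<Rightarrow> 'a::real_normed_vector) \<Rightarrow> bool" where
  "weakly_null x \<longleftrightarrow> (\<forall>f :: 'a \<Rightarrow> real. bounded_linear f \<longrightarrow> (\<lambda>n. f (x n)) \<longlonglongrightarrow> 0)"

text \<open>Boundedness is a separate conjunct because a supremum of an unbounded set of reals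
  is a junk value; the infimum is over a set that is bounded below by 0.\<close>

definition seminormalized :: "(nat \<Rightarrow> 'a::real_normed_vector) \<Rightarrow> bool" where
  "seminormalized x \<longleftrightarrow> 0 < (INF n. norm (x n)) \<and> bdd_above (range (\<lambda>n. norm (x n)))"

text \<open>Domination is stated for arbitrary sequences; it is only used for spreading models of
  seminormalized weakly null sequences, which are always Schauder basic.\<close>

definition dominated ::
  "(nat \<Rightarrow> 'a::real_normed_vector) \<Rightarrow> (nat \<Rightarrow> 'b::real_normed_vector) \<Rightarrow> bool" where
  "dominated x y \<longleftrightarrow> (\<exists>C\<ge>1. \<forall>(k::nat) (a :: nat \<Rightarrow> real).
     norm (\<Sum>n\<le>k. a n *\<^sub>R x n) \<le> C * norm (\<Sum>n\<le>k. a n *\<^sub>R y n))"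

definition equivalent_seq ::
  "(nat \<Rightarrow> 'a::real_normed_vector) \<Rightarrow> (nat \<Rightarrow> 'b::real_normed_vector) \<Rightarrow> bool" where
  "equivalent_seq x y \<longleftrightarrow> dominated x y \<and> dominated y x"

text \<open>In the definition below, \<open>n\<close> restricted to \<open>{..<k}\<close> is the tuple
  \<open>n 0 < \<dots> < n (k - 1)\<close>.\<close>

definition generates_spreading_model ::
  "(nat \<Rightarrow> 'a::real_normed_vector) \<Rightarrow> (nat \<Rightarrow> 'b::real_normed_vector) \<Rightarrow> bool" where
  "generates_spreading_model x y \<longleftrightarrow> seminormalized x \<and>
     (\<exists>\<epsilon> :: nat \<Rightarrow> real. decseq \<epsilon> \<and> \<epsilon> \<longlonglongrightarrow> 0 \<and>
       (\<forall>k\<ge>1. \<forall>(n :: nat \<Rightarrow> nat) (a :: nat \<Rightarrow> real).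
          k \<le> n 0 \<and> strict_mono_on {..<k} n \<and> (\<forall>i<k. a i \<in> {-1..1}) \<longrightarrow>
          \<bar>norm (\<Sum>i<k. a i *\<^sub>R x (n i)) - norm (\<Sum>i<k. a i *\<^sub>R y i)\<bar> < \<epsilon> k))"


subsection \<open>The ordered set of spreading models\<close>

text \<open>A spreading model may live in any Banach space, but only its equivalence class matters.
  As one cannot quantify existentially over types, spreading models are taken in the
  fixed Banach space \<open>\<ell>\<^sub>\<infinity>\<close> of bounded real sequences. This loses nothing:
  every sequence in a normed space has an isometric copy in \<open>\<ell>\<^sub>\<infinity>\<close>, see
  \<open>isometric_copy_in_linfty\<close> and \<open>spreading_model_in_linfty\<close> below.\<close>

type_synonym linfty = "nat \<Rightarrow>\<^sub>C real"

instance bcontfun :: (metric_space, banach) banach ..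

definition spreading_models_w :: "'a::banach itself \<Rightarrow> (nat \<Rightarrow> linfty) set" where
  "spreading_models_w _ = {y. \<exists>x :: nat \<Rightarrow> 'a. weakly_null x \<and> generates_spreading_model x y}"

definition SPw :: "'a::banach itself \<Rightarrow> (nat \<Rightarrow> linfty) set set" where
  "SPw X = spreading_models_w X //
     {(y, z). y \<in> spreading_models_w X \<and> z \<in> spreading_models_w X \<and> equivalent_seq y z}"

definition SP_le :: "(nat \<Rightarrow> linfty) set \<Rightarrow> (nat \<Rightarrow> linfty) set \<Rightarrow> bool" where
  "SP_le p q \<longleftrightarrow> (\<exists>y\<in>p. \<exists>z\<in>q. dominated y z)"

definition SP_less :: "(nat \<Rightarrow> linfty) set \<Rightarrow> (nat \<Rightarrow> linfty) set \<Rightarrow> bool" where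
  "SP_less p q \<longleftrightarrow> SP_le p q \<and> \<not> SP_le q p"

text \<open>An ordinal \<open>\<xi>\<close> is represented by a (reflexive) well-order relation \<open>r\<close> of that order
  type, and a family indexed by \<open>\<zeta> < \<xi>\<close> by a family indexed by \<open>Field r\<close>.\<close>

definition SPw_has_increasing :: "'a::banach itself \<Rightarrow> 'i rel \<Rightarrow> bool" where
  "SPw_has_increasing X r \<longleftrightarrow> (\<exists>p. (\<forall>\<zeta>\<in>Field r. p \<zeta> \<in> SPw X) \<and>
     (\<forall>\<zeta> \<eta>. (\<zeta>, \<eta>) \<in> r \<and> \<zeta> \<noteq> \<eta> \<longrightarrow> SP_less (p \<zeta>) (p \<eta>)))"

definition SPw_has_decreasing :: "'a::banach itself \<Rightarrow> 'i rel \<Rightarrow> bool" where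
  "SPw_has_decreasing X r \<longleftrightarrow> (\<exists>p. (\<forall>\<zeta>\<in>Field r. p \<zeta> \<in> SPw X) \<and>
     (\<forall>\<zeta> \<eta>. (\<zeta>, \<eta>) \<in> r \<and> \<zeta> \<noteq> \<eta> \<longrightarrow> SP_less (p \<eta>) (p \<zeta>)))"

abbreviation omega1 :: "nat set rel" where
  "omega1 \<equiv> cardSuc natLeq"


subsection \<open>Adequacy of the encoding\<close>

lemma dominated_refl: "dominated x x"
  unfolding dominated_def by (rule exI[of _ 1]) simp

lemma dominated_trans:
  assumes "dominated x y" "dominated y z"
  shows "dominated x z"
proof -
  obtain C where C: "C \<ge> 1"
    "\<forall>(k::nat) a. norm (\<Sum>n\<le>k. a n *\<^sub>R x n) \<le> C * norm (\<Sum>n\<le>k. a n *\<^sub>R y n)"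
    using assms(1) unfolding dominated_def by (elim exE conjE)
  obtain D where D: "D \<ge> 1"
    "\<forall>(k::nat) a. norm (\<Sum>n\<le>k. a n *\<^sub>R y n) \<le> D * norm (\<Sum>n\<le>k. a n *\<^sub>R z n)"
    using assms(2) unfolding dominated_def by (elim exE conjE)
  have "norm (\<Sum>n\<le>k. a n *\<^sub>R x n) \<le> (C * D) * norm (\<Sum>n\<le>k. a n *\<^sub>R z n)"
    for k :: nat and a
  proof -
    have "norm (\<Sum>n\<le>k. a n *\<^sub>R x n) \<le> C * norm (\<Sum>n\<le>k. a n *\<^sub>R y n)"
      using C(2) by (elim allE)
    also have "\<dots> \<le> C * (D * norm (\<Sum>n\<le>k. a n *\<^sub>R z n))"
      by (rule mult_left_mono) (use C(1) D(2) in auto)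
    finally show ?thesis by (simp only: mult.assoc)
  qed
  moreover have "C * D \<ge> 1"
    using mult_mono[OF C(1) D(1)] C(1) by simp
  ultimately show ?thesis unfolding dominated_def by (intro exI[of _ "C * D"]) auto
qed

lemma equiv_SPw:
  "equiv (spreading_models_w X)
     {(y, z). y \<in> spreading_models_w X \<and> z \<in> spreading_models_w X \<and> equivalent_seq y z}"
proof (rule equivI)
  let ?R = "{(y, z). y \<in> spreading_models_w X \<and> z \<in> spreading_models_w X \<and> equivalent_seq y z}"
  show "?R \<subseteq> spreading_models_w X \<times> spreading_models_w X" by auto
  show "refl_on (spreading_models_w X) ?R"
    by (rule refl_onI) (simp add: equivalent_seq_def dominated_refl)
  show "sym ?R" by (auto simp: sym_def equivalent_seq_def)
  show "trans ?R" unfolding trans_def equivalent_seq_def using dominated_trans by blast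
qed

lemma SP_le_iff:
  assumes p: "p \<in> SPw X" "y \<in> p" and q: "q \<in> SPw X" "z \<in> q"
  shows "SP_le p q \<longleftrightarrow> dominated y z"
proof
  assume "SP_le p q"
  then obtain y' z' where *: "y' \<in> p" "z' \<in> q" "dominated y' z'"
    unfolding SP_le_def by blast
  have "dominated y y'" "dominated z' z"
    using quotient_eq_iff[OF equiv_SPw, of p X p y y'] quotient_eq_iff[OF equiv_SPw, of q X q z' z]
      p q * unfolding SPw_def equivalent_seq_def by auto
  with * show "dominated y z" by (blast intro: dominated_trans)
qed (use assms in \<open>auto simp: SP_le_def\<close>)

text \<open>The index ordinal of a decreasing family can always be represented on the type of
  equivalence classes themselves.\<close>

lemma SPw_has_decreasing_on_classes:
  fixes r :: "'i rel"
  assumes r: "Well_order r" and dec: "SPw_has_decreasing X r"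
  shows "\<exists>r' :: (nat \<Rightarrow> linfty) set rel. (r, r') \<in> ordIso \<and> SPw_has_decreasing X r'"
proof -
  obtain p where p: "\<forall>\<zeta>\<in>Field r. p \<zeta> \<in> SPw X"
    "\<forall>\<zeta> \<eta>. (\<zeta>, \<eta>) \<in> r \<and> \<zeta> \<noteq> \<eta> \<longrightarrow> SP_less (p \<eta>) (p \<zeta>)"
    using dec unfolding SPw_has_decreasing_def by (elim exE conjE)
  have "inj_on p (Field r)"
  proof (rule inj_onI, rule ccontr)
    fix \<zeta> \<eta> assume *: "\<zeta> \<in> Field r" "\<eta> \<in> Field r" "p \<zeta> = p \<eta>" "\<zeta> \<noteq> \<eta>"
    then have "(\<zeta>, \<eta>) \<in> r \<or> (\<eta>, \<zeta>) \<in> r"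
      using r unfolding order_on_defs total_on_def by auto
    with p(2) * show False unfolding SP_less_def by metis
  qed
  then have "(r, dir_image r p) \<in> ordIso" using r by (rule dir_image_ordIso[rotated])
  moreover have "SPw_has_decreasing X (dir_image r p)"
    unfolding SPw_has_decreasing_def dir_image_Field
    by (rule exI[of _ id]) (use p in \<open>auto simp: dir_image_def\<close>)
  ultimately show ?thesis by blast
qed

text \<open>A Hahn-Banach theorem: minimal sublinear functionals are linear.\<close>

definition sublinear :: "('a::real_vector \<Rightarrow> real) \<Rightarrow> bool" where
  "sublinear p \<longleftrightarrow> (\<forall>x y. p (x + y) \<le> p x + p y) \<and> (\<forall>c\<ge>0. \<forall>x. p (c *\<^sub>R x) = c * p x)"

lemma sublinear_add: "sublinear p \<Longrightarrow> p (x + y) \<le> p x + p y"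
  by (simp add: sublinear_def)

lemma sublinear_scale: "sublinear p \<Longrightarrow> c \<ge> 0 \<Longrightarrow> p (c *\<^sub>R x) = c * p x"
  by (simp add: sublinear_def)

lemma sublinear_uminus: "sublinear p \<Longrightarrow> - p (- x) \<le> p x"
  using sublinear_add[of p x "- x"] sublinear_scale[of p 0 0] by simp

lemma sublinear_shift:
  fixes p :: "'a::real_vector \<Rightarrow> real"
  assumes s: "sublinear p"
  obtains q where "sublinear q" "q \<le> p" "q (- v) \<le> - p v"
proof -
  note add = sublinear_add[OF s] and hom = sublinear_scale[OF s]
  define Q where "Q x = (\<lambda>t. p (x + t *\<^sub>R v) - t * p v) ` {0..}" for x
  define q where "q x = Inf (Q x)" for x
  have lb: "- p (- x) \<le> w" if w: "w \<in> Q x" for x w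
  proof -
    obtain t where t: "t \<in> {0..}" "w = p (x + t *\<^sub>R v) - t * p v" using w unfolding Q_def by blast
    have "p ((x + t *\<^sub>R v) + (- x)) \<le> p (x + t *\<^sub>R v) + p (- x)" by (rule add)
    with t hom[of t v] show ?thesis by simp
  qed
  have bdd: "bdd_below (Q x)" for x using lb unfolding bdd_below_def by blast
  have ne: "Q x \<noteq> {}" for x unfolding Q_def by auto
  have le: "q x \<le> p (x + t *\<^sub>R v) - t * p v" if "t \<ge> 0" for x t
    unfolding q_def by (rule cInf_lower[OF _ bdd]) (use that in \<open>auto simp: Q_def\<close>)
  have ge: "w \<le> q x" if "\<And>t. t \<ge> 0 \<Longrightarrow> w \<le> p (x + t *\<^sub>R v) - t * p v" for w x
    unfolding q_def by (rule cInf_greatest[OF ne]) (use that in \<open>auto simp: Q_def\<close>)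
  have qadd: "q (x + y) \<le> q x + q y" for x y
  proof -
    have "q (x + y) - q x \<le> q y"
    proof (rule ge)
      fix t :: real assume t: "t \<ge> 0"
      have "q (x + y) - (p (y + t *\<^sub>R v) - t * p v) \<le> q x"
      proof (rule ge)
        fix u :: real assume u: "u \<ge> 0"
        have "q (x + y) \<le> p ((x + y) + (u + t) *\<^sub>R v) - (u + t) * p v"
          by (rule le) (use t u in simp)
        also have "(x + y) + (u + t) *\<^sub>R v = (x + u *\<^sub>R v) + (y + t *\<^sub>R v)"
          by (simp add: algebra_simps)
        also have "p \<dots> \<le> p (x + u *\<^sub>R v) + p (y + t *\<^sub>R v)" by (rule add)
        finally show "q (x + y) - (p (y + t *\<^sub>R v) - t * p v) \<le> p (x + u *\<^sub>R v) - u * p v"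
          by (simp add: algebra_simps)
      qed
      then show "q (x + y) - q x \<le> p (y + t *\<^sub>R v) - t * p v" by simp
    qed
    then show ?thesis by simp
  qed
  have qle: "c * q x \<le> q (c *\<^sub>R x)" if c: "c > 0" for c x
  proof (rule ge)
    fix t :: real assume t: "t \<ge> 0"
    have "c * q x \<le> c * (p (x + (t / c) *\<^sub>R v) - (t / c) * p v)"
      by (rule mult_left_mono[OF le]) (use t c in auto)
    also have "\<dots> = p (c *\<^sub>R (x + (t / c) *\<^sub>R v)) - t * p v"
      using hom[of c "x + (t / c) *\<^sub>R v"] c by (simp add: algebra_simps)
    also have "c *\<^sub>R (x + (t / c) *\<^sub>R v) = c *\<^sub>R x + t *\<^sub>R v"
      using c by (simp add: scaleR_add_right)
    finally show "c * q x \<le> p (c *\<^sub>R x + t *\<^sub>R v) - t * p v" .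
  qed
  have q0: "q 0 = 0"
  proof (rule antisym)
    show "q 0 \<le> 0" using le[of 0 0] hom[of 0 0] by simp
    show "0 \<le> q 0" by (rule ge) (use hom in simp)
  qed
  have qhom: "q (c *\<^sub>R x) = c * q x" if "c \<ge> 0" for c x
  proof (cases "c = 0")
    case False
    with that have c: "c > 0" by simp
    have "(1 / c) * q (c *\<^sub>R x) \<le> q ((1 / c) *\<^sub>R c *\<^sub>R x)" by (rule qle) (use c in simp)
    then have "q (c *\<^sub>R x) \<le> c * q x" using c by (simp add: field_simps)
    with qle[OF c, of x] show ?thesis by simp
  qed (simp add: q0)
  show thesis
  proof (rule that)
    show "sublinear q" unfolding sublinear_def using qadd qhom by blast
    show "q \<le> p" using le[of 0] by (auto simp: le_fun_def)
    show "q (- v) \<le> - p v" using le[of 1 "- v"] hom[of 0 0] by simp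
  qed
qed

lemma sublinear_minimal_linear:
  fixes m :: "'a::real_vector \<Rightarrow> real"
  assumes s: "sublinear m" and min: "\<And>q. sublinear q \<Longrightarrow> q \<le> m \<Longrightarrow> q = m"
  shows "linear m"
proof -
  have odd: "m (- v) = - m v" for v
  proof -
    obtain q where q: "sublinear q" "q \<le> m" "q (- v) \<le> - m v"
      using sublinear_shift[OF s] by blast
    with min have "m (- v) \<le> - m v" by metis
    with sublinear_uminus[OF s, of v] show ?thesis by simp
  qed
  note add = sublinear_add[OF s] and hom = sublinear_scale[OF s]
  show ?thesis
  proof (rule linearI)
    fix x y
    have "m (- (x + y)) \<le> m (- x) + m (- y)" using add[of "- x" "- y"] by simp
    then have "- m (x + y) \<le> - m x - m y" unfolding odd by simp
    with add[of x y] show "m (x + y) = m x + m y" by simp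
  next
    fix c x
    show "m (c *\<^sub>R x) = c *\<^sub>R m x"
    proof (cases "c \<ge> 0")
      case False
      then have "m ((- c) *\<^sub>R x) = (- c) * m x" by (intro hom) simp
      with odd[of "c *\<^sub>R x"] show ?thesis by simp
    qed (simp add: hom)
  qed
qed

lemma hahn_banach_sublinear:
  fixes p :: "'a::real_vector \<Rightarrow> real"
  assumes s: "sublinear p"
  obtains f where "linear f" "f \<le> p"
proof -
  define A where "A = {q. sublinear q \<and> q \<le> p}"
  have "\<exists>m\<in>A. \<forall>a\<in>A. m \<ge> a \<longrightarrow> a = m"
  proof (rule predicate_Zorn)
    show "partial_order_on A (relation_of (\<ge>) A)"
      by (rule partial_order_on_relation_ofI) auto
  next
    fix C assume C: "C \<in> Chains (relation_of (\<ge>) A)"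
    then have CA: "C \<subseteq> A" and chain: "\<And>a b. a \<in> C \<Longrightarrow> b \<in> C \<Longrightarrow> a \<le> b \<or> b \<le> a"
      unfolding Chains_def relation_of_def by auto
    show "\<exists>u\<in>A. \<forall>a\<in>C. a \<ge> u"
    proof (cases "C = {}")
      case True
      with s show ?thesis unfolding A_def by auto
    next
      case ne: False
      have sub: "sublinear a" "a \<le> p" if "a \<in> C" for a using that CA unfolding A_def by auto
      define u where "u x = (INF a\<in>C. a x)" for x
      have "- p (- x) \<le> a x" if "a \<in> C" for a x
        using sublinear_uminus[OF sub(1)[OF that], of x] le_funD[OF sub(2)[OF that], of "- x"] by simp
      then have bdd: "bdd_below ((\<lambda>a. a x) ` C)" for x by (intro bdd_belowI[of _ "- p (- x)"]) auto
      have le: "u x \<le> a x" if "a \<in> C" for a x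
        unfolding u_def by (rule cINF_lower[OF bdd that])
      have ge: "w \<le> u x" if "\<And>a. a \<in> C \<Longrightarrow> w \<le> a x" for w x
        unfolding u_def by (rule cINF_greatest[OF ne that])
      have uadd: "u (x + y) \<le> u x + u y" for x y
      proof -
        have "u (x + y) - u x \<le> u y"
        proof (rule ge)
          fix a assume a: "a \<in> C"
          have "u (x + y) - a y \<le> u x"
          proof (rule ge)
            fix b assume b: "b \<in> C"
            have "\<exists>c\<in>C. c \<le> a \<and> c \<le> b"
              using chain[OF a b]
            proof
              assume "a \<le> b"
              with a show ?thesis by (intro bexI[of _ a] conjI order_refl)
            next
              assume "b \<le> a"
              with b show ?thesis by (intro bexI[of _ b] conjI order_refl)
            qed
            then obtain c where c: "c \<in> C" "c \<le> a" "c \<le> b" by (elim bexE conjE)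
            have "u (x + y) \<le> c (x + y)" by (rule le[OF c(1)])
            also have "\<dots> \<le> c x + c y" by (rule sublinear_add[OF sub(1)[OF c(1)]])
            also have "\<dots> \<le> b x + a y" by (rule add_mono[OF le_funD[OF c(3)] le_funD[OF c(2)]])
            finally show "u (x + y) - a y \<le> b x" by simp
          qed
          then show "u (x + y) - u x \<le> a y" by simp
        qed
        then show ?thesis by simp
      qed
      have chom: "a (c *\<^sub>R x) = c * a x" if "a \<in> C" "c \<ge> 0" for a c x
        by (rule sublinear_scale[OF sub(1)[OF that(1)] that(2)])
      have u0: "u 0 = 0"
      proof -
        have "a 0 = 0" if "a \<in> C" for a using chom[OF that, of 0 0] by simp
        then have "(\<lambda>a. a 0) ` C = {0}" using ne by (auto simp: image_iff)
        then show ?thesis unfolding u_def by simp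
      qed
      have ule: "c * u x \<le> u (c *\<^sub>R x)" if "c > 0" for c x
        by (rule ge) (use that in \<open>simp add: chom le\<close>)
      have uhom: "u (c *\<^sub>R x) = c * u x" if "c \<ge> 0" for c x
      proof (cases "c = 0")
        case False
        with that have c: "c > 0" by simp
        have "(1 / c) * u (c *\<^sub>R x) \<le> u ((1 / c) *\<^sub>R c *\<^sub>R x)" by (rule ule) (use c in simp)
        then have "u (c *\<^sub>R x) \<le> c * u x" using c by (simp add: field_simps)
        with ule[OF c, of x] show ?thesis by simp
      qed (simp add: u0)
      obtain a where a: "a \<in> C" using ne by auto
      have "u \<le> p"
        by (rule order_trans[OF _ sub(2)[OF a]]) (simp add: le_fun_def le[OF a])
      then have "u \<in> A" unfolding A_def sublinear_def using uadd uhom by simp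
      with le show ?thesis by (auto simp: le_fun_def)
    qed
  qed
  then obtain m where m: "m \<in> A" "\<And>a. a \<in> A \<Longrightarrow> a \<le> m \<Longrightarrow> a = m" by blast
  have "linear m"
  proof (rule sublinear_minimal_linear)
    show "sublinear m" using m(1) unfolding A_def by blast
    fix q :: "'a \<Rightarrow> real" assume "sublinear q" "q \<le> m"
    with m show "q = m" unfolding A_def by (auto intro: order_trans)
  qed
  with m(1) that show thesis unfolding A_def by blast
qed

lemma norming_functional:
  fixes v :: "'a::real_normed_vector"
  obtains f :: "'a \<Rightarrow> real" where "linear f" "\<And>x. \<bar>f x\<bar> \<le> norm x" "f v = norm v"
proof -
  have "sublinear (norm :: 'a \<Rightarrow> real)" unfolding sublinear_def by (auto simp: norm_triangle_ineq)
  then obtain q where q: "sublinear q" "q \<le> norm" "q (- v) \<le> - norm v"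
    using sublinear_shift by blast
  obtain f where f: "linear f" "f \<le> q" using hahn_banach_sublinear[OF q(1)] by blast
  have fle: "f x \<le> norm x" for x using le_funD[OF f(2), of x] le_funD[OF q(2), of x] by simp
  have neg: "f (- x) = - f x" for x by (rule linear_neg[OF f(1)])
  show thesis
  proof (rule that[OF f(1)])
    show "\<bar>f x\<bar> \<le> norm x" for x using fle[of x] fle[of "- x"] neg[of x] by simp
    show "f v = norm v" using le_funD[OF f(2), of "- v"] q(3) neg[of v] fle[of v] by simp
  qed
qed

lemma rational_combinations_dense:
  fixes y :: "nat \<Rightarrow> 'b::real_normed_vector" and a :: "nat \<Rightarrow> real"
  assumes "e > 0"
  shows "\<exists>qs :: rat list. norm ((\<Sum>i<length qs. of_rat (qs ! i) *\<^sub>R y i) - (\<Sum>i<k. a i *\<^sub>R y i)) < e"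
proof -
  define M where "M = (\<Sum>i<k. norm (y i)) + 1"
  have M: "M > 0" unfolding M_def by (simp add: add_nonneg_pos sum_nonneg)
  have "\<exists>q. \<bar>of_rat q - a i\<bar> < e / M" for i
  proof -
    have "a i - e / M < a i + e / M" using assms M by simp
    from of_rat_dense[OF this] show ?thesis by (auto simp: abs_less_iff algebra_simps)
  qed
  then obtain q where q: "\<And>i. \<bar>of_rat (q i) - a i\<bar> < e / M" by metis
  have "norm ((\<Sum>i<k. of_rat (q i) *\<^sub>R y i) - (\<Sum>i<k. a i *\<^sub>R y i))
      = norm (\<Sum>i<k. (of_rat (q i) - a i) *\<^sub>R y i)"
    by (simp add: sum_subtractf scaleR_diff_left)
  also have "\<dots> \<le> (\<Sum>i<k. norm ((of_rat (q i) - a i) *\<^sub>R y i))" by (rule norm_sum)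
  also have "\<dots> \<le> (\<Sum>i<k. e / M * norm (y i))"
    unfolding norm_scaleR real_norm_def
    by (intro sum_mono mult_right_mono less_imp_le[OF q] norm_ge_zero)
  also have "\<dots> = e / M * (M - 1)" by (simp add: M_def sum_distrib_left)
  also have "\<dots> < e" using M assms by (simp add: field_simps)
  finally show ?thesis
    by (intro exI[of _ "map q [0..<k]"]) simp
qed

lemma isometric_copy_in_linfty:
  fixes y :: "nat \<Rightarrow> 'b::real_normed_vector"
  shows "\<exists>z :: nat \<Rightarrow> linfty. \<forall>(k::nat) (a :: nat \<Rightarrow> real).
           norm (\<Sum>i<k. a i *\<^sub>R z i) = norm (\<Sum>i<k. a i *\<^sub>R y i)"
proof -
  define d :: "nat \<Rightarrow> 'b" where
    "d n = (\<Sum>i<length (from_nat n :: rat list). of_rat ((from_nat n :: rat list) ! i) *\<^sub>R y i)" for n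
  have "\<exists>f :: 'b \<Rightarrow> real. linear f \<and> (\<forall>x. \<bar>f x\<bar> \<le> norm x) \<and> f (d n) = norm (d n)" for n
    using norming_functional[of "d n"] by metis
  then obtain f :: "nat \<Rightarrow> 'b \<Rightarrow> real" where
    f: "\<And>n. linear (f n)" "\<And>n x. \<bar>f n x\<bar> \<le> norm x" "\<And>n. f n (d n) = norm (d n)" by metis
  define z :: "nat \<Rightarrow> linfty" where "z i = Bcontfun (\<lambda>n. f n (y i))" for i
  have "(\<lambda>n. f n (y i)) \<in> bcontfun" for i
    by (rule bcontfun_normI[of _ "norm (y i)"]) (use f(2) in auto)
  then have z: "apply_bcontfun (z i) n = f n (y i)" for i n
    unfolding z_def by (simp add: Bcontfun_inverse)
  have app: "apply_bcontfun (\<Sum>i<k. a i *\<^sub>R z i) n = f n (\<Sum>i<k. a i *\<^sub>R y i)" for k a n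
  proof (induction k)
    case 0
    show ?case using linear_0[OF f(1)] by simp
  next
    case (Suc k)
    then show ?case by (simp add: z linear_add[OF f(1)] linear_scale[OF f(1)])
  qed
  have "norm (\<Sum>i<k. a i *\<^sub>R z i) = norm (\<Sum>i<k. a i *\<^sub>R y i)" for k and a :: "nat \<Rightarrow> real"
  proof (rule antisym)
    show "norm (\<Sum>i<k. a i *\<^sub>R z i) \<le> norm (\<Sum>i<k. a i *\<^sub>R y i)"
      by (rule norm_bound) (simp add: app f(2))
    define v where "v = (\<Sum>i<k. a i *\<^sub>R y i)"
    show "norm (\<Sum>i<k. a i *\<^sub>R y i) \<le> norm (\<Sum>i<k. a i *\<^sub>R z i)"
    proof (rule field_le_epsilon)
      fix e :: real assume e: "e > 0"
      then obtain qs :: "rat list"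
        where qs: "norm ((\<Sum>i<length qs. of_rat (qs ! i) *\<^sub>R y i) - v) < e / 2"
        using rational_combinations_dense[of "e / 2" y a k] unfolding v_def by auto
      define n where "n = to_nat qs"
      have dn: "norm (d n - v) < e / 2" using qs by (simp add: d_def n_def)
      have "norm v \<le> norm (d n) + norm (d n - v)"
        using norm_triangle_ineq4[of "d n" "d n - v"] by simp
      moreover have "norm (d n) = f n v + f n (d n - v)"
        using f(3)[of n] linear_diff[OF f(1), of n "d n" v] by simp
      moreover have "f n (d n - v) \<le> norm (d n - v)" using f(2)[of n "d n - v"] by simp
      moreover have "f n v \<le> norm (\<Sum>i<k. a i *\<^sub>R z i)"
        using norm_bounded[of "\<Sum>i<k. a i *\<^sub>R z i" n] by (simp add: app v_def)
      ultimately show "norm (\<Sum>i<k. a i *\<^sub>R y i) \<le> norm (\<Sum>i<k. a i *\<^sub>R z i) + e"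
        using dn unfolding v_def by simp
    qed
  qed
  then show ?thesis by blast
qed

lemma spreading_model_in_linfty:
  fixes x :: "nat \<Rightarrow> 'a::banach" and y :: "nat \<Rightarrow> 'b::banach"
  assumes "weakly_null x" "generates_spreading_model x y"
  shows "\<exists>z \<in> spreading_models_w TYPE('a). equivalent_seq y z"
proof -
  obtain z :: "nat \<Rightarrow> linfty" where z: "\<And>(k::nat) (a :: nat \<Rightarrow> real).
      norm (\<Sum>i<k. a i *\<^sub>R z i) = norm (\<Sum>i<k. a i *\<^sub>R y i)"
    using isometric_copy_in_linfty[of y] by blast
  have "generates_spreading_model x z"
    using assms(2) unfolding generates_spreading_model_def z .
  moreover have "equivalent_seq y z"
    unfolding equivalent_seq_def dominated_def lessThan_Suc_atMost[symmetric] z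
    by (auto intro: exI[of _ 1])
  ultimately show ?thesis using assms(1) unfolding spreading_models_w_def by blast
qed

end

theory Submission
  imports Defs
    "HOL-Library.Ramsey"
    "HOL-Library.Diagonal_Subsequence"
    "HOL-Library.Countable_Set_Type"
    "HOL-Library.Extended_Nat"
    "HOL-Library.Sublist"
begin

text \<open>
  Code a generating sequence by the indices of nearby members of a dense sequence of \<open>X\<close>. After
  passing to a subsequence with a fixed rate of convergence, "the spreading model of \<open>c\<close> lies
  strictly below that of \<open>c'\<close>" is the projection of a closed relation. Weak nullness need not be coded:
  if a sequence generates a suppression unconditional spreading model that does not dominate
  \<open>\<ell>\<^sub>1\<close>, then it is weakly null, and this applies to the lower member of each strict pair. So if there
  is no strictly increasing infinite sequence, the tree of finite attempts to build one is
  well-founded, and (Kunen-Martin) every strictly decreasing family embeds into its Kleene-Brouwer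
  order. This gives (b).

  By (b), a strictly decreasing family of length \<open>\<omega>\<^sub>1\<close> yields a strictly increasing sequence of
  spreading models \<open>p\<^sub>0 < p\<^sub>1 < \<dots>\<close>. Let \<open>q\<^sub>c\<close> be generated by \<open>\<Sum>\<^sub>m c\<^sub>m x\<^sup>m\<close>, where \<open>x\<^sup>m\<close> generates \<open>p\<^sub>m\<close> and the
  terms are spread out. By suppression unconditionality \<open>q\<^sub>c\<close> is monotone in the weights \<open>c\<close>, and
  \<open>c\<^sub>m p\<^sub>m \<le> q\<^sub>c \<le> \<Sum>\<^sub>m c\<^sub>m p\<^sub>m\<close>. For weights close to a rapidly decreasing sequence \<open>\<delta>\<close> this makes
  \<open>q\<^sub>c\<close> strictly increase whenever \<open>c\<^sub>m\<close> grows by an unbounded factor, and diagonalization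
  gives \<open>\<omega>\<^sub>1\<close> many weights of increasing growth.
\<close>

subsection \<open>Spreading norms\<close>

text \<open>Weak nullness is the obstacle: it quantifies over all functionals, so it has no place in
  a tree of finite attempts. What is coded instead are inequalities between spreading norms, and the
  fixed rate of convergence makes such a norm a continuous function of the code. An infinite
  increasing chain has no last member, so every member is the lower one of some pair, and hence
  weakly null in the end.

  For the chain of length \<open>\<omega>\<^sub>1\<close>, uncountably many mixtures are to be
  separated by countably many test vectors that are chosen before the weights. The weights are
  \<open>\<beta> n * (1/2)^n * (1/2)^f n\<close> with \<open>f n \<le> n\<close>, so the
  \<open>n\<close>-th one never falls below \<open>\<beta> n * (1/2)^n * (1/2)^n\<close>. The
  \<open>n\<close>-th test vector keeps the total share of the other rows within a constant multiple
  of this number; so it reads off the \<open>n\<close>-th weight of every mixture up to a factor 4,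
  and mixtures can be compared through the functions \<open>f\<close>. Countably many functions
  tending to infinity always admit a much slower one, which is what each step of the recursion asks
  for.\<close>

text \<open>Strictly increasing sequences whose first term tends to infinity replace the finite tuples in
  the definition of spreading models; only the first \<open>k\<close> terms matter for combinations of length \<open>k\<close>.\<close>

definition incr_seqs :: "(nat \<Rightarrow> nat) filter" where
  "incr_seqs = (INF m. principal {n. strict_mono n \<and> m \<le> n 0})"

lemma eventually_incr_seqs:
  "eventually P incr_seqs \<longleftrightarrow> (\<exists>m. \<forall>n. strict_mono n \<and> m \<le> n 0 \<longrightarrow> P n)"
proof -
  have "eventually P incr_seqs \<longleftrightarrow>
      (\<exists>m\<in>UNIV. eventually P (principal {n. strict_mono n \<and> m \<le> n 0}))"
    unfolding incr_seqs_def
  proof (rule eventually_INF_base)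
    fix a b :: nat
    show "\<exists>x\<in>UNIV. principal {n. strict_mono n \<and> x \<le> n 0}
      \<le> inf (principal {n. strict_mono n \<and> a \<le> n 0}) (principal {n. strict_mono n \<and> b \<le> n (0::nat)})"
      by (rule bexI[of _ "max a b"]) auto
  qed auto
  then show ?thesis by (simp add: eventually_principal)
qed

lemma incr_seqs_neq_bot [simp]: "incr_seqs \<noteq> bot"
proof
  assume "incr_seqs = bot"
  then have "eventually (\<lambda>_. False) incr_seqs" by simp
  then obtain m where m: "\<And>n::nat \<Rightarrow> nat. strict_mono n \<Longrightarrow> m \<le> n 0 \<Longrightarrow> False"
    unfolding eventually_incr_seqs by auto
  show False by (rule m[of "\<lambda>j. m + j"]) (simp_all add: strict_mono_def)
qed

lemma eventually_incr_seqsI: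
  assumes "\<And>n. strict_mono n \<Longrightarrow> m \<le> n 0 \<Longrightarrow> P n"
  shows "eventually P incr_seqs"
  using assms unfolding eventually_incr_seqs by blast

lemma strict_mono_nat_ge: "strict_mono (n :: nat \<Rightarrow> nat) \<Longrightarrow> n 0 + j \<le> n j"
proof (induction j)
  case (Suc j)
  then have "n j < n (Suc j)" by (simp add: strict_mono_def)
  with Suc show ?case by simp
qed simp

lemma filterlim_incr_seqsI:
  assumes "\<And>m. eventually (\<lambda>x. strict_mono (f x) \<and> m \<le> f x 0) F"
  shows "filterlim f incr_seqs F"
  unfolding filterlim_iff eventually_incr_seqs
proof (intro allI impI, elim exE)
  fix P m assume "\<forall>n::nat \<Rightarrow> nat. strict_mono n \<and> m \<le> n (0::nat) \<longrightarrow> P n"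
  with assms[of m] show "eventually (\<lambda>x. P (f x)) F" by (auto elim: eventually_mono)
qed

lemma filterlim_comp_incr_seqs:
  assumes "strict_mono \<phi>"
  shows "filterlim (\<lambda>n. \<phi> \<circ> n) incr_seqs incr_seqs"
proof (rule filterlim_incr_seqsI, rule eventually_incr_seqsI)
  fix m and n :: "nat \<Rightarrow> nat" assume n: "strict_mono n" "m \<le> n 0"
  show "strict_mono (\<phi> \<circ> n) \<and> m \<le> (\<phi> \<circ> n) 0"
    using assms n strict_mono_o seq_suble[OF assms, of "n 0"] by force
qed

lemma filterlim_shift_incr_seqs: "filterlim (\<lambda>i j. i + j) incr_seqs sequentially"
proof (rule filterlim_incr_seqsI)
  fix m show "eventually (\<lambda>i. strict_mono ((+) i) \<and> m \<le> i + 0) sequentially"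
    using eventually_ge_at_top[of m] by eventually_elim (simp add: strict_mono_def)
qed

lemma filterlim_nth_incr_seqs: "filterlim (\<lambda>n. n j) sequentially incr_seqs"
  unfolding filterlim_at_top
proof
  fix m
  show "eventually (\<lambda>n. m \<le> n j) incr_seqs"
  proof (rule eventually_incr_seqsI)
    fix n :: "nat \<Rightarrow> nat" assume "strict_mono n" "m \<le> n 0"
    then show "m \<le> n j" using strict_mono_nat_ge[of n j] by simp
  qed
qed

lemma convergent_incr_seqs_iff_Cauchy:
  fixes F :: "(nat \<Rightarrow> nat) \<Rightarrow> real"
  shows "(\<exists>l. (F \<longlongrightarrow> l) incr_seqs) \<longleftrightarrow>
    (\<forall>e>0. \<exists>m. \<forall>n n'. strict_mono n \<and> strict_mono n' \<and> m \<le> n 0 \<and> m \<le> n' 0 \<longrightarrow> \<bar>F n - F n'\<bar> < e)"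
    (is "_ \<longleftrightarrow> (\<forall>e>0. \<exists>m. ?C e m)")
proof
  assume "\<exists>l. (F \<longlongrightarrow> l) incr_seqs"
  then obtain l where l: "(F \<longlongrightarrow> l) incr_seqs" ..
  show "\<forall>e>0. \<exists>m. ?C e m"
  proof (intro allI impI)
    fix e :: real assume "e > 0"
    then have "eventually (\<lambda>n. dist (F n) l < e/2) incr_seqs" using l by (intro tendstoD) auto
    then obtain m where m: "\<And>n. strict_mono n \<Longrightarrow> m \<le> n 0 \<Longrightarrow> \<bar>F n - l\<bar> < e/2"
      unfolding eventually_incr_seqs dist_real_def by blast
    show "\<exists>m. ?C e m"
    proof (intro exI[of _ m] allI impI)
      fix n n' :: "nat \<Rightarrow> nat" assume "strict_mono n \<and> strict_mono n' \<and> m \<le> n 0 \<and> m \<le> n' 0"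
      then show "\<bar>F n - F n'\<bar> < e" using m[of n] m[of n'] by linarith
    qed
  qed
next
  assume C: "\<forall>e>0. \<exists>m. ?C e m"
  \<comment> \<open>The translates \<open>(+) i\<close> are an ordinary sequence running to infinity
    in the filter; its limit is the only candidate for \<open>l\<close>.\<close>
  have "Cauchy (\<lambda>i. F ((+) i))"
  proof (rule metric_CauchyI)
    fix e :: real assume "e > 0"
    with C obtain m where m: "\<And>n n' :: nat \<Rightarrow> nat. strict_mono n \<Longrightarrow> strict_mono n' \<Longrightarrow> m \<le> n 0 \<Longrightarrow> m \<le> n' 0 \<Longrightarrow> \<bar>F n - F n'\<bar> < e"
      by meson
    show "\<exists>M. \<forall>i\<ge>M. \<forall>i'\<ge>M. dist (F ((+) i)) (F ((+) i')) < e"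
      unfolding dist_real_def by (intro exI[of _ m] allI impI m) (auto simp: strict_mono_def)
  qed
  then obtain l where l: "(\<lambda>i. F ((+) i)) \<longlonglongrightarrow> l"
    using Cauchy_convergent convergent_def by blast
  have "(F \<longlongrightarrow> l) incr_seqs"
  proof (rule tendstoI)
    fix e :: real assume "e > 0"
    with C obtain m where m: "\<And>n n' :: nat \<Rightarrow> nat. strict_mono n \<Longrightarrow> strict_mono n' \<Longrightarrow> m \<le> n 0 \<Longrightarrow> m \<le> n' 0 \<Longrightarrow> \<bar>F n - F n'\<bar> < e/2"
      using C[rule_format, of "e/2"] by (metis half_gt_zero)
    have "eventually (\<lambda>i. dist (F ((+) i)) l < e/2) sequentially" using l \<open>e > 0\<close> by (intro tendstoD) auto
    then have "eventually (\<lambda>i. dist (F ((+) i)) l < e/2 \<and> m \<le> i) sequentially"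
      using eventually_ge_at_top[of m] by eventually_elim auto
    then obtain i where i: "\<bar>F ((+) i) - l\<bar> < e/2" "m \<le> i"
      unfolding dist_real_def eventually_sequentially by blast
    show "eventually (\<lambda>n. dist (F n) l < e) incr_seqs"
    proof (rule eventually_incr_seqsI)
      fix n :: "nat \<Rightarrow> nat" assume "strict_mono n" "m \<le> n 0"
      then have "\<bar>F n - F ((+) i)\<bar> < e/2" using i by (intro m) (auto simp: strict_mono_def)
      with i show "dist (F n) l < e" unfolding dist_real_def by linarith
    qed
  qed
  then show "\<exists>l. (F \<longlongrightarrow> l) incr_seqs" ..
qed

text \<open>Convergence survives uniform approximation. This serves twice: for rational coefficients
  in \<open>Brunel_Sucheston_array\<close> and for truncated mixtures in
  \<open>mix_norm\<close>.\<close>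

lemma convergent_incr_seqs_approx:
  fixes F :: "(nat \<Rightarrow> nat) \<Rightarrow> real"
  assumes "\<And>e. e > 0 \<Longrightarrow> \<exists>G l. (G \<longlongrightarrow> l) incr_seqs \<and> eventually (\<lambda>n. \<bar>F n - G n\<bar> \<le> e) incr_seqs"
  shows "\<exists>l. (F \<longlongrightarrow> l) incr_seqs"
  unfolding convergent_incr_seqs_iff_Cauchy
proof (intro allI impI)
  fix e :: real assume "e > 0"
  with assms[of "e/3"] obtain G l where G: "(G \<longlongrightarrow> l) incr_seqs"
    "eventually (\<lambda>n. \<bar>F n - G n\<bar> \<le> e/3) incr_seqs" by auto
  from G(1) \<open>e > 0\<close> obtain m where m: "\<And>n n'. strict_mono n \<Longrightarrow> strict_mono n' \<Longrightarrow> m \<le> n 0 \<Longrightarrow> m \<le> n' 0 \<Longrightarrow> \<bar>G n - G n'\<bar> < e/3"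
    using convergent_incr_seqs_iff_Cauchy[of G] by (meson divide_pos_pos zero_less_numeral)
  from G(2) obtain m' where m': "\<And>n. strict_mono n \<Longrightarrow> m' \<le> n 0 \<Longrightarrow> \<bar>F n - G n\<bar> \<le> e/3"
    unfolding eventually_incr_seqs by blast
  show "\<exists>m. \<forall>n n'. strict_mono n \<and> strict_mono n' \<and> m \<le> n 0 \<and> m \<le> n' 0 \<longrightarrow> \<bar>F n - F n'\<bar> < e"
  proof (intro exI[of _ "max m m'"] allI impI)
    fix n n' :: "nat \<Rightarrow> nat" assume "strict_mono n \<and> strict_mono n' \<and> max m m' \<le> n 0 \<and> max m m' \<le> n' 0"
    then show "\<bar>F n - F n'\<bar> < e" using m[of n n'] m'[of n] m'[of n'] by (simp, linarith)
  qed
qed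

lemma norm_lincomb_diff_le:
  fixes v :: "nat \<Rightarrow> 'a::real_normed_vector"
  assumes "\<And>j. j < k \<Longrightarrow> norm (v j) \<le> B"
  shows "\<bar>norm (\<Sum>j<k. a j *\<^sub>R v j) - norm (\<Sum>j<k. b j *\<^sub>R v j)\<bar> \<le> (\<Sum>j<k. \<bar>a j - b j\<bar>) * B"
proof -
  have "\<bar>norm (\<Sum>j<k. a j *\<^sub>R v j) - norm (\<Sum>j<k. b j *\<^sub>R v j)\<bar>
      \<le> norm ((\<Sum>j<k. a j *\<^sub>R v j) - (\<Sum>j<k. b j *\<^sub>R v j))" by (rule norm_triangle_ineq3)
  also have "\<dots> = norm (\<Sum>j<k. (a j - b j) *\<^sub>R v j)" by (simp add: sum_subtractf scaleR_diff_left)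
  also have "\<dots> \<le> (\<Sum>j<k. norm ((a j - b j) *\<^sub>R v j))" by (rule norm_sum)
  also have "\<dots> \<le> (\<Sum>j<k. \<bar>a j - b j\<bar> * B)"
    by (rule sum_mono) (use assms in \<open>auto intro: mult_left_mono\<close>)
  finally show ?thesis by (simp add: sum_distrib_right)
qed

lemma norm_lincomb_le:
  fixes v :: "nat \<Rightarrow> 'a::real_normed_vector"
  assumes "\<And>j. j < k \<Longrightarrow> norm (v j) \<le> B"
  shows "norm (\<Sum>j<k. a j *\<^sub>R v j) \<le> (\<Sum>j<k. \<bar>a j\<bar>) * B"
  using norm_lincomb_diff_le[OF assms, where a = a and b = "\<lambda>_. 0"] by simp

text \<open>Padding with zeros lets a short combination profit from the smaller error that is
  granted to long ones.\<close>

lemma sum_pad_zero: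
  fixes v :: "nat \<Rightarrow> 'a::real_vector"
  assumes "k \<le> K"
  shows "(\<Sum>j<K. (if j < k then a j else 0) *\<^sub>R v j) = (\<Sum>j<k. a j *\<^sub>R v j)"
  using assms by (intro sum.mono_neutral_cong_right) auto

text \<open>\<open>L\<close> is the norm of the spreading model on combinations of its terms.
  Working with this function postpones the choice of a Banach space that carries the model.\<close>

definition has_spreading_norm ::
    "(nat \<Rightarrow> 'a::real_normed_vector) \<Rightarrow> (nat \<Rightarrow> (nat \<Rightarrow> real) \<Rightarrow> real) \<Rightarrow> bool" where
  "has_spreading_norm x L \<longleftrightarrow>
    (\<forall>k a. ((\<lambda>n. norm (\<Sum>j<k. a j *\<^sub>R x (n j))) \<longlongrightarrow> L k a) incr_seqs)"

lemma has_spreading_normD: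
  "has_spreading_norm x L \<Longrightarrow> ((\<lambda>n. norm (\<Sum>j<k. a j *\<^sub>R x (n j))) \<longlongrightarrow> L k a) incr_seqs"
  by (simp add: has_spreading_norm_def)

lemma has_spreading_norm_subseq:
  assumes "has_spreading_norm x L" "strict_mono \<phi>"
  shows "has_spreading_norm (x \<circ> \<phi>) L"
  unfolding has_spreading_norm_def
proof (intro allI)
  fix k :: nat and a :: "nat \<Rightarrow> real"
  show "((\<lambda>n. norm (\<Sum>j<k. a j *\<^sub>R (x \<circ> \<phi>) (n j))) \<longlongrightarrow> L k a) incr_seqs"
    using filterlim_compose[OF has_spreading_normD[OF assms(1)] filterlim_comp_incr_seqs[OF assms(2)]]
    by simp
qed

lemma has_spreading_norm_scale:
  assumes "has_spreading_norm x L"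
  shows "has_spreading_norm (\<lambda>i. c *\<^sub>R x i) (\<lambda>k a. \<bar>c\<bar> * L k a)"
  unfolding has_spreading_norm_def
proof (intro allI)
  fix k :: nat and a :: "nat \<Rightarrow> real"
  have "(\<Sum>j<k. a j *\<^sub>R c *\<^sub>R x (n j)) = c *\<^sub>R (\<Sum>j<k. a j *\<^sub>R x (n j))" for n
    by (simp add: scaleR_sum_right mult.commute)
  then show "((\<lambda>n. norm (\<Sum>j<k. a j *\<^sub>R c *\<^sub>R x (n j))) \<longlongrightarrow> \<bar>c\<bar> * L k a) incr_seqs"
    by (simp add: tendsto_mult_left has_spreading_normD[OF assms])
qed

text \<open>This allows a generating sequence to be replaced by nearby members of a dense sequence,
  that is, by a code.\<close>

lemma has_spreading_norm_perturb:
  assumes "has_spreading_norm x L" "(\<lambda>i. norm (x i - x' i)) \<longlonglongrightarrow> 0"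
  shows "has_spreading_norm x' L"
  unfolding has_spreading_norm_def
proof (intro allI)
  fix k :: nat and a :: "nat \<Rightarrow> real"
  have "((\<lambda>n. \<Sum>j<k. \<bar>a j\<bar> * norm (x (n j) - x' (n j))) \<longlongrightarrow> (\<Sum>j<k. \<bar>a j\<bar> * 0)) incr_seqs"
    by (intro tendsto_sum tendsto_mult_left filterlim_compose[OF assms(2) filterlim_nth_incr_seqs])
  then have 1: "((\<lambda>n. \<Sum>j<k. \<bar>a j\<bar> * norm (x (n j) - x' (n j))) \<longlongrightarrow> 0) incr_seqs" by simp
  have 2: "\<bar>norm (\<Sum>j<k. a j *\<^sub>R x (n j)) - norm (\<Sum>j<k. a j *\<^sub>R x' (n j))\<bar>
      \<le> (\<Sum>j<k. \<bar>a j\<bar> * norm (x (n j) - x' (n j)))" for n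
  proof -
    have "\<bar>norm (\<Sum>j<k. a j *\<^sub>R x (n j)) - norm (\<Sum>j<k. a j *\<^sub>R x' (n j))\<bar>
        \<le> norm ((\<Sum>j<k. a j *\<^sub>R x (n j)) - (\<Sum>j<k. a j *\<^sub>R x' (n j)))" by (rule norm_triangle_ineq3)
    also have "\<dots> = norm (\<Sum>j<k. a j *\<^sub>R (x (n j) - x' (n j)))"
      by (simp add: sum_subtractf scaleR_diff_right)
    also have "\<dots> \<le> (\<Sum>j<k. norm (a j *\<^sub>R (x (n j) - x' (n j))))" by (rule norm_sum)
    finally show ?thesis by simp
  qed
  have "((\<lambda>n. norm (\<Sum>j<k. a j *\<^sub>R x (n j)) - norm (\<Sum>j<k. a j *\<^sub>R x' (n j))) \<longlongrightarrow> 0) incr_seqs"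
    by (rule Lim_null_comparison[OF _ 1]) (use 2 in simp)
  from tendsto_diff[OF has_spreading_normD[OF assms(1), of a k] this]
  show "((\<lambda>n. norm (\<Sum>j<k. a j *\<^sub>R x' (n j))) \<longlongrightarrow> L k a) incr_seqs" by simp
qed

lemma generates_imp_has_spreading_norm:
  assumes "generates_spreading_model x y"
  shows "has_spreading_norm x (\<lambda>k a. norm (\<Sum>j<k. a j *\<^sub>R y j))"
  unfolding has_spreading_norm_def
proof (intro allI)
  fix k :: nat and a :: "nat \<Rightarrow> real"
  obtain \<epsilon> :: "nat \<Rightarrow> real" where lim: "\<epsilon> \<longlonglongrightarrow> 0" and raw: "\<forall>k\<ge>1. \<forall>n a.
      k \<le> n 0 \<and> strict_mono_on {..<k} n \<and> (\<forall>i<k. a i \<in> {-1..1}) \<longrightarrow>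
      \<bar>norm (\<Sum>i<k. a i *\<^sub>R x (n i)) - norm (\<Sum>i<k. a i *\<^sub>R y i)\<bar> < \<epsilon> k"
    using assms unfolding generates_spreading_model_def by (elim conjE exE)
  have \<epsilon>: "\<bar>norm (\<Sum>i<k. a i *\<^sub>R x (n i)) - norm (\<Sum>i<k. a i *\<^sub>R y i)\<bar> < \<epsilon> k"
    if "k \<ge> 1" "k \<le> n 0" "strict_mono_on {..<k} n" "\<And>i. i < k \<Longrightarrow> a i \<in> {-1..1}" for k n a
    using raw[rule_format, of k n a] that by simp
  define B where "B = (\<Sum>j<k. \<bar>a j\<bar>) + 1"
  have B: "B > 0" "\<And>j. j < k \<Longrightarrow> \<bar>a j\<bar> \<le> B"
    unfolding B_def by (auto intro!: add_nonneg_pos sum_nonneg add_increasing2 member_le_sum)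
  show "((\<lambda>n. norm (\<Sum>j<k. a j *\<^sub>R x (n j))) \<longlongrightarrow> norm (\<Sum>j<k. a j *\<^sub>R y j)) incr_seqs"
  proof (rule tendstoI)
    fix e :: real assume e: "e > 0"
    \<comment> \<open>The error at length \<open>k\<close> is the fixed number
      \<open>\<epsilon> k\<close>. It becomes small only when the combination, scaled by
      \<open>1 / B\<close> into [-1,1], is read as one of a large length \<open>K\<close>.\<close>
    have "eventually (\<lambda>K. \<epsilon> K < e / B) sequentially"
      using order_tendstoD(2)[OF lim] e B by simp
    then have "eventually (\<lambda>K. \<epsilon> K < e / B \<and> K \<ge> k \<and> K \<ge> 1) sequentially"
      using eventually_ge_at_top[of k] eventually_ge_at_top[of 1] by eventually_elim auto
    then obtain K where K: "\<epsilon> K < e / B" "K \<ge> k" "K \<ge> 1" unfolding eventually_sequentially by blast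
    show "eventually (\<lambda>n. dist (norm (\<Sum>j<k. a j *\<^sub>R x (n j))) (norm (\<Sum>j<k. a j *\<^sub>R y j)) < e) incr_seqs"
    proof (rule eventually_incr_seqsI)
      fix n :: "nat \<Rightarrow> nat" assume n: "strict_mono n" "K \<le> n 0"
      have eq: "norm (\<Sum>j<K. (if j < k then a j / B else 0) *\<^sub>R v j) = norm (\<Sum>j<k. a j *\<^sub>R v j) / B"
        for v :: "nat \<Rightarrow> 'c::real_normed_vector"
      proof -
        have "(\<Sum>j<k. (a j / B) *\<^sub>R v j) = (1 / B) *\<^sub>R (\<Sum>j<k. a j *\<^sub>R v j)"
          by (simp add: scaleR_sum_right)
        then show ?thesis using B by (simp add: sum_pad_zero[OF K(2)])
      qed
      have "\<bar>norm (\<Sum>j<K. (if j < k then a j / B else 0) *\<^sub>R x (n j))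
          - norm (\<Sum>j<K. (if j < k then a j / B else 0) *\<^sub>R y j)\<bar> < \<epsilon> K"
      proof (rule \<epsilon>)
        show "(if i < k then a i / B else 0) \<in> {- 1..1}" if "i < K" for i
          using B(1) abs_le_iff[of "a i" B] B(2)[of i] by (auto simp: field_simps)
      qed (use n K in \<open>auto simp: strict_mono_on_def strict_mono_def\<close>)
      also have "\<dots> < e / B" by (rule K)
      finally have "\<bar>(norm (\<Sum>j<k. a j *\<^sub>R x (n j)) - norm (\<Sum>j<k. a j *\<^sub>R y j)) / B\<bar> < e / B"
        unfolding eq by (simp add: diff_divide_distrib)
      then show "dist (norm (\<Sum>j<k. a j *\<^sub>R x (n j))) (norm (\<Sum>j<k. a j *\<^sub>R y j)) < e"
        using B by (simp add: dist_real_def abs_divide divide_less_cancel)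
    qed
  qed
qed

lemma has_spreading_norm_Lipschitz:
  assumes L: "has_spreading_norm x L" and B: "\<And>i. norm (x i) \<le> B"
  shows "\<bar>L k a - L k b\<bar> \<le> (\<Sum>j<k. \<bar>a j - b j\<bar>) * B"
proof (rule tendsto_upperbound)
  show "((\<lambda>n. \<bar>norm (\<Sum>j<k. a j *\<^sub>R x (n j)) - norm (\<Sum>j<k. b j *\<^sub>R x (n j))\<bar>)
      \<longlongrightarrow> \<bar>L k a - L k b\<bar>) incr_seqs"
    by (intro tendsto_intros has_spreading_normD L)
  show "\<forall>\<^sub>F n in incr_seqs. \<bar>norm (\<Sum>j<k. a j *\<^sub>R x (n j)) - norm (\<Sum>j<k. b j *\<^sub>R x (n j))\<bar>
      \<le> (\<Sum>j<k. \<bar>a j - b j\<bar>) * B"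
    by (intro always_eventually allI norm_lincomb_diff_le B)
qed simp

lemma has_spreading_norm_nonneg:
  assumes "has_spreading_norm x L"
  shows "0 \<le> L k a"
  by (rule tendsto_lowerbound[OF has_spreading_normD[OF assms]]) auto

lemma has_spreading_norm_homogeneous:
  assumes L: "has_spreading_norm x L"
  shows "L k (\<lambda>j. s * a j) = \<bar>s\<bar> * L k a"
proof (rule tendsto_unique[OF incr_seqs_neq_bot has_spreading_normD[OF L]])
  have "(\<Sum>j<k. (s * a j) *\<^sub>R x (n j)) = s *\<^sub>R (\<Sum>j<k. a j *\<^sub>R x (n j))" for n
    by (simp add: scaleR_sum_right)
  then show "((\<lambda>n. norm (\<Sum>j<k. (s * a j) *\<^sub>R x (n j))) \<longlongrightarrow> \<bar>s\<bar> * L k a) incr_seqs"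
    by (simp add: tendsto_mult_left has_spreading_normD[OF L])
qed

lemma has_spreading_norm_le_l1:
  assumes L: "has_spreading_norm x L" and B: "\<And>i. norm (x i) \<le> B"
  shows "L k a \<le> (\<Sum>j<k. \<bar>a j\<bar>) * B"
proof (rule tendsto_upperbound[OF has_spreading_normD[OF L]])
  show "\<forall>\<^sub>F n in incr_seqs. norm (\<Sum>j<k. a j *\<^sub>R x (n j)) \<le> (\<Sum>j<k. \<bar>a j\<bar>) * B"
    by (intro always_eventually allI norm_lincomb_le B)
qed simp

text \<open>All functions involved are Lipschitz in the coefficients with the same constant, so
  convergence at the finitely many points of a grid of mesh \<open>1 / M\<close> gives convergence
  uniformly on the cube.\<close>

lemma has_spreading_norm_uniform:
  assumes L: "has_spreading_norm x L" and B: "\<And>i. norm (x i) \<le> B" and e: "e > 0"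
  shows "\<forall>\<^sub>F n in incr_seqs. \<forall>a. (\<forall>j<k. \<bar>a j\<bar> \<le> 1) \<longrightarrow> \<bar>norm (\<Sum>j<k. a j *\<^sub>R x (n j)) - L k a\<bar> < e"
proof -
  have B0: "B \<ge> 0" using B[of 0] norm_ge_zero order_trans by blast
  obtain M :: nat where M0: "M > 3 * (real k * B) / e" using reals_Archimedean2 by blast
  then have Mpos: "M > 0" using B0 e by (cases "M = 0") (auto simp: field_simps not_le mult_less_0_iff)
  then have M: "real k * B / M < e / 3" using M0 e by (simp add: field_simps)
  define G where "G = PiE {..<k} (\<lambda>_. (\<lambda>i::int. of_int i / M) ` {-int M..int M})"
  have "finite G" unfolding G_def by (intro finite_PiE) auto
  moreover have "\<forall>b\<in>G. \<forall>\<^sub>F n in incr_seqs. \<bar>norm (\<Sum>j<k. b j *\<^sub>R x (n j)) - L k b\<bar> < e/3"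
    using tendstoD[OF has_spreading_normD[OF L], of "e/3"] e by (simp add: dist_real_def)
  ultimately have "\<forall>\<^sub>F n in incr_seqs. \<forall>b\<in>G. \<bar>norm (\<Sum>j<k. b j *\<^sub>R x (n j)) - L k b\<bar> < e/3"
    by (rule eventually_ball_finite)
  then show ?thesis
  proof eventually_elim
    case (elim n)
    show ?case
    proof (intro allI impI)
      fix a :: "nat \<Rightarrow> real" assume a: "\<forall>j<k. \<bar>a j\<bar> \<le> 1"
      \<comment> \<open>The value \<open>undefined\<close> outside \<open>{..<k}\<close> puts
        \<open>b\<close> into the extensional function space, which is what makes the grid
        \<open>G\<close> finite.\<close>
      define b where "b j = (if j < k then of_int \<lfloor>a j * M\<rfloor> / real M else undefined)" for j
      have "b \<in> G" unfolding G_def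
      proof (rule PiE_I)
        fix j assume "j \<in> {..<k}"
        with a have "j < k" "\<bar>a j\<bar> \<le> 1" by auto
        then have "-1 * real M \<le> a j * real M" "a j * real M \<le> 1 * real M"
          by (intro mult_right_mono; simp)+
        then have "\<lfloor>a j * real M\<rfloor> \<in> {-int M..int M}" by (auto simp: le_floor_iff floor_le_iff)
        then show "b j \<in> (\<lambda>i::int. of_int i / M) ` {-int M..int M}"
          using \<open>j < k\<close> unfolding b_def by auto
      qed (simp add: b_def)
      with elim have 1: "\<bar>norm (\<Sum>j<k. b j *\<^sub>R x (n j)) - L k b\<bar> < e/3" by blast
      have "\<bar>a j - b j\<bar> \<le> 1 / M" if "j < k" for j
      proof -
        have "\<bar>a j * M - of_int \<lfloor>a j * M\<rfloor>\<bar> \<le> 1" by linarith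
        moreover have "a j - b j = (a j * M - of_int \<lfloor>a j * M\<rfloor>) / M"
          using that Mpos by (simp add: b_def field_simps)
        ultimately show ?thesis using Mpos by (simp add: abs_divide divide_right_mono)
      qed
      then have "(\<Sum>j<k. \<bar>a j - b j\<bar>) \<le> (\<Sum>j<k. 1 / M)" by (intro sum_mono) auto
      then have "(\<Sum>j<k. \<bar>a j - b j\<bar>) * B \<le> (real k / M) * B" using B0 by (intro mult_right_mono) auto
      with M have 2: "(\<Sum>j<k. \<bar>a j - b j\<bar>) * B < e/3" by (simp, linarith)
      show "\<bar>norm (\<Sum>j<k. a j *\<^sub>R x (n j)) - L k a\<bar> < e"
        using 1 2 has_spreading_norm_Lipschitz[OF L B, of k a b]
          norm_lincomb_diff_le[of k "\<lambda>j. x (n j)" B a b, OF B] by linarith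
    qed
  qed
qed

lemma has_spreading_norm_fast_subseq:
  assumes L: "has_spreading_norm x L" and B: "\<And>i. norm (x i) \<le> B"
  obtains \<phi> where "strict_mono \<phi>" "\<phi> 0 \<ge> s"
    "\<And>k n a. strict_mono n \<Longrightarrow> k \<le> n 0 \<Longrightarrow> (\<And>j. j < k \<Longrightarrow> \<bar>a j\<bar> \<le> 1) \<Longrightarrow>
      \<bar>norm (\<Sum>j<k. a j *\<^sub>R (x \<circ> \<phi>) (n j)) - L k a\<bar> < 1 / Suc k"
proof -
  have "\<exists>m. \<forall>n. strict_mono n \<and> m \<le> n 0 \<longrightarrow>
      (\<forall>a. (\<forall>j<k. \<bar>a j\<bar> \<le> 1) \<longrightarrow> \<bar>norm (\<Sum>j<k. a j *\<^sub>R x (n j)) - L k a\<bar> < 1 / Suc k)" for k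
    using has_spreading_norm_uniform[OF L B, of "1 / Suc k" k] unfolding eventually_incr_seqs by simp
  then obtain T where T: "\<And>k n a. strict_mono n \<Longrightarrow> T k \<le> n 0 \<Longrightarrow> (\<And>j. j < k \<Longrightarrow> \<bar>a j\<bar> \<le> 1)
      \<Longrightarrow> \<bar>norm (\<Sum>j<k. a j *\<^sub>R x (n j)) - L k a\<bar> < 1 / Suc k" by metis
  \<comment> \<open>The sum exceeds every threshold \<open>T k\<close> with
    \<open>k \<le> i\<close>, so a tuple that starts at \<open>n 0 \<ge> k\<close> in the
    subsequence starts beyond \<open>T k\<close> in \<open>x\<close>. The summand \<open>s\<close>
    skips a finite part of \<open>x\<close> on request.\<close>
  define \<phi> where "\<phi> i = s + i + (\<Sum>k\<le>i. T k)" for i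
  have \<phi>: "strict_mono \<phi>" unfolding strict_mono_Suc_iff \<phi>_def by simp
  show thesis
  proof (rule that[OF \<phi>])
    show "s \<le> \<phi> 0" by (simp add: \<phi>_def)
    fix k :: nat and n :: "nat \<Rightarrow> nat" and a :: "nat \<Rightarrow> real" assume n: "strict_mono n" "k \<le> n 0" and a: "\<And>j. j < k \<Longrightarrow> \<bar>a j\<bar> \<le> 1"
    have "T k \<le> (\<Sum>k\<le>n 0. T k)" by (rule member_le_sum) (use n in auto)
    then have "T k \<le> (\<phi> \<circ> n) 0" by (simp add: \<phi>_def)
    from T[OF strict_mono_o[OF \<phi> n(1)] this, of a] a
    show "\<bar>norm (\<Sum>j<k. a j *\<^sub>R (x \<circ> \<phi>) (n j)) - L k a\<bar> < 1 / Suc k" by simp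
  qed
qed

lemma extend_strict_mono_on:
  fixes n :: "nat \<Rightarrow> nat"
  assumes "strict_mono_on {..<k} n" "k \<ge> 1"
  obtains n' where "strict_mono n'" "\<And>j. j < k \<Longrightarrow> n' j = n j"
proof (rule that)
  show "strict_mono (\<lambda>j. if j < k then n j else n (k - 1) + j)"
    unfolding strict_mono_Suc_iff
  proof
    fix j
    show "(if j < k then n j else n (k - 1) + j) < (if Suc j < k then n (Suc j) else n (k - 1) + Suc j)"
    proof (cases "j < k")
      case True
      then have "n j \<le> n (k - 1)"
        using strict_mono_on_leD[OF assms(1), of j "k - 1"] assms(2) by simp
      moreover have "Suc j < k \<Longrightarrow> n j < n (Suc j)"
        using strict_mono_onD[OF assms(1), of j "Suc j"] by simp
      ultimately show ?thesis by auto
    qed simp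
  qed
qed simp

lemma generates_spreading_modelI:
  assumes x: "seminormalized x"
    and L: "\<And>k n a. strict_mono n \<Longrightarrow> k \<le> n 0 \<Longrightarrow> (\<And>j. j < k \<Longrightarrow> \<bar>a j\<bar> \<le> 1) \<Longrightarrow>
      \<bar>norm (\<Sum>j<k. a j *\<^sub>R x (n j)) - norm (\<Sum>j<k. a j *\<^sub>R y j)\<bar> < C / Suc k"
  shows "generates_spreading_model x y"
  unfolding generates_spreading_model_def
proof (intro conjI x exI[of _ "\<lambda>k. C / Suc k"] allI impI)
  \<comment> \<open>At \<open>k = 0\<close> both norms vanish, and the hypothesis yields
    \<open>C > 0\<close>.\<close>
  have "\<bar>norm (\<Sum>j<0. 0 *\<^sub>R x j) - norm (\<Sum>j<0. 0 *\<^sub>R y j)\<bar> < C / Suc 0"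
    by (rule L[of "\<lambda>j. j"]) (auto simp: strict_mono_def)
  then have C: "C > 0" by simp
  show "decseq (\<lambda>k. C / real (Suc k))"
    by (rule decseq_SucI) (use C in \<open>simp add: field_simps\<close>)
  show "(\<lambda>k. C / real (Suc k)) \<longlonglongrightarrow> 0"
    using tendsto_mult_left[OF LIMSEQ_inverse_real_of_nat, of C] by (simp add: field_simps)
next
  fix k :: nat and n :: "nat \<Rightarrow> nat" and a :: "nat \<Rightarrow> real"
  assume k: "1 \<le> k" and *: "k \<le> n 0 \<and> strict_mono_on {..<k} n \<and> (\<forall>i<k. a i \<in> {-1..1})"
  then obtain n' where n': "strict_mono n'" "\<And>j. j < k \<Longrightarrow> n' j = n j"
    using extend_strict_mono_on by blast
  have "\<bar>norm (\<Sum>j<k. a j *\<^sub>R x (n' j)) - norm (\<Sum>j<k. a j *\<^sub>R y j)\<bar> < C / Suc k"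
    using * k n' by (intro L) (auto simp: abs_le_iff)
  then show "\<bar>norm (\<Sum>i<k. a i *\<^sub>R x (n i)) - norm (\<Sum>i<k. a i *\<^sub>R y i)\<bar> < C / Suc k"
    using n' by simp
qed

subsection \<open>Ramsey and Brunel-Sucheston arguments\<close>

text \<open>Colour a \<open>k\<close>-set by the interval of length \<open>e\<close> that contains
  the value of \<open>F\<close> at its increasing enumeration; boundedness leaves finitely many
  colours.\<close>

lemma Ramsey_oscillation:
  fixes F :: "(nat \<Rightarrow> nat) \<Rightarrow> real"
  assumes bnd: "\<And>n. \<bar>F n\<bar> \<le> B" and dep: "\<And>n n'. (\<And>j. j < k \<Longrightarrow> n j = n' j) \<Longrightarrow> F n = F n'"
    and e: "e > 0"
  obtains r :: "nat \<Rightarrow> nat" where "strict_mono r"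
    "\<And>n n'. strict_mono n \<Longrightarrow> strict_mono n' \<Longrightarrow> \<bar>F (r \<circ> n) - F (r \<circ> n')\<bar> \<le> e"
proof -
  \<comment> \<open>Indexing the list beyond its length gives unspecified values, which is harmless
    by \<open>dep\<close> once \<open>X\<close> has \<open>k\<close> elements.\<close>
  define f where "f X = nat \<lfloor>(F (\<lambda>j. sorted_list_of_set X ! j) + B) / e\<rfloor>" for X
  define S where "S = Suc (nat \<lfloor>2 * B / e\<rfloor>)"
  have fS: "f X < S" for X
  proof -
    have "(F (\<lambda>j. sorted_list_of_set X ! j) + B) / e \<le> 2 * B / e"
      using bnd[of "\<lambda>j. sorted_list_of_set X ! j"] e by (intro divide_right_mono) auto
    then have "f X \<le> nat \<lfloor>2 * B / e\<rfloor>" unfolding f_def by (intro nat_mono floor_mono)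
    then show ?thesis by (simp add: S_def)
  qed
  obtain Y t where Y: "infinite (Y :: nat set)" and t: "\<And>X. X \<subseteq> Y \<Longrightarrow> finite X \<Longrightarrow> card X = k \<Longrightarrow> f X = t"
    using Ramsey[of "UNIV :: nat set" k f S] fS by auto
  define r where "r = enumerate Y"
  have r: "strict_mono r" unfolding r_def by (rule strict_mono_enumerate[OF Y])
  have val: "real t \<le> (F (r \<circ> n) + B) / e \<and> (F (r \<circ> n) + B) / e < real t + 1" if n: "strict_mono n" for n
  proof -
    define X where "X = (r \<circ> n) ` {..<k}"
    have rn: "strict_mono (r \<circ> n)" by (rule strict_mono_o[OF r n])
    have "card X = k"
      unfolding X_def using inj_on_subset[OF strict_mono_imp_inj_on[OF rn] subset_UNIV]
      by (simp only: card_image card_lessThan)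
    then have X: "X \<subseteq> Y" "finite X" "card X = k"
      unfolding X_def r_def using enumerate_in_set[OF Y] by auto
    have "sorted_list_of_set X = map (r \<circ> n) [0..<k]"
    proof (rule sorted_distinct_set_unique)
      show "sorted (map (r \<circ> n) [0..<k])"
        by (auto simp: sorted_iff_nth_mono strict_mono_less_eq[OF rn, unfolded o_def])
      show "distinct (map (r \<circ> n) [0..<k])"
        using rn by (simp add: distinct_map strict_mono_imp_inj_on inj_on_subset)
      show "set (sorted_list_of_set X) = set (map (r \<circ> n) [0..<k])"
        using X(2) unfolding X_def by (simp add: atLeast0LessThan)
    qed simp_all
    then have "F (\<lambda>j. sorted_list_of_set X ! j) = F (r \<circ> n)" by (intro dep) simp
    with t[OF X] have "nat \<lfloor>(F (r \<circ> n) + B) / e\<rfloor> = t" by (simp add: f_def)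
    moreover have "(F (r \<circ> n) + B) / e \<ge> 0" using bnd[of "r \<circ> n"] e by simp
    ultimately show ?thesis by linarith
  qed
  show thesis
  proof (rule that[OF r])
    fix n n' :: "nat \<Rightarrow> nat" assume "strict_mono n" "strict_mono n'"
    from val[OF this(1)] val[OF this(2)] e show "\<bar>F (r \<circ> n) - F (r \<circ> n')\<bar> \<le> e"
      by (simp add: pos_le_divide_eq pos_divide_less_eq distrib_right abs_le_iff)
  qed
qed

text \<open>A requirement is an oscillation bound for one function at one precision. Requirements
  are inherited by subsequences, so the diagonal meets each of them from some stage on, and this is
  the Cauchy condition for all \<open>F m\<close> at once.\<close>

lemma Ramsey_diagonal:
  fixes F :: "nat \<Rightarrow> (nat \<Rightarrow> nat) \<Rightarrow> real"
  assumes bnd: "\<And>m n. \<bar>F m n\<bar> \<le> B m"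
    and dep: "\<And>m n n'. (\<And>j. j < k m \<Longrightarrow> n j = n' j) \<Longrightarrow> F m n = F m n'"
  obtains \<phi> :: "nat \<Rightarrow> nat" where "strict_mono \<phi>" "\<And>m. \<exists>l. ((\<lambda>n. F m (\<phi> \<circ> n)) \<longlongrightarrow> l) incr_seqs"
proof -
  let ?m = "\<lambda>i. fst (prod_decode i)" and ?N = "\<lambda>i. snd (prod_decode i)"
  define P where "P i s \<longleftrightarrow> (\<forall>n n'. strict_mono n \<and> strict_mono n' \<longrightarrow>
    \<bar>F (?m i) (s \<circ> n) - F (?m i) (s \<circ> n')\<bar> \<le> 1 / Suc (?N i))"
    for i and s :: "nat \<Rightarrow> nat"
  interpret subseqs P
  proof
    fix i and s :: "nat \<Rightarrow> nat" assume s: "strict_mono s"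
    show "\<exists>r'. strict_mono r' \<and> P i (s \<circ> r')"
    proof (rule Ramsey_oscillation[of "\<lambda>n. F (?m i) (s \<circ> n)"])
      show "\<bar>F (?m i) (s \<circ> n)\<bar> \<le> B (?m i)" for n by (rule bnd)
      show "F (?m i) (s \<circ> n) = F (?m i) (s \<circ> n')"
        if "\<And>j. j < k (?m i) \<Longrightarrow> n j = n' j" for n n'
        using that by (intro dep) auto
      show "(0::real) < 1 / Suc (?N i)" by simp
    next
      fix r :: "nat \<Rightarrow> nat" assume r: "strict_mono r"
        and *: "\<And>n n'. strict_mono n \<Longrightarrow> strict_mono n' \<Longrightarrow> \<bar>F (?m i) (s \<circ> (r \<circ> n)) -
          F (?m i) (s \<circ> (r \<circ> n'))\<bar> \<le> 1 / Suc (?N i)"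
      show ?thesis using r * unfolding P_def by (auto simp: comp_assoc intro!: exI[of _ r])
    qed
  qed
  have stable: "P i (s \<circ> r)" if "strict_mono r" "P i s" for r s i
    using that unfolding P_def comp_assoc by (blast intro: strict_mono_o)
  show thesis
  proof (rule that[OF subseq_diagseq])
    fix m
    show "\<exists>l. ((\<lambda>n. F m (diagseq \<circ> n)) \<longlongrightarrow> l) incr_seqs"
      unfolding convergent_incr_seqs_iff_Cauchy
    proof (intro allI impI)
      fix e :: real assume "e > 0"
      then obtain N where N: "1 / Suc N < e" using nat_approx_posE by blast
      define i where "i = prod_encode (m, N)"
      have P: "P i (diagseq \<circ> ((+) (Suc i)))" by (rule diagseq_holds[OF stable])
      show "\<exists>M. \<forall>n n'. strict_mono n \<and> strict_mono n' \<and> M \<le> n 0 \<and> M \<le> n' 0 \<longrightarrow>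
          \<bar>F m (diagseq \<circ> n) - F m (diagseq \<circ> n')\<bar> < e"
      proof (intro exI[of _ "Suc i"] allI impI, elim conjE)
        \<comment> \<open>A sequence that starts beyond \<open>i\<close> factors through the shift
          by \<open>Suc i\<close>, past which the diagonal satisfies requirement
          \<open>i\<close>.\<close>
        have shift: "strict_mono (\<lambda>j. n j - Suc i) \<and> n = (+) (Suc i) \<circ> (\<lambda>j. n j - Suc i)"
          if n: "strict_mono n" "Suc i \<le> n 0" for n :: "nat \<Rightarrow> nat"
        proof -
          have ge: "Suc i \<le> n j" for j using strict_mono_nat_ge[OF n(1), of j] n(2) by simp
          have "n j - Suc i < n (Suc j) - Suc i" for j
            using strict_monoD[OF n(1), of j "Suc j"] ge[of j] by simp
          moreover have "n j = Suc i + (n j - Suc i)" for j using ge[of j] by linarith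
          ultimately show ?thesis unfolding strict_mono_Suc_iff fun_eq_iff o_def by blast
        qed
        fix n n' :: "nat \<Rightarrow> nat"
        assume "strict_mono n" "strict_mono n'" "Suc i \<le> n 0" "Suc i \<le> n' 0"
        then obtain h h' where h: "strict_mono h" "strict_mono h'"
          "n = (+) (Suc i) \<circ> h" "n' = (+) (Suc i) \<circ> h'" using shift[of n] shift[of n'] by blast
        have "\<bar>F m (diagseq \<circ> n) - F m (diagseq \<circ> n')\<bar> \<le> 1 / Suc N"
          using P h unfolding P_def i_def by (simp add: comp_assoc)
        with N show "\<bar>F m (diagseq \<circ> n) - F m (diagseq \<circ> n')\<bar> < e" by simp
      qed
    qed
  qed
qed

text \<open>One subsequence serves all rows and all coefficients: there are only countably many
  lists of pairs of a row and a rational, and real coefficients are approximated by rational ones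
  uniformly in \<open>n\<close>.\<close>

lemma Brunel_Sucheston_array:
  fixes w :: "nat \<Rightarrow> nat \<Rightarrow> 'a::real_normed_vector"
  assumes B: "\<And>m i. norm (w m i) \<le> B"
  obtains \<phi> :: "nat \<Rightarrow> nat" where "strict_mono \<phi>"
    "\<And>k \<nu> a. \<exists>l. ((\<lambda>n. norm (\<Sum>j<k. a j *\<^sub>R w (\<nu> j) (\<phi> (n j)))) \<longlongrightarrow> l) incr_seqs"
proof -
  define q :: "nat \<Rightarrow> (nat \<times> rat) list" where "q = from_nat"
  define F where "F i n = norm (\<Sum>j<length (q i).
    of_rat (snd (q i ! j)) *\<^sub>R w (fst (q i ! j)) (n j))"
    for i and n :: "nat \<Rightarrow> nat"
  obtain \<phi> where \<phi>: "strict_mono \<phi>" "\<And>i. \<exists>l. ((\<lambda>n. F i (\<phi> \<circ> n)) \<longlongrightarrow> l) incr_seqs"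
  proof (rule Ramsey_diagonal[of F])
    show "\<bar>F i n\<bar> \<le> (\<Sum>j<length (q i).
        \<bar>of_rat (snd (q i ! j))\<bar>) * B" for i n
      unfolding F_def abs_norm_cancel by (rule norm_lincomb_le) (rule B)
    show "F i n = F i n'" if "\<And>j. j < length (q i) \<Longrightarrow> n j = n' j" for i n n'
      using that unfolding F_def by simp
  qed blast
  have B0: "B \<ge> 0" using B[of 0 0] norm_ge_zero order_trans by blast
  show thesis
  proof (rule that[OF \<phi>(1)])
    fix k \<nu> and a :: "nat \<Rightarrow> real"
    show "\<exists>l. ((\<lambda>n. norm (\<Sum>j<k. a j *\<^sub>R w (\<nu> j) (\<phi> (n j)))) \<longlongrightarrow> l) incr_seqs"
    proof (rule convergent_incr_seqs_approx)
      fix e :: real assume e: "e > 0"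
      define d where "d = e / (real k * B + 1)"
      have pos: "real k * B + 1 > 0" using B0 by (simp add: add_nonneg_pos)
      with e have d: "d > 0" by (simp add: d_def)
      have "\<exists>q. \<bar>a j - of_rat q\<bar> < d" for j
      proof -
        have "a j - d < a j + d" using d by simp
        from of_rat_dense[OF this] show ?thesis by (auto simp: abs_less_iff algebra_simps)
      qed
      then obtain b where b: "\<And>j. \<bar>a j - of_rat (b j)\<bar> < d" by metis
      define i where "i = to_nat (map (\<lambda>j. (\<nu> j, b j)) [0..<k])"
      have F: "F i (\<phi> \<circ> n) = norm (\<Sum>j<k. of_rat (b j) *\<^sub>R w (\<nu> j) (\<phi> (n j)))" for n
        unfolding F_def i_def q_def by simp
      have "\<bar>norm (\<Sum>j<k. a j *\<^sub>R w (\<nu> j) (\<phi> (n j))) - F i (\<phi> \<circ> n)\<bar> \<le> e" for n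
      proof -
        have "\<bar>norm (\<Sum>j<k. a j *\<^sub>R w (\<nu> j) (\<phi> (n j))) - F i (\<phi> \<circ> n)\<bar>
            \<le> (\<Sum>j<k. \<bar>a j - of_rat (b j)\<bar>) * B"
          unfolding F by (rule norm_lincomb_diff_le) (rule B)
        also have "\<dots> \<le> (\<Sum>j<k. d) * B"
          by (intro mult_right_mono sum_mono B0) (use b in \<open>auto intro: less_imp_le\<close>)
        also have "\<dots> = d * (real k * B)" by simp
        also have "\<dots> \<le> d * (real k * B + 1)" using d by (intro mult_left_mono) auto
        also have "\<dots> = e" using pos by (simp add: d_def)
        finally show ?thesis .
      qed
      then show "\<exists>G l. (G \<longlongrightarrow> l) incr_seqs \<and>
          (\<forall>\<^sub>F n in incr_seqs. \<bar>norm (\<Sum>j<k. a j *\<^sub>R w (\<nu> j) (\<phi> (n j))) - G n\<bar> \<le> e)"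
        using \<phi>(2)[of i] by auto
    qed
  qed
qed

subsection \<open>Suppression unconditionality\<close>

text \<open>If the convex hull of a tail kept distance \<open>e\<close> from 0, then Hahn-Banach
  would give a bounded functional that is at least \<open>e\<close> on the whole tail.\<close>

lemma Mazur_weakly_null:
  fixes x :: "nat \<Rightarrow> 'a::real_normed_vector"
  assumes x: "weakly_null x" and e: "e > 0"
  obtains I l where "finite I" "I \<subseteq> {m..}" "\<And>i. i \<in> I \<Longrightarrow> l i \<ge> 0" "sum l I = 1"
    "norm (\<Sum>i\<in>I. l i *\<^sub>R x i) < e"
proof -
  define C where "C = convex hull (x ` {m..})"
  have "\<exists>c\<in>C. norm c < e"
  proof (rule ccontr)
    assume "\<not> (\<exists>c\<in>C. norm c < e)"
    then have far: "\<And>c. c \<in> C \<Longrightarrow> e \<le> norm c" by force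
    have ne: "x m \<in> C" unfolding C_def by (rule hull_inc) auto
    \<comment> \<open>The term \<open>- t * e\<close> forces \<open>p (- c) \<le> - e\<close> for
      every \<open>c\<close> in the hull, so any linear functional below \<open>p\<close> separates.
      Convexity of \<open>C\<close> makes \<open>p\<close> subadditive:
      \<open>s *\<^sub>R d + t *\<^sub>R c\<close> is \<open>s + t\<close> times a point of
      \<open>C\<close>.\<close>
    define P where "P u = {norm (u + t *\<^sub>R c) - t * e | t c. t \<ge> 0 \<and> c \<in> C}" for u
    define p where "p u = Inf (P u)" for u
    have lb: "- norm u \<le> norm (u + t *\<^sub>R c) - t * e" if "t \<ge> 0" "c \<in> C" for u t c
    proof -
      have "t * e \<le> t * norm c" using far[OF that(2)] that(1) by (rule mult_left_mono)
      also have "\<dots> = norm (t *\<^sub>R c)" using that by simp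
      also have "\<dots> \<le> norm (u + t *\<^sub>R c) + norm u"
        using norm_triangle_ineq4[of "u + t *\<^sub>R c" u] by simp
      finally show ?thesis by simp
    qed
    have bdd: "bdd_below (P u)" for u
      unfolding P_def using lb by (intro bdd_belowI[of _ "- norm u"]) auto
    have le: "p u \<le> norm (u + t *\<^sub>R c) - t * e" if "t \<ge> 0" "c \<in> C" for u t c
      unfolding p_def by (rule cInf_lower[OF _ bdd]) (use that in \<open>auto simp: P_def\<close>)
    have ge: "y \<le> p u" if "\<And>t c. t \<ge> 0 \<Longrightarrow> c \<in> C \<Longrightarrow> y \<le> norm (u + t *\<^sub>R c) - t * e" for y u
      unfolding p_def by (rule cInf_greatest) (use that ne in \<open>auto simp: P_def\<close>)
    have add: "p (u + v) \<le> p u + p v" for u v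
    proof -
      have "p (u + v) - p u \<le> p v"
      proof (rule ge)
        fix t c assume tc: "(t::real) \<ge> 0" "c \<in> C"
        have "p (u + v) - (norm (v + t *\<^sub>R c) - t * e) \<le> p u"
        proof (rule ge)
          fix s d assume sd: "(s::real) \<ge> 0" "d \<in> C"
          obtain b where b: "b \<in> C" "(s + t) *\<^sub>R b = s *\<^sub>R d + t *\<^sub>R c"
          proof (cases "s + t = 0")
            case True
            then show thesis using tc sd that[of c] by (simp add: add_nonneg_eq_0_iff)
          next
            case False
            then have pos: "s + t > 0" using tc sd by simp
            have "(s / (s + t)) *\<^sub>R d + (t / (s + t)) *\<^sub>R c \<in> C"
              unfolding C_def by (rule convexD[OF convex_convex_hull])
                (use tc sd pos in \<open>auto simp: C_def add_divide_distrib[symmetric]\<close>)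
            with pos show thesis by (intro that) (auto simp: scaleR_add_right)
          qed
          have "p (u + v) \<le> norm ((u + v) + (s + t) *\<^sub>R b) - (s + t) * e"
            using tc sd b by (intro le) auto
          also have "(u + v) + (s + t) *\<^sub>R b = (u + s *\<^sub>R d) + (v + t *\<^sub>R c)"
            unfolding b(2) by (simp add: algebra_simps)
          also have "norm \<dots> \<le> norm (u + s *\<^sub>R d) + norm (v + t *\<^sub>R c)" by (rule norm_triangle_ineq)
          finally show "p (u + v) - (norm (v + t *\<^sub>R c) - t * e) \<le> norm (u + s *\<^sub>R d) - s * e"
            by (simp add: algebra_simps)
        qed
        then show "p (u + v) - p u \<le> norm (v + t *\<^sub>R c) - t * e" by simp
      qed
      then show ?thesis by simp
    qed
    have hom_le: "r * p u \<le> p (r *\<^sub>R u)" if r: "r > 0" for r u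
    proof (rule ge)
      fix t c assume tc: "(t::real) \<ge> 0" "c \<in> C"
      have "r * p u \<le> r * (norm (u + (t / r) *\<^sub>R c) - (t / r) * e)"
        using tc r by (intro mult_left_mono le) auto
      also have "\<dots> = norm (r *\<^sub>R (u + (t / r) *\<^sub>R c)) - t * e"
        unfolding norm_scaleR using r by (simp add: right_diff_distrib)
      also have "r *\<^sub>R (u + (t / r) *\<^sub>R c) = r *\<^sub>R u + t *\<^sub>R c" using r by (simp add: scaleR_add_right)
      finally show "r * p u \<le> norm (r *\<^sub>R u + t *\<^sub>R c) - t * e" .
    qed
    have p0: "p 0 = 0"
    proof (rule antisym)
      show "p 0 \<le> 0" using le[of 0 "x m" 0] ne by simp
      show "0 \<le> p 0" by (rule ge) (use lb[of _ _ 0] in simp)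
    qed
    have hom: "p (r *\<^sub>R u) = r * p u" if "r \<ge> 0" for r u
    proof (cases "r = 0")
      case False
      with that have r: "r > 0" by simp
      then have "(1 / r) * p (r *\<^sub>R u) \<le> p ((1 / r) *\<^sub>R r *\<^sub>R u)" by (intro hom_le) simp
      then have "p (r *\<^sub>R u) \<le> r * p u" using r by (simp add: field_simps)
      with hom_le[OF r, of u] show ?thesis by simp
    qed (simp add: p0)
    have "sublinear p" unfolding sublinear_def using add hom by blast
    then obtain f where f: "linear f" "f \<le> p" using hahn_banach_sublinear by blast
    have fn: "f u \<le> norm u" for u using le_funD[OF f(2), of u] le[of 0 "x m" u] ne by simp
    have "\<bar>f u\<bar> \<le> norm u" for u using fn[of u] fn[of "- u"] linear_neg[OF f(1), of u] by simp
    then have bl: "bounded_linear f"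
      using f(1) by (intro bounded_linear.intro bounded_linear_axioms.intro exI[of _ 1]) auto
    have fC: "e \<le> f (x i)" if "i \<ge> m" for i
    proof -
      have xi: "x i \<in> C" unfolding C_def by (rule hull_inc) (use that in auto)
      have "f (- x i) \<le> norm (- x i + 1 *\<^sub>R x i) - 1 * e"
        using le_funD[OF f(2), of "- x i"] le[of 1 "x i" "- x i"] xi by simp
      then show ?thesis using linear_neg[OF f(1), of "x i"] by simp
    qed
    have "(\<lambda>n. f (x n)) \<longlonglongrightarrow> 0" using x bl unfolding weakly_null_def by blast
    then have "e \<le> 0" by (rule tendsto_lowerbound) (use fC in \<open>auto simp: eventually_sequentially\<close>)
    with e show False by simp
  qed
  then obtain c where c: "c \<in> convex hull (x ` {m..})" "norm c < e" unfolding C_def by blast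
  then obtain S u where S: "finite S" "S \<subseteq> x ` {m..}" "\<forall>v\<in>S. 0 \<le> u v" "sum u S = 1"
    "(\<Sum>v\<in>S. u v *\<^sub>R v) = c" unfolding convex_hull_explicit by blast
  \<comment> \<open>The weights of the convex combination belong to vectors, and several indices may
    carry the same vector; \<open>I\<close> picks one index for each.\<close>
  obtain I where I: "I \<subseteq> {m..}" "inj_on x I" "S = x ` I" using S(2) unfolding subset_image_inj by blast
  show thesis
  proof (rule that[of I "u \<circ> x"])
    show "finite I" using S(1) I finite_image_iff by blast
    show "sum (u \<circ> x) I = 1" using S(4) I by (simp add: sum.reindex)
    show "norm (\<Sum>i\<in>I. (u \<circ> x) i *\<^sub>R x i) < e" using S(5) c I by (simp add: sum.reindex)
  qed (use S I in auto)
qed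

text \<open>The row may change with the position, as prescribed by \<open>\<nu>\<close>; a
  combination of mixtures of rows takes this form once its double sum is flattened.\<close>

definition has_joint_norm :: "(nat \<Rightarrow> nat \<Rightarrow> 'a::real_normed_vector) \<Rightarrow>
    (nat \<Rightarrow> (nat \<Rightarrow> nat) \<Rightarrow> (nat \<Rightarrow> real) \<Rightarrow> real) \<Rightarrow> bool" where
  "has_joint_norm w \<Lambda> \<longleftrightarrow>
    (\<forall>k \<nu> a. ((\<lambda>n. norm (\<Sum>j<k. a j *\<^sub>R w (\<nu> j) (n j))) \<longlongrightarrow> \<Lambda> k \<nu> a) incr_seqs)"

lemma has_joint_normD:
  "has_joint_norm w \<Lambda> \<Longrightarrow> ((\<lambda>n. norm (\<Sum>j<k. a j *\<^sub>R w (\<nu> j) (n j))) \<longlongrightarrow> \<Lambda> k \<nu> a) incr_seqs"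
  by (simp add: has_joint_norm_def)

text \<open>A small convex combination of far terms replaces the term to be suppressed; by the
  convexity of the norm and its asymptotic independence of the index this costs nothing.\<close>

lemma joint_norm_suppress:
  assumes w: "weakly_null (w (\<nu> i))" and L: "has_joint_norm w \<Lambda>" and i: "i < k"
  shows "\<Lambda> k \<nu> (a(i := 0)) \<le> \<Lambda> k \<nu> a"
proof (rule field_le_epsilon)
  fix \<epsilon> :: real assume "\<epsilon> > 0"
  define e where "e = \<epsilon> / 3"
  have e: "e > 0" using \<open>\<epsilon> > 0\<close> by (simp add: e_def)
  have near: "\<exists>m. \<forall>n. strict_mono n \<and> m \<le> n 0 \<longrightarrow>
      \<bar>norm (\<Sum>j<k. b j *\<^sub>R w (\<nu> j) (n j)) - \<Lambda> k \<nu> b\<bar> < e" for b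
    using tendstoD[OF has_joint_normD[OF L] e, of b \<nu> k]
    unfolding eventually_incr_seqs dist_real_def .
  define b where "b = a(i := 0)"
  obtain m1 m2 where m1: "\<And>n. strict_mono n \<Longrightarrow> m1 \<le> n 0 \<Longrightarrow>
      \<bar>norm (\<Sum>j<k. a j *\<^sub>R w (\<nu> j) (n j)) - \<Lambda> k \<nu> a\<bar> < e"
    and m2: "\<And>n. strict_mono n \<Longrightarrow> m2 \<le> n 0 \<Longrightarrow>
      \<bar>norm (\<Sum>j<k. b j *\<^sub>R w (\<nu> j) (n j)) - \<Lambda> k \<nu> b\<bar> < e"
    using near[of a] near[of b] by blast
  define m where "m = max m1 m2"
  have "e / (\<bar>a i\<bar> + 1) > 0" using e by (simp add: add_nonneg_pos)
  from Mazur_weakly_null[OF w this, of "m + i"] obtain I l where I: "finite I" "I \<subseteq> {m + i..}"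
    and l: "\<And>r. r \<in> I \<Longrightarrow> l r \<ge> 0" "sum l I = 1"
    and small: "norm (\<Sum>r\<in>I. l r *\<^sub>R w (\<nu> i) r) < e / (\<bar>a i\<bar> + 1)" by blast
  have "I \<noteq> {}" using l by auto
  \<comment> \<open>Only the \<open>i\<close>-th index varies with \<open>r\<close>. The
    \<open>i\<close> earlier ones lie below \<open>m + i \<le> r\<close> and the later ones beyond
    \<open>Max I\<close>, so every \<open>n r\<close> is increasing and the other terms always add
    up to the same vector \<open>R\<close>.\<close>
  define n where "n r j = (if j < i then m + j else if j = i then r else Max I + j)" for r j
  have n: "strict_mono (n r)" "m \<le> n r 0" if "r \<in> I" for r
  proof -
    have "m + i \<le> r" "r \<le> Max I" using that I by auto
    then show "strict_mono (n r)" "m \<le> n r 0" unfolding strict_mono_Suc_iff by (auto simp: n_def)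
  qed
  define R where "R = (\<Sum>j\<in>{..<k} - {i}. a j *\<^sub>R w (\<nu> j) (if j < i then m + j else Max I + j))"
  have split: "(\<Sum>j<k. c j *\<^sub>R w (\<nu> j) (n r j)) = c i *\<^sub>R w (\<nu> i) r + R"
    if "\<And>j. j \<noteq> i \<Longrightarrow> c j = a j" for c r
  proof -
    have "(\<Sum>j<k. c j *\<^sub>R w (\<nu> j) (n r j))
        = c i *\<^sub>R w (\<nu> i) (n r i) + (\<Sum>j\<in>{..<k} - {i}. c j *\<^sub>R w (\<nu> j) (n r j))"
      using i by (subst sum.remove[of _ i]) auto
    also have "(\<Sum>j\<in>{..<k} - {i}. c j *\<^sub>R w (\<nu> j) (n r j)) = R"
      unfolding R_def by (rule sum.cong) (auto simp: n_def that)
    finally show ?thesis by (simp add: n_def)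
  qed
  obtain r0 where r0: "r0 \<in> I" using \<open>I \<noteq> {}\<close> by blast
  have "\<bar>norm R - \<Lambda> k \<nu> b\<bar> < e"
    using m2[of "n r0"] n[OF r0] split[of b r0] unfolding b_def m_def by simp
  moreover have "norm R \<le> \<Lambda> k \<nu> a + e + e"
  proof -
    have "(\<Sum>r\<in>I. l r *\<^sub>R (a i *\<^sub>R w (\<nu> i) r + R)) = a i *\<^sub>R (\<Sum>r\<in>I. l r *\<^sub>R w (\<nu> i) r) + R"
      using l(2) by (simp add: scaleR_add_right sum.distrib scaleR_sum_right mult.commute
          scaleR_sum_left[symmetric])
    then have "norm R = norm ((\<Sum>r\<in>I. l r *\<^sub>R (a i *\<^sub>R w (\<nu> i) r + R)) - a i *\<^sub>R (\<Sum>r\<in>I. l r *\<^sub>R w (\<nu> i) r))"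
      by simp
    also have "\<dots> \<le> norm (\<Sum>r\<in>I. l r *\<^sub>R (a i *\<^sub>R w (\<nu> i) r + R)) + norm (a i *\<^sub>R (\<Sum>r\<in>I. l r *\<^sub>R w (\<nu> i) r))"
      by (rule norm_triangle_ineq4)
    also have "norm (\<Sum>r\<in>I. l r *\<^sub>R (a i *\<^sub>R w (\<nu> i) r + R)) \<le> (\<Sum>r\<in>I. l r * (\<Lambda> k \<nu> a + e))"
    proof (rule sum_norm_le)
      fix r assume r: "r \<in> I"
      have "norm (a i *\<^sub>R w (\<nu> i) r + R) \<le> \<Lambda> k \<nu> a + e"
        using m1[of "n r"] n[OF r] split[of a r] unfolding m_def by simp
      then show "norm (l r *\<^sub>R (a i *\<^sub>R w (\<nu> i) r + R)) \<le> l r * (\<Lambda> k \<nu> a + e)"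
        using l(1)[OF r] by (simp add: mult_left_mono)
    qed
    also have "(\<Sum>r\<in>I. l r * (\<Lambda> k \<nu> a + e)) = \<Lambda> k \<nu> a + e"
      using l(2) by (simp add: sum_distrib_right[symmetric])
    also have "norm (a i *\<^sub>R (\<Sum>r\<in>I. l r *\<^sub>R w (\<nu> i) r)) \<le> (\<bar>a i\<bar> + 1) * (e / (\<bar>a i\<bar> + 1))"
      unfolding norm_scaleR real_norm_def using small e
      by (intro mult_mono) (auto intro: less_imp_le)
    also have "\<dots> = e" by simp
    finally show ?thesis by simp
  qed
  ultimately show "\<Lambda> k \<nu> (a(i := 0)) \<le> \<Lambda> k \<nu> a + \<epsilon>" unfolding b_def e_def by linarith
qed

text \<open>Multiplying one coefficient by \<open>s\<close> in [0,1] is the convex combination of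
  keeping it and suppressing it; the positions are treated one after the other.\<close>

lemma joint_norm_multiplier:
  assumes w: "\<And>m. weakly_null (w m)" and L: "has_joint_norm w \<Lambda>"
    and t: "\<And>j. j < k \<Longrightarrow> 0 \<le> t j \<and> t j \<le> 1"
  shows "\<Lambda> k \<nu> (\<lambda>j. t j * a j) \<le> \<Lambda> k \<nu> a"
proof -
  have step: "\<Lambda> k \<nu> (b(i := s * b i)) \<le> \<Lambda> k \<nu> b" if i: "i < k" and s: "0 \<le> s" "s \<le> 1" for b i s
  proof -
    let ?c = "b(i := s * b i)" and ?d = "b(i := 0)"
    have "\<Lambda> k \<nu> ?c \<le> s * \<Lambda> k \<nu> b + (1 - s) * \<Lambda> k \<nu> ?d"
    proof (rule tendsto_le[OF incr_seqs_neq_bot])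
      show "((\<lambda>n. s * norm (\<Sum>j<k. b j *\<^sub>R w (\<nu> j) (n j)) + (1 - s) * norm (\<Sum>j<k. ?d j *\<^sub>R w (\<nu> j) (n j)))
          \<longlongrightarrow> s * \<Lambda> k \<nu> b + (1 - s) * \<Lambda> k \<nu> ?d) incr_seqs"
        using has_joint_normD[OF L, of b \<nu> k] has_joint_normD[OF L, of ?d \<nu> k]
        by (intro tendsto_add tendsto_mult_left)
      show "((\<lambda>n. norm (\<Sum>j<k. ?c j *\<^sub>R w (\<nu> j) (n j))) \<longlongrightarrow> \<Lambda> k \<nu> ?c) incr_seqs"
        by (rule has_joint_normD[OF L])
      have "(\<Sum>j<k. ?c j *\<^sub>R v j)
          = s *\<^sub>R (\<Sum>j<k. b j *\<^sub>R v j) + (1 - s) *\<^sub>R (\<Sum>j<k. ?d j *\<^sub>R v j)" for v :: "nat \<Rightarrow> 'a"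
        unfolding scaleR_sum_right sum.distrib[symmetric]
        by (rule sum.cong) (auto simp: algebra_simps)
      then have "norm (\<Sum>j<k. ?c j *\<^sub>R v j)
          \<le> s * norm (\<Sum>j<k. b j *\<^sub>R v j) + (1 - s) * norm (\<Sum>j<k. ?d j *\<^sub>R v j)" for v :: "nat \<Rightarrow> 'a"
        using norm_triangle_ineq[of "s *\<^sub>R (\<Sum>j<k. b j *\<^sub>R v j)" "(1 - s) *\<^sub>R (\<Sum>j<k. ?d j *\<^sub>R v j)"] s
        by simp
      then show "\<forall>\<^sub>F n in incr_seqs. norm (\<Sum>j<k. ?c j *\<^sub>R w (\<nu> j) (n j))
          \<le> s * norm (\<Sum>j<k. b j *\<^sub>R w (\<nu> j) (n j)) + (1 - s) * norm (\<Sum>j<k. ?d j *\<^sub>R w (\<nu> j) (n j))"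
        by simp
    qed
    also have "\<dots> \<le> s * \<Lambda> k \<nu> b + (1 - s) * \<Lambda> k \<nu> b"
      using joint_norm_suppress[OF w L i, of \<nu> b] s by (intro add_left_mono mult_left_mono) auto
    finally show ?thesis by (simp add: algebra_simps)
  qed
  have "\<Lambda> k \<nu> (\<lambda>j. if j < i then t j * a j else a j) \<le> \<Lambda> k \<nu> a" if "i \<le> k" for i
    using that
  proof (induction i)
    case (Suc i)
    define b where "b = (\<lambda>j. if j < i then t j * a j else a j)"
    have "(\<lambda>j. if j < Suc i then t j * a j else a j) = b(i := t i * b i)"
      by (auto simp: b_def fun_eq_iff less_Suc_eq)
    with step[of i "t i" b] t[of i] Suc show ?case by (auto simp: b_def)
  qed simp
  from this[of k] have "\<Lambda> k \<nu> (\<lambda>j. if j < k then t j * a j else a j) \<le> \<Lambda> k \<nu> a" by simp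
  moreover have "\<Lambda> k \<nu> (\<lambda>j. if j < k then t j * a j else a j) = \<Lambda> k \<nu> (\<lambda>j. t j * a j)"
  proof (rule tendsto_unique[OF incr_seqs_neq_bot])
    have "(\<Sum>j<k. (if j < k then t j * a j else a j) *\<^sub>R w (\<nu> j) (n j)) = (\<Sum>j<k. (t j * a j) *\<^sub>R w (\<nu> j) (n j))" for n
      by (rule sum.cong) auto
    then show "((\<lambda>n. norm (\<Sum>j<k. (t j * a j) *\<^sub>R w (\<nu> j) (n j)))
        \<longlongrightarrow> \<Lambda> k \<nu> (\<lambda>j. if j < k then t j * a j else a j)) incr_seqs"
      using has_joint_normD[OF L, of "\<lambda>j. if j < k then t j * a j else a j" \<nu> k] by simp
    show "((\<lambda>n. norm (\<Sum>j<k. (t j * a j) *\<^sub>R w (\<nu> j) (n j))) \<longlongrightarrow> \<Lambda> k \<nu> (\<lambda>j. t j * a j)) incr_seqs"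
      by (rule has_joint_normD[OF L])
  qed
  ultimately show ?thesis by simp
qed

subsection \<open>Spreading models from spreading norms\<close>

lemma seminorm_norming_functional:
  fixes p :: "'a::real_vector \<Rightarrow> real"
  assumes p: "sublinear p" and even: "\<And>x. p (- x) = p x"
  obtains f :: "'a \<Rightarrow> real" where "linear f" "\<And>x. \<bar>f x\<bar> \<le> p x" "f v = p v"
proof -
  obtain q where q: "sublinear q" "q \<le> p" "q (- v) \<le> - p v" using sublinear_shift[OF p] by blast
  obtain f where f: "linear f" "f \<le> q" using hahn_banach_sublinear[OF q(1)] by blast
  have fle: "f x \<le> p x" for x using le_funD[OF f(2), of x] le_funD[OF q(2), of x] by simp
  have neg: "f (- x) = - f x" for x by (rule linear_neg[OF f(1)])
  show thesis
  proof (rule that[OF f(1)])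
    show "\<bar>f x\<bar> \<le> p x" for x using fle[of x] fle[of "- x"] neg[of x] even[of x] by simp
    show "f v = p v" using le_funD[OF f(2), of "- v"] q(3) neg[of v] fle[of v] by simp
  qed
qed

lemma sublinear_sum:
  assumes p: "sublinear p"
  shows "p (\<Sum>i<k. f i) \<le> (\<Sum>i<(k::nat). p (f i))"
proof (induction k)
  case 0
  show ?case using sublinear_scale[OF p, of 0 0] by simp
next
  case (Suc k)
  then show ?case using sublinear_add[OF p, of "sum f {..<k}" "f k"] by simp
qed

text \<open>The coordinates are norming functionals of the countably many rational combinations of
  \<open>y\<close>, which are \<open>p\<close>-dense among the real ones. A seminorm suffices, since
  only the norms of combinations are copied.\<close>

lemma seminorm_copy_in_linfty:
  fixes y :: "nat \<Rightarrow> 'b::real_vector"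
  assumes p: "sublinear p" and even: "\<And>x. p (- x) = p x"
  shows "\<exists>z :: nat \<Rightarrow> linfty. \<forall>(k::nat) (a :: nat \<Rightarrow> real).
           norm (\<Sum>i<k. a i *\<^sub>R z i) = p (\<Sum>i<k. a i *\<^sub>R y i)"
proof -
  have p_nonneg: "0 \<le> p x" for x
    using sublinear_uminus[OF p, of x] even[of x] by simp
  have p_scale: "p (c *\<^sub>R x) = \<bar>c\<bar> * p x" for c x
    using sublinear_scale[OF p, of c x] sublinear_scale[OF p, of "- c" x] even[of "c *\<^sub>R x"]
    by (cases "c \<ge> 0") auto
  define d :: "nat \<Rightarrow> 'b" where
    "d n = (\<Sum>i<length (from_nat n :: rat list). of_rat ((from_nat n :: rat list) ! i) *\<^sub>R y i)" for n
  have "\<exists>f :: 'b \<Rightarrow> real. linear f \<and> (\<forall>x. \<bar>f x\<bar> \<le> p x) \<and> f (d n) = p (d n)" for n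
    using seminorm_norming_functional[OF p even, of "d n"] by metis
  then obtain f :: "nat \<Rightarrow> 'b \<Rightarrow> real" where
    f: "\<And>n. linear (f n)" "\<And>n x. \<bar>f n x\<bar> \<le> p x" "\<And>n. f n (d n) = p (d n)" by metis
  define z :: "nat \<Rightarrow> linfty" where "z i = Bcontfun (\<lambda>n. f n (y i))" for i
  have "(\<lambda>n. f n (y i)) \<in> bcontfun" for i
    by (rule bcontfun_normI[of _ "p (y i)"]) (use f(2) in auto)
  then have z: "apply_bcontfun (z i) n = f n (y i)" for i n
    unfolding z_def by (simp add: Bcontfun_inverse)
  have app: "apply_bcontfun (\<Sum>i<k. a i *\<^sub>R z i) n = f n (\<Sum>i<k. a i *\<^sub>R y i)" for k :: nat and a n
    by (induction k) (simp_all add: z linear_0[OF f(1)] linear_add[OF f(1)] linear_scale[OF f(1)])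
  have "norm (\<Sum>i<k. a i *\<^sub>R z i) = p (\<Sum>i<k. a i *\<^sub>R y i)" for k :: nat and a :: "nat \<Rightarrow> real"
  proof (rule antisym)
    show "norm (\<Sum>i<k. a i *\<^sub>R z i) \<le> p (\<Sum>i<k. a i *\<^sub>R y i)"
      by (rule norm_bound) (simp add: app f(2))
    define v where "v = (\<Sum>i<k. a i *\<^sub>R y i)"
    show "p (\<Sum>i<k. a i *\<^sub>R y i) \<le> norm (\<Sum>i<k. a i *\<^sub>R z i)"
    proof (rule field_le_epsilon)
      fix e :: real assume e: "e > 0"
      define M where "M = (\<Sum>i<k. p (y i)) + 1"
      have M: "M > 0" unfolding M_def by (simp add: add_nonneg_pos sum_nonneg p_nonneg)
      have "\<exists>q. \<bar>of_rat q - a i\<bar> < e / (2 * M)" for i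
      proof -
        have "a i - e / (2 * M) < a i + e / (2 * M)" using e M by simp
        from of_rat_dense[OF this] show ?thesis by (auto simp: abs_less_iff algebra_simps)
      qed
      then obtain q where q: "\<And>i. \<bar>of_rat (q i) - a i\<bar> < e / (2 * M)" by metis
      define n where "n = to_nat (map q [0..<k])"
      have "d n - v = (\<Sum>i<k. (of_rat (q i) - a i) *\<^sub>R y i)"
        by (simp add: d_def n_def v_def sum_subtractf scaleR_diff_left)
      then have "p (d n - v) \<le> (\<Sum>i<k. p ((of_rat (q i) - a i) *\<^sub>R y i))"
        by (simp add: sublinear_sum[OF p])
      also have "\<dots> \<le> (\<Sum>i<k. e / (2 * M) * p (y i))"
        unfolding p_scale by (intro sum_mono mult_right_mono less_imp_le[OF q] p_nonneg)
      also have "\<dots> = e / (2 * M) * (M - 1)" by (simp add: M_def sum_distrib_left)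
      also have "\<dots> \<le> e / (2 * M) * M" using M e by (intro mult_left_mono) auto
      also have "\<dots> = e / 2" using M by simp
      finally have dn: "p (d n - v) \<le> e / 2" .
      have "p v \<le> p (d n) + p (d n - v)"
        using sublinear_add[OF p, of "d n" "v - d n"] even[of "d n - v"] by simp
      moreover have "p (d n) = f n v + f n (d n - v)"
        using f(3)[of n] linear_diff[OF f(1), of n "d n" v] by simp
      moreover have "f n (d n - v) \<le> p (d n - v)" using f(2)[of n "d n - v"] by simp
      moreover have "f n v \<le> norm (\<Sum>i<k. a i *\<^sub>R z i)"
        using norm_bounded[of "\<Sum>i<k. a i *\<^sub>R z i" n] by (simp add: app v_def)
      ultimately show "p (\<Sum>i<k. a i *\<^sub>R y i) \<le> norm (\<Sum>i<k. a i *\<^sub>R z i) + e"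
        using dn unfolding v_def by simp
    qed
  qed
  then show ?thesis by blast
qed

text \<open>The spreading norm is the seminorm \<open>limsup\<close> on the span of the shifts of \<open>x\<close>, which
  live in the space of bounded sequences.\<close>

lemma spreading_norm_in_linfty:
  fixes x :: "nat \<Rightarrow> 'a::real_normed_vector"
  assumes L: "has_spreading_norm x L" and B: "\<And>i. norm (x i) \<le> B"
  obtains z :: "nat \<Rightarrow> linfty" where "\<And>k a. norm (\<Sum>j<k. a j *\<^sub>R z j) = L k a"
proof -
  define p where "p h = Inf {c. \<forall>\<^sub>F i in sequentially. norm (apply_bcontfun h i) \<le> c}"
    for h :: "nat \<Rightarrow>\<^sub>C 'a"
  have lower: "0 \<le> c" if h: "\<forall>\<^sub>F i in sequentially. norm (apply_bcontfun h i) \<le> c" for h :: "nat \<Rightarrow>\<^sub>C 'a" and c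
  proof -
    obtain i where "norm (apply_bcontfun h i) \<le> c"
      using eventually_happens[OF h] by auto
    then show ?thesis using norm_ge_zero order_trans by blast
  qed
  have le: "p h \<le> c" if "\<forall>\<^sub>F i in sequentially. norm (apply_bcontfun h i) \<le> c" for h c
    unfolding p_def by (rule cInf_lower) (use that lower in \<open>auto intro: bdd_belowI[of _ 0]\<close>)
  have ev: "\<forall>\<^sub>F i in sequentially. norm (apply_bcontfun h i) \<le> p h + e" if "e > 0" for h e
  proof -
    have ne: "{c. \<forall>\<^sub>F i in sequentially. norm (apply_bcontfun h i) \<le> c} \<noteq> {}"
      using norm_bounded[of h] by (auto intro!: exI[of _ "norm h"])
    have "Inf {c. \<forall>\<^sub>F i in sequentially. norm (apply_bcontfun h i) \<le> c} < p h + e"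
      using that by (simp add: p_def)
    from cInf_lessD[OF ne this] obtain c where
      "\<forall>\<^sub>F i in sequentially. norm (apply_bcontfun h i) \<le> c" "c < p h + e" by auto
    then show ?thesis by (auto elim: eventually_mono)
  qed
  have nonneg: "0 \<le> p h" for h
    by (rule field_le_epsilon) (use lower[OF ev] in auto)
  have scale_le: "p (c *\<^sub>R h) \<le> \<bar>c\<bar> * p h" for c h
  proof (rule field_le_epsilon)
    fix e :: real assume e: "e > 0"
    have pos: "e / (\<bar>c\<bar> + 1) > 0" using e by simp
    have "\<forall>\<^sub>F i in sequentially. norm (apply_bcontfun (c *\<^sub>R h) i) \<le> \<bar>c\<bar> * p h + e"
      using ev[OF pos, of h]
    proof eventually_elim
      case (elim i)
      have "norm (apply_bcontfun (c *\<^sub>R h) i) = \<bar>c\<bar> * norm (apply_bcontfun h i)" by simp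
      also have "\<dots> \<le> \<bar>c\<bar> * (p h + e / (\<bar>c\<bar> + 1))" using elim by (rule mult_left_mono) simp
      also have "\<dots> = \<bar>c\<bar> * p h + e * (\<bar>c\<bar> / (\<bar>c\<bar> + 1))" by (simp add: algebra_simps)
      also have "\<dots> \<le> \<bar>c\<bar> * p h + e * 1" using e by (intro add_left_mono mult_left_mono) auto
      finally show ?case by simp
    qed
    then show "p (c *\<^sub>R h) \<le> \<bar>c\<bar> * p h + e" by (rule le)
  qed
  have p: "sublinear p"
    unfolding sublinear_def
  proof (intro conjI allI impI)
    fix h g
    show "p (h + g) \<le> p h + p g"
    proof (rule field_le_epsilon)
      fix e :: real assume "e > 0"
      then have "e / 2 > 0" by simp
      from ev[OF this, of h] ev[OF this, of g]
      have "\<forall>\<^sub>F i in sequentially. norm (apply_bcontfun (h + g) i) \<le> p h + p g + e"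
      proof eventually_elim
        case (elim i)
        then show ?case
          using norm_triangle_ineq[of "apply_bcontfun h i" "apply_bcontfun g i"] by simp
      qed
      then show "p (h + g) \<le> p h + p g + e" by (rule le)
    qed
  next
    fix c :: real and h assume c: "0 \<le> c"
    show "p (c *\<^sub>R h) = c * p h"
    proof (rule antisym)
      show "p (c *\<^sub>R h) \<le> c * p h" using scale_le[of c h] c by simp
      show "c * p h \<le> p (c *\<^sub>R h)"
      proof (cases "c = 0")
        case False
        have "p ((1 / c) *\<^sub>R c *\<^sub>R h) \<le> \<bar>1 / c\<bar> * p (c *\<^sub>R h)" by (rule scale_le)
        then show ?thesis using False c by (simp add: field_simps)
      qed (simp add: nonneg)
    qed
  qed
  have even: "p (- h) = p h" for h
    using scale_le[of "-1" h] scale_le[of "-1" "- h"] by simp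
  define y where "y j = Bcontfun (\<lambda>i. x (i + j))" for j
  have "(\<lambda>i. x (i + j)) \<in> bcontfun" for j by (rule bcontfun_normI[of _ B]) (auto simp: B)
  then have y: "apply_bcontfun (y j) i = x (i + j)" for i j
    unfolding y_def by (simp add: Bcontfun_inverse)
  have app: "apply_bcontfun (\<Sum>j<k. a j *\<^sub>R y j) i = (\<Sum>j<k. a j *\<^sub>R x (i + j))" for k :: nat and a i
    by (induction k) (simp_all add: y)
  have lim: "p (\<Sum>j<k. a j *\<^sub>R y j) = L k a" for k a
  proof (rule antisym)
    have "(\<lambda>i. norm (\<Sum>j<k. a j *\<^sub>R x (i + j))) \<longlonglongrightarrow> L k a"
      using filterlim_compose[OF has_spreading_normD[OF L] filterlim_shift_incr_seqs] by simp
    then have l: "(\<lambda>i. norm (apply_bcontfun (\<Sum>j<k. a j *\<^sub>R y j) i)) \<longlonglongrightarrow> L k a"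
      by (simp add: app)
    show "p (\<Sum>j<k. a j *\<^sub>R y j) \<le> L k a"
    proof (rule field_le_epsilon)
      fix e :: real assume "e > 0"
      with order_tendstoD(2)[OF l, of "L k a + e"] show "p (\<Sum>j<k. a j *\<^sub>R y j) \<le> L k a + e"
        by (intro le) (auto elim: eventually_mono)
    qed
    show "L k a \<le> p (\<Sum>j<k. a j *\<^sub>R y j)"
      by (rule field_le_epsilon, rule tendsto_upperbound[OF l ev]) auto
  qed
  from seminorm_copy_in_linfty[OF p even, of y] obtain z :: "nat \<Rightarrow> linfty" where
    "\<And>k a. norm (\<Sum>j<k. a j *\<^sub>R z j) = p (\<Sum>j<k. a j *\<^sub>R y j)" by blast
  then show thesis using lim by (intro that) auto
qed

lemma weakly_null_subseq:
  assumes "weakly_null x" "strict_mono \<phi>"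
  shows "weakly_null (x \<circ> \<phi>)"
  unfolding weakly_null_def
proof (intro allI impI)
  fix f :: "'a \<Rightarrow> real" assume "bounded_linear f"
  then have "(\<lambda>n. f (x n)) \<longlonglongrightarrow> 0" using assms(1) unfolding weakly_null_def by blast
  from LIMSEQ_subseq_LIMSEQ[OF this assms(2)] show "(\<lambda>n. f ((x \<circ> \<phi>) n)) \<longlonglongrightarrow> 0" by (simp add: o_def)
qed

lemma has_spreading_norm_tendsto_norm:
  assumes L: "has_spreading_norm x L"
  shows "(\<lambda>i. norm (x i)) \<longlonglongrightarrow> L 1 (\<lambda>_. 1)"
  using filterlim_compose[OF has_spreading_normD[OF L, of "\<lambda>_. 1" 1] filterlim_shift_incr_seqs] by simp

text \<open>The copy in \<open>linfty\<close> carries the norm; a subsequence supplies the rate of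
  convergence and, as \<open>norm (x i)\<close> tends to \<open>L 1 (\<lambda>_. 1) > 0\<close>, the
  lower bound on the norms.\<close>

lemma spreading_model_of_norm:
  fixes x :: "nat \<Rightarrow> 'a::banach"
  assumes x: "weakly_null x" and B: "\<And>i. norm (x i) \<le> B" and L: "has_spreading_norm x L"
    and pos: "L 1 (\<lambda>_. 1) > 0"
  obtains z where "z \<in> spreading_models_w TYPE('a)" "\<And>k a. norm (\<Sum>j<k. a j *\<^sub>R z j) = L k a"
proof -
  obtain z :: "nat \<Rightarrow> linfty" where z: "\<And>k a. norm (\<Sum>j<k. a j *\<^sub>R z j) = L k a"
    using spreading_norm_in_linfty[OF L B] by blast
  have "L 1 (\<lambda>_. 1) / 2 < L 1 (\<lambda>_. 1)" using pos by simp
  from order_tendstoD(1)[OF has_spreading_norm_tendsto_norm[OF L] this]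
  obtain s where s: "\<And>i. i \<ge> s \<Longrightarrow> L 1 (\<lambda>_. 1) / 2 < norm (x i)"
    unfolding eventually_sequentially by blast
  obtain \<phi> where \<phi>: "strict_mono \<phi>" "\<phi> 0 \<ge> s" and
    near: "\<And>k n a. strict_mono n \<Longrightarrow> k \<le> n 0 \<Longrightarrow> (\<And>j. j < k \<Longrightarrow> \<bar>a j\<bar> \<le> 1) \<Longrightarrow>
      \<bar>norm (\<Sum>j<k. a j *\<^sub>R (x \<circ> \<phi>) (n j)) - L k a\<bar> < 1 / Suc k"
    using has_spreading_norm_fast_subseq[OF L B] by blast
  have "L 1 (\<lambda>_. 1) / 2 \<le> (INF i. norm ((x \<circ> \<phi>) i))"
  proof (rule cINF_greatest)
    fix i
    have "s \<le> \<phi> i" using strict_mono_nat_ge[OF \<phi>(1), of i] \<phi>(2) by simp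
    from s[OF this] show "L 1 (\<lambda>_. 1) / 2 \<le> norm ((x \<circ> \<phi>) i)" by simp
  qed simp
  then have "seminormalized (x \<circ> \<phi>)"
    unfolding seminormalized_def using pos B by (auto intro!: bdd_aboveI[of _ B])
  then have "generates_spreading_model (x \<circ> \<phi>) z"
    by (rule generates_spreading_modelI) (use near z in auto)
  then have "z \<in> spreading_models_w TYPE('a)"
    unfolding spreading_models_w_def using weakly_null_subseq[OF x \<phi>(1)] by blast
  then show thesis using z by (rule that)
qed

lemma dominated_iff:
  "dominated x y \<longleftrightarrow> (\<exists>C. \<forall>k a. norm (\<Sum>j<k. a j *\<^sub>R x j) \<le> C * norm (\<Sum>j<(k::nat). a j *\<^sub>R y j))"
proof
  assume "dominated x y"
  then obtain C where C: "\<And>k a. norm (\<Sum>n\<le>(k::nat). a n *\<^sub>R x n) \<le> C * norm (\<Sum>n\<le>k. a n *\<^sub>R y n)"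
    unfolding dominated_def by blast
  have "norm (\<Sum>j<k. a j *\<^sub>R x j) \<le> C * norm (\<Sum>j<k. a j *\<^sub>R y j)" for k a
    using C[of a "k - 1"] by (cases k) (auto simp: lessThan_Suc_atMost)
  then show "\<exists>C. \<forall>k a. norm (\<Sum>j<k. a j *\<^sub>R x j) \<le> C * norm (\<Sum>j<(k::nat). a j *\<^sub>R y j)" by blast
next
  assume "\<exists>C. \<forall>k a. norm (\<Sum>j<k. a j *\<^sub>R x j) \<le> C * norm (\<Sum>j<(k::nat). a j *\<^sub>R y j)"
  then obtain C where C: "\<And>k a. norm (\<Sum>j<k. a j *\<^sub>R x j) \<le> C * norm (\<Sum>j<(k::nat). a j *\<^sub>R y j)" by blast
  have "norm (\<Sum>n\<le>k. a n *\<^sub>R x n) \<le> max C 1 * norm (\<Sum>n\<le>k. a n *\<^sub>R y n)" for k a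
  proof -
    have "norm (\<Sum>n\<le>k. a n *\<^sub>R x n) \<le> C * norm (\<Sum>n\<le>k. a n *\<^sub>R y n)"
      using C[of a "Suc k"] by (simp only: lessThan_Suc_atMost)
    also have "\<dots> \<le> max C 1 * norm (\<Sum>n\<le>k. a n *\<^sub>R y n)" by (rule mult_right_mono) auto
    finally show ?thesis .
  qed
  then show "dominated x y" unfolding dominated_def by (intro exI[of _ "max C 1"]) auto
qed

subsection \<open>Mixtures of weakly null sequences\<close>

lemma sum_half_powers_le: "(\<Sum>n\<in>{N..<i}. (1/2 :: real) ^ n) \<le> 2 * (1/2) ^ N"
proof (cases "N \<le> i")
  case True
  then have "(\<Sum>n\<in>{N..<i}. (1/2 :: real) ^ n) = 2 * ((1/2) ^ N - (1/2) ^ i)"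
    by (induction rule: dec_induct) auto
  then show ?thesis by simp
qed simp

locale weakly_null_array =
  fixes w :: "nat \<Rightarrow> nat \<Rightarrow> 'a::banach" and \<Lambda> :: "nat \<Rightarrow> (nat \<Rightarrow> nat) \<Rightarrow> (nat \<Rightarrow> real) \<Rightarrow> real"
  assumes wn: "\<And>m. weakly_null (w m)" and joint: "has_joint_norm w \<Lambda>"
    and bound: "\<And>m i. norm (w m i) \<le> 1"
begin

definition row_norm :: "nat \<Rightarrow> nat \<Rightarrow> (nat \<Rightarrow> real) \<Rightarrow> real" where
  "row_norm m k a = \<Lambda> k (\<lambda>_. m) a"

text \<open>The terms of the \<open>m\<close>-th row used in \<open>mix c i\<close> have index \<open>i * i + m\<close>; so for \<open>i < i'\<close> all
  indices in \<open>mix c i\<close> precede those in \<open>mix c i'\<close>, and no index is used twice.\<close>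

definition mix :: "(nat \<Rightarrow> real) \<Rightarrow> nat \<Rightarrow> 'a" where
  "mix c i = (\<Sum>m<i. c m *\<^sub>R w m (i * i + m))"

definition mix_upto :: "nat \<Rightarrow> (nat \<Rightarrow> real) \<Rightarrow> nat \<Rightarrow> 'a" where
  "mix_upto N c i = (\<Sum>m<N. c m *\<^sub>R w m (i * i + m))"

definition weights :: "(nat \<Rightarrow> real) set" where
  "weights = {c. \<forall>m. 0 \<le> c m \<and> c m \<le> (1/2) ^ m}"

text \<open>Position \<open>l\<close> of the flattened double sum belongs to block
  \<open>l div N\<close>, one term of the combination, and to row \<open>l mod N\<close>.\<close>

definition mix_norm_upto :: "nat \<Rightarrow> (nat \<Rightarrow> real) \<Rightarrow> nat \<Rightarrow> (nat \<Rightarrow> real) \<Rightarrow> real" where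
  "mix_norm_upto N c k a = \<Lambda> (k * N) (\<lambda>l. l mod N) (\<lambda>l. a (l div N) * c (l mod N))"

definition mix_norm :: "(nat \<Rightarrow> real) \<Rightarrow> nat \<Rightarrow> (nat \<Rightarrow> real) \<Rightarrow> real" where
  "mix_norm c k a = Lim incr_seqs (\<lambda>n. norm (\<Sum>j<k. a j *\<^sub>R mix c (n j)))"

lemma row_norm: "has_spreading_norm (w m) (row_norm m)"
  unfolding has_spreading_norm_def row_norm_def using has_joint_normD[OF joint, where \<nu> = "\<lambda>_. m"] by simp

lemma weightsD: "c \<in> weights \<Longrightarrow> 0 \<le> c m" "c \<in> weights \<Longrightarrow> c m \<le> (1/2) ^ m"
  by (auto simp: weights_def)

lemma weights_tail:
  fixes c :: "nat \<Rightarrow> real"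
  assumes "\<And>m. m \<ge> N \<Longrightarrow> c m \<le> s * (1/2) ^ m" "s \<ge> 0"
  shows "(\<Sum>m\<in>{N..<i}. c m) \<le> s * (2 * (1/2) ^ N)"
proof -
  have "(\<Sum>m\<in>{N..<i}. c m) \<le> (\<Sum>m\<in>{N..<i}. s * (1/2) ^ m)" by (rule sum_mono) (use assms in auto)
  also have "\<dots> = s * (\<Sum>m\<in>{N..<i}. (1/2) ^ m)" by (simp add: sum_distrib_left)
  also have "\<dots> \<le> s * (2 * (1/2) ^ N)" using sum_half_powers_le assms(2) by (intro mult_left_mono) auto
  finally show ?thesis .
qed

lemma weights_tail':
  assumes "c \<in> weights"
  shows "(\<Sum>m\<in>{N..<i}. c m) \<le> 2 * (1/2) ^ N"
  using weights_tail[of N c 1 i] weightsD(2)[OF assms] by simp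

lemma norm_mix_tail:
  assumes c: "c \<in> weights" and T: "(\<Sum>m\<in>{N..<i}. c m) \<le> T" and i: "N \<le> i"
  shows "norm (mix c i - mix_upto N c i) \<le> T"
proof -
  have "{..<i} = {..<N} \<union> {N..<i}" using i by auto
  then have "mix c i - mix_upto N c i = (\<Sum>m\<in>{N..<i}. c m *\<^sub>R w m (i * i + m))"
    unfolding mix_def mix_upto_def by (simp add: sum.union_disjoint ivl_disj_int)
  also have "norm \<dots> \<le> (\<Sum>m\<in>{N..<i}. c m)"
  proof (rule sum_norm_le)
    fix m
    show "norm (c m *\<^sub>R w m (i * i + m)) \<le> c m"
      using mult_left_mono[OF bound[of m "i * i + m"] weightsD(1)[OF c, of m]] weightsD(1)[OF c, of m] by simp
  qed
  also have "\<dots> \<le> T" by (rule T)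
  finally show ?thesis .
qed

lemma norm_mix_le:
  assumes "c \<in> weights"
  shows "norm (mix c i) \<le> 2"
  using norm_mix_tail[OF assms weights_tail'[OF assms], of 0 i] by (simp add: mix_upto_def)

lemma norm_lincomb_mix_tail:
  fixes n :: "nat \<Rightarrow> nat"
  assumes c: "c \<in> weights" and T: "\<And>i. (\<Sum>m\<in>{N..<i}. c m) \<le> T"
    and n: "strict_mono n" "N \<le> n 0"
  shows "\<bar>norm (\<Sum>j<k. a j *\<^sub>R mix c (n j)) - norm (\<Sum>j<k. a j *\<^sub>R mix_upto N c (n j))\<bar>
    \<le> (\<Sum>j<k. \<bar>a j\<bar>) * T"
proof -
  have "\<bar>norm (\<Sum>j<k. a j *\<^sub>R mix c (n j)) - norm (\<Sum>j<k. a j *\<^sub>R mix_upto N c (n j))\<bar>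
      \<le> norm ((\<Sum>j<k. a j *\<^sub>R mix c (n j)) - (\<Sum>j<k. a j *\<^sub>R mix_upto N c (n j)))"
    by (rule norm_triangle_ineq3)
  also have "\<dots> = norm (\<Sum>j<k. a j *\<^sub>R (mix c (n j) - mix_upto N c (n j)))"
    by (simp add: sum_subtractf scaleR_diff_right)
  also have "\<dots> \<le> (\<Sum>j<k. \<bar>a j\<bar>) * T"
  proof (rule norm_lincomb_le)
    fix j
    have "N \<le> n j" using strict_mono_nat_ge[OF n(1), of j] n(2) by simp
    then show "norm (mix c (n j) - mix_upto N c (n j)) \<le> T" by (rule norm_mix_tail[OF c T])
  qed
  finally show ?thesis .
qed

text \<open>Inside a block the index rises by one. Between blocks it goes from at most
  \<open>q * q + N - 1\<close> to at least \<open>Suc q * Suc q\<close>, which is larger because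
  \<open>N \<le> q\<close>.\<close>

lemma filterlim_flatten:
  assumes N: "N > 0"
  shows "filterlim (\<lambda>n l. n (l div N) * n (l div N) + l mod N) incr_seqs incr_seqs"
proof (rule filterlim_incr_seqsI, rule eventually_incr_seqsI)
  fix m and n :: "nat \<Rightarrow> nat" assume n: "strict_mono n" "max m N \<le> n 0"
  show "strict_mono (\<lambda>l. n (l div N) * n (l div N) + l mod N) \<and> m \<le> n (0 div N) * n (0 div N) + 0 mod N"
  proof
    have "m \<le> n 0 * n 0" by (rule le_trans[of _ "n 0"]) (use n in auto)
    then show "m \<le> n (0 div N) * n (0 div N) + 0 mod N" by simp
    show "strict_mono (\<lambda>l. n (l div N) * n (l div N) + l mod N)"
      unfolding strict_mono_Suc_iff
    proof
      fix l
      show "n (l div N) * n (l div N) + l mod N < n (Suc l div N) * n (Suc l div N) + Suc l mod N"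
      proof (cases "Suc (l mod N) = N")
        case True
        then have eq: "Suc l div N = Suc (l div N)" "Suc l mod N = 0" by (simp_all add: div_Suc mod_Suc)
        define q where "q = n (l div N)"
        have "N \<le> q" using strict_mono_nat_ge[OF n(1), of "l div N"] n(2) unfolding q_def by simp
        moreover have "Suc q \<le> n (Suc (l div N))"
          unfolding q_def using strict_monoD[OF n(1), of "l div N" "Suc (l div N)"] by simp
        then have "Suc q * Suc q \<le> n (Suc (l div N)) * n (Suc (l div N))" by (intro mult_le_mono)
        moreover have "l mod N < N" using N by simp
        ultimately show ?thesis unfolding eq q_def[symmetric] by simp
      next
        case False
        then show ?thesis by (simp add: div_Suc mod_Suc)
      qed
    qed
  qed
qed

lemma mix_upto_tendsto:
  assumes N: "N > 0"
  shows "((\<lambda>n. norm (\<Sum>j<k. a j *\<^sub>R mix_upto N c (n j))) \<longlongrightarrow> mix_norm_upto N c k a) incr_seqs"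
proof -
  have eq: "(\<Sum>j<k. a j *\<^sub>R mix_upto N c (n j))
      = (\<Sum>l<k * N. (a (l div N) * c (l mod N)) *\<^sub>R w (l mod N) (n (l div N) * n (l div N) + l mod N))" for n
  proof -
    define g where "g l = (a (l div N) * c (l mod N)) *\<^sub>R w (l mod N) (n (l div N) * n (l div N) + l mod N)" for l
    have "a j *\<^sub>R mix_upto N c (n j) = sum g {j * N..<j * N + N}" for j
    proof -
      have "sum g {j * N..<j * N + N} = (\<Sum>r<N. g (j * N + r))"
        by (simp add: sum.atLeastLessThan_shift_0[of g] atLeast0LessThan)
      also have "\<dots> = (\<Sum>r<N. a j *\<^sub>R c r *\<^sub>R w r (n j * n j + r))"
        by (rule sum.cong) (auto simp: g_def)
      finally show ?thesis by (simp add: mix_upto_def scaleR_sum_right)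
    qed
    then show ?thesis using sum.nat_group[of g N k] by (simp add: g_def)
  qed
  show ?thesis unfolding eq mix_norm_upto_def
    by (rule filterlim_compose[OF has_joint_normD[OF joint] filterlim_flatten[OF N]])
qed

text \<open>Truncation to \<open>N\<close> rows costs at most \<open>2 * (1/2)^N\<close> per unit of
  coefficient, and truncated mixtures converge by the joint norm.\<close>

lemma mix_norm:
  assumes c: "c \<in> weights"
  shows "has_spreading_norm (mix c) (mix_norm c)"
  unfolding has_spreading_norm_def
proof (intro allI)
  fix k :: nat and a :: "nat \<Rightarrow> real"
  have "\<exists>l. ((\<lambda>n. norm (\<Sum>j<k. a j *\<^sub>R mix c (n j))) \<longlongrightarrow> l) incr_seqs"
  proof (rule convergent_incr_seqs_approx)
    fix e :: real assume e: "e > 0"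
    have "(\<lambda>N. (\<Sum>j<k. \<bar>a j\<bar>) * (2 * (1/2) ^ N)) \<longlonglongrightarrow> (\<Sum>j<k. \<bar>a j\<bar>) * (2 * 0)"
      by (intro tendsto_mult_left LIMSEQ_realpow_zero) auto
    then have "\<forall>\<^sub>F N in sequentially. (\<Sum>j<k. \<bar>a j\<bar>) * (2 * (1/2) ^ N) < e"
      using e by (intro order_tendstoD(2)) auto
    then have "\<forall>\<^sub>F N in sequentially. (\<Sum>j<k. \<bar>a j\<bar>) * (2 * (1/2) ^ N) < e \<and> N > 0"
      using eventually_gt_at_top[of 0] by eventually_elim auto
    then obtain N where N: "(\<Sum>j<k. \<bar>a j\<bar>) * (2 * (1/2) ^ N) < e" "N > 0"
      unfolding eventually_sequentially by blast
    have "\<forall>\<^sub>F n in incr_seqs. \<bar>norm (\<Sum>j<k. a j *\<^sub>R mix c (n j)) - norm (\<Sum>j<k. a j *\<^sub>R mix_upto N c (n j))\<bar> \<le> e"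
    proof (rule eventually_incr_seqsI)
      fix n :: "nat \<Rightarrow> nat" assume "strict_mono n" "N \<le> n 0"
      from norm_lincomb_mix_tail[OF c weights_tail'[OF c] this, where a = a and k = k] N(1)
      show "\<bar>norm (\<Sum>j<k. a j *\<^sub>R mix c (n j)) - norm (\<Sum>j<k. a j *\<^sub>R mix_upto N c (n j))\<bar> \<le> e" by linarith
    qed
    then show "\<exists>G l. (G \<longlongrightarrow> l) incr_seqs \<and>
        (\<forall>\<^sub>F n in incr_seqs. \<bar>norm (\<Sum>j<k. a j *\<^sub>R mix c (n j)) - G n\<bar> \<le> e)"
      using mix_upto_tendsto[OF N(2)] by blast
  qed
  then obtain l where l: "((\<lambda>n. norm (\<Sum>j<k. a j *\<^sub>R mix c (n j))) \<longlongrightarrow> l) incr_seqs" ..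
  then show "((\<lambda>n. norm (\<Sum>j<k. a j *\<^sub>R mix c (n j))) \<longlongrightarrow> mix_norm c k a) incr_seqs"
    unfolding mix_norm_def tendsto_Lim[OF incr_seqs_neq_bot l] .
qed

lemma mix_norm_tail:
  assumes c: "c \<in> weights" and T: "\<And>i. (\<Sum>m\<in>{N..<i}. c m) \<le> T" and N: "N > 0"
  shows "\<bar>mix_norm c k a - mix_norm_upto N c k a\<bar> \<le> (\<Sum>j<k. \<bar>a j\<bar>) * T"
proof (rule tendsto_upperbound)
  show "((\<lambda>n. \<bar>norm (\<Sum>j<k. a j *\<^sub>R mix c (n j)) - norm (\<Sum>j<k. a j *\<^sub>R mix_upto N c (n j))\<bar>)
      \<longlongrightarrow> \<bar>mix_norm c k a - mix_norm_upto N c k a\<bar>) incr_seqs"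
    by (intro tendsto_rabs tendsto_diff mix_upto_tendsto N has_spreading_normD mix_norm c)
  show "\<forall>\<^sub>F n in incr_seqs. \<bar>norm (\<Sum>j<k. a j *\<^sub>R mix c (n j)) - norm (\<Sum>j<k. a j *\<^sub>R mix_upto N c (n j))\<bar>
      \<le> (\<Sum>j<k. \<bar>a j\<bar>) * T"
    by (rule eventually_incr_seqsI) (rule norm_lincomb_mix_tail[OF c T])
qed simp

lemma mix_norm_upto_tendsto:
  assumes c: "c \<in> weights"
  shows "(\<lambda>N. mix_norm_upto N c k a) \<longlonglongrightarrow> mix_norm c k a"
proof -
  have "(\<lambda>N. (\<Sum>j<k. \<bar>a j\<bar>) * (2 * (1/2) ^ N)) \<longlonglongrightarrow> (\<Sum>j<k. \<bar>a j\<bar>) * (2 * 0)"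
    by (intro tendsto_mult_left LIMSEQ_realpow_zero) auto
  then have lim: "(\<lambda>N. (\<Sum>j<k. \<bar>a j\<bar>) * (2 * (1/2) ^ N)) \<longlonglongrightarrow> 0" by simp
  have "(\<lambda>N. mix_norm_upto N c k a - mix_norm c k a) \<longlonglongrightarrow> 0"
  proof (rule Lim_null_comparison[OF _ lim])
    show "\<forall>\<^sub>F N in sequentially. norm (mix_norm_upto N c k a - mix_norm c k a) \<le> (\<Sum>j<k. \<bar>a j\<bar>) * (2 * (1/2) ^ N)"
      using eventually_gt_at_top[of 0]
    proof eventually_elim
      case (elim N)
      from mix_norm_tail[OF c weights_tail'[OF c] elim, of k a] show ?case
        by (simp add: abs_minus_commute)
    qed
  qed
  from tendsto_add[OF this tendsto_const[of "mix_norm c k a"]] show ?thesis by simp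
qed

text \<open>The quotients of the weights lie in [0,1] and act as multipliers on the flattened
  combination; the truncations then pass to the limit.\<close>

lemma mix_norm_mono:
  assumes c: "c \<in> weights" and d: "d \<in> weights" and le: "\<And>m. c m \<le> d m"
  shows "mix_norm c k a \<le> mix_norm d k a"
proof (rule LIMSEQ_le[OF mix_norm_upto_tendsto[OF c] mix_norm_upto_tendsto[OF d]])
  have "mix_norm_upto N c k a \<le> mix_norm_upto N d k a" for N
  proof -
    \<comment> \<open>Where \<open>d m = 0\<close>, also \<open>c m = 0\<close>, so the default 0
      still satisfies \<open>c m = t m * d m\<close>.\<close>
    define t where "t m = (if d m = 0 then 0 else c m / d m)" for m
    have t: "0 \<le> t m" "t m \<le> 1" "c m = t m * d m" for m
      using weightsD(1)[OF c, of m] weightsD(1)[OF d, of m] le[of m]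
      by (auto simp: t_def divide_le_eq_1)
    then have "(\<lambda>l. a (l div N) * c (l mod N)) = (\<lambda>l. t (l mod N) * (a (l div N) * d (l mod N)))"
      by (simp add: fun_eq_iff)
    then show ?thesis unfolding mix_norm_upto_def
      using joint_norm_multiplier[OF wn joint, of "k * N" "\<lambda>l. t (l mod N)" "\<lambda>l. l mod N"
          "\<lambda>l. a (l div N) * d (l mod N)"] t by simp
  qed
  then show "\<exists>N. \<forall>n\<ge>N. mix_norm_upto n c k a \<le> mix_norm_upto n d k a" by blast
qed

lemma mix_norm_scale:
  assumes c: "c \<in> weights" and sc: "(\<lambda>m. s * c m) \<in> weights"
  shows "mix_norm (\<lambda>m. s * c m) k a = \<bar>s\<bar> * mix_norm c k a"
proof -
  have "mix (\<lambda>m. s * c m) = (\<lambda>i. s *\<^sub>R mix c i)" by (simp add: mix_def scaleR_sum_right fun_eq_iff)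
  then have "has_spreading_norm (mix (\<lambda>m. s * c m)) (\<lambda>k a. \<bar>s\<bar> * mix_norm c k a)"
    using has_spreading_norm_scale[OF mix_norm[OF c], of s] by simp
  from tendsto_unique[OF incr_seqs_neq_bot has_spreading_normD[OF mix_norm[OF sc]] has_spreading_normD[OF this]]
  show ?thesis .
qed

lemma row_norm_shift_tendsto:
  "((\<lambda>n. norm (\<Sum>j<k. a j *\<^sub>R w m (n j * n j + m))) \<longlongrightarrow> row_norm m k a) incr_seqs"
proof -
  have "strict_mono (\<lambda>i. i * i + m)" unfolding strict_mono_Suc_iff by simp
  from has_spreading_normD[OF has_spreading_norm_subseq[OF row_norm this], of a m k]
  show ?thesis by (simp add: o_def)
qed

text \<open>Deleting all rows but \<open>m\<close> does not increase the norm, by monotonicity, and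
  leaves \<open>c m\<close> times a subsequence of row \<open>m\<close> as soon as the indices
  exceed \<open>m\<close>.\<close>

lemma mix_norm_lower:
  assumes c: "c \<in> weights"
  shows "c m * row_norm m k a \<le> mix_norm c k a"
proof -
  define d where "d r = (if r = m then c m else 0)" for r
  have d: "d \<in> weights" using c unfolding weights_def d_def by auto
  have "mix_norm d k a = c m * row_norm m k a"
  proof (rule tendsto_unique[OF incr_seqs_neq_bot has_spreading_normD[OF mix_norm[OF d]]])
    have "\<forall>\<^sub>F n in incr_seqs. c m * norm (\<Sum>j<k. a j *\<^sub>R w m (n j * n j + m)) = norm (\<Sum>j<k. a j *\<^sub>R mix d (n j))"
    proof (rule eventually_incr_seqsI)
      fix n :: "nat \<Rightarrow> nat" assume n: "strict_mono n" "Suc m \<le> n 0"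
      have "mix d (n j) = c m *\<^sub>R w m (n j * n j + m)" for j
      proof -
        have "m < n j" using strict_mono_nat_ge[OF n(1), of j] n(2) by simp
        then show ?thesis unfolding mix_def d_def by (simp add: if_distrib[of "\<lambda>x. x *\<^sub>R _"] sum.delta cong: if_cong)
      qed
      then have "(\<Sum>j<k. a j *\<^sub>R mix d (n j)) = c m *\<^sub>R (\<Sum>j<k. a j *\<^sub>R w m (n j * n j + m))"
        by (simp add: scaleR_sum_right mult.commute)
      then show "c m * norm (\<Sum>j<k. a j *\<^sub>R w m (n j * n j + m)) = norm (\<Sum>j<k. a j *\<^sub>R mix d (n j))"
        using weightsD(1)[OF c] by simp
    qed
    with tendsto_mult_left[OF row_norm_shift_tendsto, of "c m" a m k]
    show "((\<lambda>n. norm (\<Sum>j<k. a j *\<^sub>R mix d (n j))) \<longlongrightarrow> c m * row_norm m k a) incr_seqs"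
      by (rule Lim_transform_eventually)
  qed
  moreover have "mix_norm d k a \<le> mix_norm c k a"
    by (rule mix_norm_mono[OF d c]) (use weightsD(1)[OF c] in \<open>auto simp: d_def\<close>)
  ultimately show ?thesis by simp
qed

lemma mix_norm_upper:
  assumes c: "c \<in> weights" and T: "\<And>i. (\<Sum>m\<in>{N..<i}. c m) \<le> T"
  shows "mix_norm c k a \<le> (\<Sum>m<N. c m * row_norm m k a) + (\<Sum>j<k. \<bar>a j\<bar>) * T"
proof (rule tendsto_le[OF incr_seqs_neq_bot _ has_spreading_normD[OF mix_norm[OF c]]])
  show "((\<lambda>n. (\<Sum>m<N. c m * norm (\<Sum>j<k. a j *\<^sub>R w m (n j * n j + m))) + (\<Sum>j<k. \<bar>a j\<bar>) * T)
      \<longlongrightarrow> (\<Sum>m<N. c m * row_norm m k a) + (\<Sum>j<k. \<bar>a j\<bar>) * T) incr_seqs"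
    by (intro tendsto_add tendsto_sum tendsto_mult_left row_norm_shift_tendsto tendsto_const)
  show "\<forall>\<^sub>F n in incr_seqs. norm (\<Sum>j<k. a j *\<^sub>R mix c (n j)) \<le>
      (\<Sum>m<N. c m * norm (\<Sum>j<k. a j *\<^sub>R w m (n j * n j + m))) + (\<Sum>j<k. \<bar>a j\<bar>) * T"
  proof (rule eventually_incr_seqsI)
    fix n :: "nat \<Rightarrow> nat" assume n: "strict_mono n" "N \<le> n 0"
    have "(\<Sum>j<k. a j *\<^sub>R mix_upto N c (n j)) = (\<Sum>m<N. c m *\<^sub>R (\<Sum>j<k. a j *\<^sub>R w m (n j * n j + m)))"
      unfolding mix_upto_def scaleR_sum_right by (subst sum.swap) (simp add: mult.commute)
    also have "norm \<dots> \<le> (\<Sum>m<N. c m * norm (\<Sum>j<k. a j *\<^sub>R w m (n j * n j + m)))"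
      by (rule sum_norm_le) (use weightsD(1)[OF c] in auto)
    finally show "norm (\<Sum>j<k. a j *\<^sub>R mix c (n j)) \<le>
        (\<Sum>m<N. c m * norm (\<Sum>j<k. a j *\<^sub>R w m (n j * n j + m))) + (\<Sum>j<k. \<bar>a j\<bar>) * T"
      using norm_lincomb_mix_tail[OF c T n, where a = a and k = k] by linarith
  qed
qed

lemma weakly_null_mix:
  assumes c: "c \<in> weights"
  shows "weakly_null (mix c)"
  unfolding weakly_null_def
proof (intro allI impI)
  fix f :: "'a \<Rightarrow> real" assume f: "bounded_linear f"
  interpret f: bounded_linear f by (rule f)
  obtain K where K: "K > 0" "\<And>x. norm (f x) \<le> norm x * K" using f.pos_bounded by blast
  show "(\<lambda>i. f (mix c i)) \<longlonglongrightarrow> 0"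
  proof (rule tendstoI)
    fix e :: real assume e: "e > 0"
    have "(\<lambda>N. (2 * (1/2) ^ N) * K) \<longlonglongrightarrow> (2 * 0) * K"
      by (intro tendsto_mult_left tendsto_mult_right LIMSEQ_realpow_zero) auto
    then have "\<forall>\<^sub>F N in sequentially. (2 * (1/2) ^ N) * K < e / 2"
      using e by (intro order_tendstoD(2)) auto
    then obtain N where N: "(2 * (1/2) ^ N) * K < e / 2" unfolding eventually_sequentially by blast
    have wm: "(\<lambda>i. f (w m (i * i + m))) \<longlonglongrightarrow> 0" for m
    proof -
      have "strict_mono (\<lambda>i. i * i + m)" unfolding strict_mono_Suc_iff by simp
      from weakly_null_subseq[OF wn this] f show ?thesis unfolding weakly_null_def o_def by blast
    qed
    have "(\<lambda>i. \<Sum>m<N. c m * f (w m (i * i + m))) \<longlonglongrightarrow> (\<Sum>m<N. c m * 0)"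
      by (intro tendsto_sum tendsto_mult_left wm)
    then have "(\<lambda>i. f (mix_upto N c i)) \<longlonglongrightarrow> 0" unfolding mix_upto_def by (simp add: f.sum f.scaleR)
    then have "\<forall>\<^sub>F i in sequentially. dist (f (mix_upto N c i)) 0 < e / 2" using e by (intro tendstoD) auto
    then show "\<forall>\<^sub>F i in sequentially. dist (f (mix c i)) 0 < e"
      using eventually_ge_at_top[of N]
    proof eventually_elim
      case (elim i)
      have "norm (f (mix c i - mix_upto N c i)) \<le> norm (mix c i - mix_upto N c i) * K" by (rule K)
      also have "\<dots> \<le> (2 * (1/2) ^ N) * K"
        using norm_mix_tail[OF c weights_tail'[OF c] elim(2)] K(1) by (intro mult_right_mono) auto
      finally have "\<bar>f (mix c i) - f (mix_upto N c i)\<bar> < e / 2" using N by (simp add: f.diff)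
      with elim(1) show ?case unfolding dist_real_def by linarith
    qed
  qed
qed

end

subsection \<open>From increasing sequences to chains of length \<open>\<omega>\<^sub>1\<close>\<close>

lemma omega1_Well_order: "Well_order omega1"
  by (rule cardSuc_Well_order[OF natLeq_Card_order])

text \<open>Transfinite recursion: a proper initial segment of \<open>omega1\<close> is countable,
  so the values chosen on it have a common bound in \<open>F\<close>. The requirement
  \<open>P\<close> is vacuous outside the field, which makes the recursion total on the index
  type.\<close>

lemma omega1_chain:
  fixes F :: "'b set"
  assumes ub: "\<And>S. countable S \<Longrightarrow> S \<subseteq> F \<Longrightarrow> \<exists>g\<in>F. \<forall>f\<in>S. lt f g"
  obtains h :: "nat set \<Rightarrow> 'b" where "\<And>\<zeta>. \<zeta> \<in> Field omega1 \<Longrightarrow> h \<zeta> \<in> F"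
    "\<And>\<zeta> \<eta>. (\<zeta>, \<eta>) \<in> omega1 \<Longrightarrow> \<zeta> \<noteq> \<eta> \<Longrightarrow> lt (h \<zeta>) (h \<eta>)"
proof -
  define P where "P h \<eta> g \<longleftrightarrow> (\<eta> \<in> Field omega1 \<longrightarrow> g \<in> F \<and> (\<forall>\<zeta>. (\<zeta>, \<eta>) \<in> omega1 - Id \<longrightarrow> lt (h \<zeta>) g))"
    for h \<eta> g
  have "\<exists>h. \<forall>\<eta>. P h \<eta> (h \<eta>)"
  proof (rule dependent_wf_choice)
    show "wf (omega1 - Id)" using omega1_Well_order by (simp add: well_order_on_def)
    show "P h \<eta> g = P h' \<eta> g" if "\<And>\<zeta>. (\<zeta>, \<eta>) \<in> omega1 - Id \<Longrightarrow> h \<zeta> = h' \<zeta>" for h h' \<eta> g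
      using that unfolding P_def by auto
    fix \<eta> h assume IH: "\<And>\<zeta>. (\<zeta>, \<eta>) \<in> omega1 - Id \<Longrightarrow> P h \<zeta> (h \<zeta>)"
    show "\<exists>g. P h \<eta> g"
    proof (cases "\<eta> \<in> Field omega1")
      case True
      have "|underS omega1 \<eta>| <o omega1"
        by (rule card_of_underS[OF cardSuc_Card_order[OF natLeq_Card_order] True])
      then have "countable (underS omega1 \<eta>)"
        unfolding countable_card_le_natLeq
        by (simp add: cardSuc_ordLeq_ordLess[OF natLeq_Card_order card_of_Card_order])
      then have "countable (h ` underS omega1 \<eta>)" by (rule countable_image)
      moreover have "h ` underS omega1 \<eta> \<subseteq> F"
      proof
        fix f assume "f \<in> h ` underS omega1 \<eta>"
        then obtain \<zeta> where \<zeta>: "(\<zeta>, \<eta>) \<in> omega1" "\<zeta> \<noteq> \<eta>" "f = h \<zeta>" unfolding underS_def by blast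
        then show "f \<in> F" using IH[of \<zeta>] unfolding P_def Field_def by blast
      qed
      ultimately obtain g where "g \<in> F" "\<forall>f\<in>h ` underS omega1 \<eta>. lt f g" using ub by blast
      then show ?thesis unfolding P_def underS_def by blast
    qed (simp add: P_def)
  qed
  then obtain h where h: "\<And>\<eta>. P h \<eta> (h \<eta>)" by blast
  show thesis
  proof (rule that[of h])
    show "h \<zeta> \<in> F" if "\<zeta> \<in> Field omega1" for \<zeta> using h[of \<zeta>] that by (simp add: P_def)
    show "lt (h \<zeta>) (h \<eta>)" if "(\<zeta>, \<eta>) \<in> omega1" "\<zeta> \<noteq> \<eta>" for \<zeta> \<eta>
      using h[of \<eta>] that by (auto simp: P_def Field_def)
  qed
qed

section \<open>Exponents of the weights: functions that tend slowly to infinity\<close>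

text \<open>The bound \<open>f n \<le> n\<close> keeps the weights above the error margin fixed in
  \<open>peak_system\<close>; divergence leaves room for a function that is slower still.\<close>

definition slow_functions :: "(nat \<Rightarrow> nat) set" where
  "slow_functions = {f. (\<forall>n. f n \<le> n) \<and> filterlim f at_top sequentially}"

definition slower :: "(nat \<Rightarrow> nat) \<Rightarrow> (nat \<Rightarrow> nat) \<Rightarrow> bool" where
  "slower f g \<longleftrightarrow> (\<forall>K. \<forall>\<^sub>F n in sequentially. g n + K \<le> f n)"

text \<open>Diagonalization: \<open>g n\<close> is the largest \<open>j \<le> n\<close> such that
  the functions numbered \<open>0\<close> to \<open>j\<close> have all reached \<open>2 * j\<close>
  at \<open>n\<close>. The factor 2 gives \<open>h k n - g n \<ge> g n\<close> once
  \<open>k \<le> g n\<close>, and \<open>g\<close> tends to infinity.\<close>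

lemma slow_functions_countable_bound:
  assumes S: "countable S" "S \<subseteq> slow_functions"
  shows "\<exists>g\<in>slow_functions. \<forall>f\<in>S. slower f g"
proof (cases "S = {}")
  case True
  have "id \<in> slow_functions" by (auto simp: slow_functions_def filterlim_ident id_def)
  with True show ?thesis by blast
next
  case False
  define h where "h = from_nat_into S"
  have h: "S = range h" unfolding h_def using S(1) False by simp
  have slow: "filterlim (h k) at_top sequentially" for k
    using S(2) h unfolding slow_functions_def by blast
  define G where "G n = {j. j \<le> n \<and> (\<forall>k\<le>j. 2 * j \<le> h k n)}" for n
  define g where "g n = Max (G n)" for n
  have fin: "finite (G n)" for n unfolding G_def by simp
  have gG: "g n \<in> G n" for n
    unfolding g_def by (rule Max_in[OF fin]) (auto simp: G_def intro!: exI[of _ 0])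
  have g_lim: "\<forall>\<^sub>F n in sequentially. J \<le> g n" for J
  proof -
    have "\<forall>\<^sub>F n in sequentially. \<forall>k\<in>{..J}. 2 * J \<le> h k n"
      using slow unfolding filterlim_at_top by (intro eventually_ball_finite) auto
    with eventually_ge_at_top[of J] show ?thesis
      by eventually_elim (auto simp: g_def G_def intro!: Max_ge)
  qed
  have "g \<in> slow_functions"
    unfolding slow_functions_def filterlim_at_top using gG g_lim by (auto simp: G_def)
  moreover have "slower (h k) g" for k
    unfolding slower_def
  proof
    fix K
    show "\<forall>\<^sub>F n in sequentially. g n + K \<le> h k n"
      using g_lim[of "max k K"]
    proof eventually_elim
      case (elim n)
      have "2 * g n \<le> h k n" using gG[of n] elim unfolding G_def by auto
      with elim show ?case by simp
    qed
  qed
  ultimately show ?thesis unfolding h by blast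
qed

section \<open>Peak vectors and the chain of mixtures\<close>

context weakly_null_array
begin

lemma row_norm_nonneg: "0 \<le> row_norm m k a"
  by (rule has_spreading_norm_nonneg[OF row_norm])

lemma row_norm_scale: "row_norm m k (\<lambda>j. s * a j) = \<bar>s\<bar> * row_norm m k a"
  by (rule has_spreading_norm_homogeneous[OF row_norm])

end

locale increasing_array = weakly_null_array +
  assumes incr: "\<And>m. \<exists>K. \<forall>k a. row_norm m k a \<le> K * row_norm (Suc m) k a"
    and strict: "\<And>m C. \<exists>k a. row_norm (Suc m) k a > C * row_norm m k a"
    and pos: "row_norm 0 1 (\<lambda>_. 1) > 0"
begin

lemma row_norm_le_later:
  obtains K where "K > 0" "\<And>r k a. r \<le> m \<Longrightarrow> row_norm r k a \<le> K * row_norm m k a"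
proof -
  have "\<exists>K>0. \<forall>r k a. r \<le> m \<longrightarrow> row_norm r k a \<le> K * row_norm m k a"
  proof (induction m)
    case 0
    show ?case by (intro exI[of _ 1]) simp
  next
    case (Suc m)
    then obtain K where K: "K > 0" "\<And>r k a. r \<le> m \<Longrightarrow> row_norm r k a \<le> K * row_norm m k a" by blast
    obtain K' where K': "\<And>k a. row_norm m k a \<le> K' * row_norm (Suc m) k a" using incr by blast
    define M where "M = max 1 (K * K')"
    have "row_norm r k a \<le> M * row_norm (Suc m) k a" if "r \<le> Suc m" for r k a
    proof (cases "r = Suc m")
      case True
      have "1 * row_norm (Suc m) k a \<le> M * row_norm (Suc m) k a"
        by (intro mult_right_mono row_norm_nonneg) (simp add: M_def)
      with True show ?thesis by simp
    next
      case False
      with that have "row_norm r k a \<le> K * row_norm m k a" by (intro K) simp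
      also have "\<dots> \<le> K * (K' * row_norm (Suc m) k a)" using K(1) K' by (intro mult_left_mono) auto
      also have "\<dots> = K * K' * row_norm (Suc m) k a" by simp
      also have "\<dots> \<le> M * row_norm (Suc m) k a"
        by (intro mult_right_mono row_norm_nonneg) (simp add: M_def)
      finally show ?thesis .
    qed
    moreover have "M > 0" by (simp add: M_def)
    ultimately show ?case by blast
  qed
  then show thesis using that by blast
qed

text \<open>At a vector where row \<open>n\<close> exceeds row \<open>n - 1\<close> by a huge factor
  all earlier rows are small too, since row \<open>n - 1\<close> dominates them with a common
  constant \<open>K\<close>; homogeneity then normalizes row \<open>n\<close> to 1.\<close>

lemma peak_vector:
  assumes \<eta>: "\<eta> > 0"
  shows "\<exists>k a. row_norm n k a = 1 \<and> (\<forall>r<n. row_norm r k a \<le> \<eta>)"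
proof -
  have "\<exists>k a. row_norm n k a > 0 \<and> (\<forall>r<n. row_norm r k a \<le> \<eta> * row_norm n k a)"
  proof (cases n)
    case 0
    then show ?thesis using pos by auto
  next
    case (Suc m)
    obtain K where K: "K > 0" "\<And>r k a. r \<le> m \<Longrightarrow> row_norm r k a \<le> K * row_norm m k a"
      using row_norm_le_later by blast
    obtain k a where ka: "row_norm (Suc m) k a > (K / \<eta>) * row_norm m k a" using strict by blast
    have "0 \<le> (K / \<eta>) * row_norm m k a" using K \<eta> row_norm_nonneg by simp
    moreover have "row_norm r k a \<le> \<eta> * row_norm n k a" if "r < n" for r
    proof -
      have "row_norm r k a \<le> K * row_norm m k a" using that Suc by (intro K) simp
      also have "\<dots> \<le> \<eta> * row_norm (Suc m) k a" using ka \<eta> by (simp add: field_simps)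
      finally show ?thesis by (simp add: Suc)
    qed
    ultimately show ?thesis using ka Suc by (intro exI[of _ k] exI[of _ a]) auto
  qed
  then obtain k a where ka: "row_norm n k a > 0" "\<And>r. r < n \<Longrightarrow> row_norm r k a \<le> \<eta> * row_norm n k a" by blast
  define s where "s = inverse (row_norm n k a)"
  have s: "s > 0" using ka(1) by (simp add: s_def)
  show ?thesis
  proof (intro exI[of _ k] exI[of _ "\<lambda>j. s * a j"] conjI allI impI)
    show "row_norm n k (\<lambda>j. s * a j) = 1" unfolding row_norm_scale using s ka(1) by (simp add: s_def)
    fix r assume "r < n"
    then have "s * row_norm r k a \<le> s * (\<eta> * row_norm n k a)" using s ka(2) by (intro mult_left_mono) auto
    also have "\<dots> = \<eta>" using ka(1) by (simp add: s_def)
    finally show "row_norm r k (\<lambda>j. s * a j) \<le> \<eta>" unfolding row_norm_scale using s by simp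
  qed
qed

text \<open>The numbers \<open>\<beta> n\<close> decrease so fast that among the summands of a mixture with weights close
  to \<open>\<beta> n / 2 ^ n\<close> the \<open>n\<close>-th one dominates at the peak vector \<open>a n\<close>.\<close>

lemma peak_system:
  obtains \<beta> :: "nat \<Rightarrow> real" and k :: "nat \<Rightarrow> nat" and a :: "nat \<Rightarrow> nat \<Rightarrow> real" where
    "\<And>n. 0 < \<beta> n" "\<And>n. \<beta> n \<le> 1" "\<And>m n. n \<le> m \<Longrightarrow> \<beta> m \<le> \<beta> n"
    "\<And>n. row_norm n (k n) (a n) = 1"
    "\<And>n r. r < n \<Longrightarrow> row_norm r (k n) (a n) \<le> \<beta> n * (1/2)^n * (1/2)^n"
    "\<And>n. \<beta> (Suc n) * (\<Sum>j<k n. \<bar>a n j\<bar>) \<le> \<beta> n * (1/2)^n * (1/2)^n"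
proof -
  define P :: "nat \<Rightarrow> real \<times> nat \<times> (nat \<Rightarrow> real) \<Rightarrow> bool" where
    "P n = (\<lambda>(\<beta>, k, a). 0 < \<beta> \<and> \<beta> \<le> 1 \<and> row_norm n k a = 1 \<and>
      (\<forall>r<n. row_norm r k a \<le> \<beta> * (1/2)^n * (1/2)^n))" for n
  define Q :: "nat \<Rightarrow> real \<times> nat \<times> (nat \<Rightarrow> real) \<Rightarrow> real \<times> nat \<times> (nat \<Rightarrow> real) \<Rightarrow> bool" where
    "Q n = (\<lambda>(\<beta>, k, a) (\<beta>', _). \<beta>' \<le> \<beta> \<and> \<beta>' * (\<Sum>j<k. \<bar>a j\<bar>) \<le> \<beta> * (1/2)^n * (1/2)^n)" for n
  have ex: "\<exists>k a. P n (\<beta>, k, a)" if "0 < \<beta>" "\<beta> \<le> 1" for n \<beta>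
    using peak_vector[of "\<beta> * (1/2)^n * (1/2)^n" n] that unfolding P_def by auto
  have "\<exists>f. \<forall>n. P n (f n) \<and> Q n (f n) (f (Suc n))"
  proof (rule dependent_nat_choice)
    show "\<exists>x. P 0 x" using ex[of 1 0] by auto
    fix x n assume "P n x"
    obtain \<beta> k a where x: "x = (\<beta>, k, a)" by (cases x)
    \<comment> \<open>The least weight that row \<open>n\<close> can receive later: the exponents
      will satisfy \<open>f n \<le> n\<close>.\<close>
    define e where "e = \<beta> * (1/2)^n * (1/2)^n"
    define S where "S = (\<Sum>j<k. \<bar>a j\<bar>) + 1"
    have \<beta>: "0 < \<beta>" "\<beta> \<le> 1" using \<open>P n x\<close> unfolding P_def x by auto
    then have e: "e > 0" by (simp add: e_def)
    have S: "S > 0" unfolding S_def by (simp add: add_nonneg_pos sum_nonneg)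
    \<comment> \<open>\<open>\<beta>'\<close> is chosen after the peak vector of stage
      \<open>n\<close>. Dividing by its \<open>\<ell>\<^sub>1\<close> norm makes all later rows
      small at that vector, whatever their spreading norms are.\<close>
    define \<beta>' where "\<beta>' = min \<beta> (e / S)"
    have "0 < \<beta>'" "\<beta>' \<le> 1" using \<beta> e S by (auto simp: \<beta>'_def)
    from ex[OF this] obtain k' a' where 1: "P (Suc n) (\<beta>', k', a')" by blast
    have "\<beta>' * (S - 1) \<le> (e / S) * S"
      using e S \<open>0 < \<beta>'\<close> by (intro mult_mono) (auto simp: \<beta>'_def S_def sum_nonneg)
    then have "\<beta>' * (\<Sum>j<k. \<bar>a j\<bar>) \<le> e" using S by (simp add: S_def)
    then have "Q n x (\<beta>', k', a')" unfolding Q_def x by (simp add: e_def \<beta>'_def)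
    with 1 show "\<exists>y. P (Suc n) y \<and> Q n x y" by blast
  qed
  then obtain f where f: "\<And>n. P n (f n)" "\<And>n. Q n (f n) (f (Suc n))" by blast
  show thesis
  proof (rule that[of "\<lambda>n. fst (f n)" "\<lambda>n. fst (snd (f n))" "\<lambda>n. snd (snd (f n))"])
    fix m n :: nat
    show "0 < fst (f n)" "fst (f n) \<le> 1" "row_norm n (fst (snd (f n))) (snd (snd (f n))) = 1"
      using f(1)[of n] by (auto simp: P_def split_beta)
    show "row_norm r (fst (snd (f n))) (snd (snd (f n))) \<le> fst (f n) * (1/2)^n * (1/2)^n" if "r < n" for r
      using f(1)[of n] that by (auto simp: P_def split_beta)
    show "fst (f (Suc n)) * (\<Sum>j<fst (snd (f n)). \<bar>snd (snd (f n)) j\<bar>) \<le> fst (f n) * (1/2)^n * (1/2)^n"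
      using f(2)[of n] by (auto simp: Q_def split_beta)
    show "fst (f m) \<le> fst (f n)" if "n \<le> m"
      using that
    proof (rule lift_Suc_antimono_le[of "\<lambda>n. fst (f n)", rotated])
      show "fst (f (Suc n)) \<le> fst (f n)" for n using f(2)[of n] by (auto simp: Q_def split_beta)
    qed
  qed
qed

lemma mixtures_omega1_chain:
  obtains c :: "nat set \<Rightarrow> nat \<Rightarrow> real" where
    "\<And>\<zeta>. \<zeta> \<in> Field omega1 \<Longrightarrow> c \<zeta> \<in> weights"
    "\<And>\<zeta>. \<zeta> \<in> Field omega1 \<Longrightarrow> mix_norm (c \<zeta>) 1 (\<lambda>_. 1) > 0"
    "\<And>\<zeta> \<eta>. (\<zeta>, \<eta>) \<in> omega1 \<Longrightarrow> \<zeta> \<noteq> \<eta> \<Longrightarrow> \<exists>C. \<forall>k a. mix_norm (c \<zeta>) k a \<le> C * mix_norm (c \<eta>) k a"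
    "\<And>\<zeta> \<eta> C. (\<zeta>, \<eta>) \<in> omega1 \<Longrightarrow> \<zeta> \<noteq> \<eta> \<Longrightarrow> \<exists>k a. mix_norm (c \<eta>) k a > C * mix_norm (c \<zeta>) k a"
proof -
  obtain \<beta> k a where \<beta>: "\<And>n. 0 < \<beta> n" "\<And>n. \<beta> n \<le> 1" "\<And>m n. n \<le> m \<Longrightarrow> \<beta> m \<le> \<beta> n"
    and peak: "\<And>n. row_norm n (k n) (a n) = 1"
    and below: "\<And>n r. r < n \<Longrightarrow> row_norm r (k n) (a n) \<le> \<beta> n * (1/2)^n * (1/2)^n"
    and above: "\<And>n. \<beta> (Suc n) * (\<Sum>j<k n. \<bar>a n j\<bar>) \<le> \<beta> n * (1/2)^n * (1/2)^n"
    using peak_system by blast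
  define c where "c f n = \<beta> n * (1/2)^n * (1/2) ^ f n" for f :: "nat \<Rightarrow> nat" and n
  have c0: "0 < c f n" for f n by (simp add: c_def \<beta>)
  have c_le: "c f n \<le> \<beta> n * (1/2)^n" for f n
    using mult_left_mono[of "(1/2::real) ^ f n" 1 "\<beta> n * (1/2)^n"] \<beta>(1)[of n]
    by (simp add: c_def power_le_one)
  have cw: "c f \<in> weights" for f
  proof -
    have "c f n \<le> 1 * (1/2)^n" for n
      by (rule order_trans[OF c_le]) (intro mult_right_mono \<beta>(2), simp)
    then show ?thesis unfolding weights_def using c0[THEN less_imp_le] by auto
  qed
  \<comment> \<open>Of the factor 4, row \<open>n\<close> accounts for 1, the rows before it for 2
    (the total weight is at most 2 and each row norm at most \<open>e\<close>), and the rows after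
    it for 1.\<close>
  have upper: "mix_norm (c f) (k n) (a n) \<le> 4 * c f n" if f: "f n \<le> n" for f n
  proof -
    define e where "e = \<beta> n * (1/2)^n * (1/2)^n"
    have e: "0 \<le> e" "e \<le> c f n"
      unfolding e_def c_def using \<beta>(1)[of n] f
      by (auto intro!: mult_left_mono power_decreasing)
    have tail: "(\<Sum>m\<in>{Suc n..<i}. c f m) \<le> \<beta> (Suc n) * (2 * (1/2) ^ Suc n)" for i
    proof (rule weights_tail)
      fix m assume "Suc n \<le> m"
      show "c f m \<le> \<beta> (Suc n) * (1/2)^m"
        by (rule order_trans[OF c_le]) (intro mult_right_mono \<beta>(3) \<open>Suc n \<le> m\<close>, simp)
    qed (use \<beta>(1) less_imp_le in auto)
    have "mix_norm (c f) (k n) (a n) \<le> (\<Sum>m<Suc n. c f m * row_norm m (k n) (a n))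
        + (\<Sum>j<k n. \<bar>a n j\<bar>) * (\<beta> (Suc n) * (2 * (1/2) ^ Suc n))"
      by (rule mix_norm_upper[OF cw tail])
    also have "(\<Sum>j<k n. \<bar>a n j\<bar>) * (\<beta> (Suc n) * (2 * (1/2) ^ Suc n))
        = (\<beta> (Suc n) * (\<Sum>j<k n. \<bar>a n j\<bar>)) * (1/2)^n" by simp
    also have "\<dots> \<le> e * 1"
      using above[of n] e by (intro mult_mono) (auto simp: e_def power_le_one)
    also have "(\<Sum>m<Suc n. c f m * row_norm m (k n) (a n))
        = (\<Sum>m<n. c f m * row_norm m (k n) (a n)) + c f n" by (simp add: peak)
    also have "(\<Sum>m<n. c f m * row_norm m (k n) (a n)) \<le> (\<Sum>m<n. c f m * e)"
      using below c0 by (intro sum_mono mult_left_mono) (auto simp: e_def less_imp_le)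
    also have "\<dots> = (\<Sum>m\<in>{0..<n}. c f m) * e" by (simp add: sum_distrib_right atLeast0LessThan)
    also have "\<dots> \<le> (2 * (1/2)^0) * e" by (rule mult_right_mono[OF weights_tail'[OF cw] e(1)])
    finally show ?thesis using e by simp
  qed
  have lower: "c f n \<le> mix_norm (c f) (k n) (a n)" for f n
    using mix_norm_lower[OF cw[of f], of n "k n" "a n"] by (simp add: peak)
  obtain h where h: "\<And>\<zeta>. \<zeta> \<in> Field omega1 \<Longrightarrow> h \<zeta> \<in> slow_functions"
    "\<And>\<zeta> \<eta>. (\<zeta>, \<eta>) \<in> omega1 \<Longrightarrow> \<zeta> \<noteq> \<eta> \<Longrightarrow> slower (h \<zeta>) (h \<eta>)"
    using omega1_chain[of slow_functions slower] slow_functions_countable_bound by blast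
  show thesis
  proof (rule that[of "\<lambda>\<zeta>. c (h \<zeta>)"])
    show "c (h \<zeta>) \<in> weights" for \<zeta> by (rule cw)
    show "mix_norm (c (h \<zeta>)) 1 (\<lambda>_. 1) > 0" for \<zeta>
      using mix_norm_lower[OF cw[of "h \<zeta>"], of 0 1 "\<lambda>_. 1"] mult_pos_pos[OF c0[of "h \<zeta>" 0] pos] by linarith
    fix \<zeta> \<eta> assume *: "(\<zeta>, \<eta>) \<in> omega1" "\<zeta> \<noteq> \<eta>"
    define f g where "f = h \<zeta>" and "g = h \<eta>"
    have slower: "slower f g" unfolding f_def g_def by (rule h(2)[OF *])
    have f: "f \<in> slow_functions" unfolding f_def using h(1) * by (auto simp: Field_def)
    show "\<exists>C. \<forall>k a. mix_norm (c (h \<zeta>)) k a \<le> C * mix_norm (c (h \<eta>)) k a"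
    proof -
      from slower obtain N where N: "\<And>n. n \<ge> N \<Longrightarrow> g n + 0 \<le> f n"
        unfolding slower_def eventually_sequentially by meson
      \<comment> \<open>From \<open>N\<close> on, \<open>g\<close> lies below \<open>f\<close>;
        \<open>M\<close> bounds \<open>g\<close> at the finitely many earlier places. So the
        constant factor \<open>(1/2)^M\<close> puts the weights of \<open>f\<close> below those of
        \<open>g\<close> everywhere.\<close>
      define M where "M = (\<Sum>n<N. g n)"
      have M: "g n \<le> f n + M" for n
      proof (cases "n < N")
        case True
        then have "g n \<le> M" unfolding M_def by (intro member_le_sum) auto
        then show ?thesis by simp
      qed (use N[of n] in simp)
      define d where "d n = (1/2)^M * c f n" for n
      have d_le: "d n \<le> c f n" for n
        using mult_right_mono[of "(1/2::real)^M" 1 "c f n"] c0[of f n] by (simp add: d_def power_le_one)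
      have d0: "0 \<le> d n" for n unfolding d_def using c0[of f n] by simp
      have dw: "d \<in> weights" using d_le d0 weightsD(2)[OF cw[of f]] unfolding weights_def
        by (auto intro: order_trans)
      have "d n \<le> c g n" for n
      proof -
        have "(1/2::real) ^ (f n + M) \<le> (1/2) ^ g n" by (intro power_decreasing M) auto
        then have "\<beta> n * (1/2)^n * (1/2) ^ (f n + M) \<le> \<beta> n * (1/2)^n * (1/2) ^ g n"
          using \<beta>(1)[of n] by (intro mult_left_mono) auto
        then show ?thesis by (simp add: d_def c_def power_add mult_ac)
      qed
      then have "mix_norm d k a \<le> mix_norm (c g) k a" for k a by (rule mix_norm_mono[OF dw cw])
      moreover have "mix_norm d k a = (1/2)^M * mix_norm (c f) k a" for k a
        using mix_norm_scale[OF cw[of f], of "(1/2)^M" k a] dw unfolding d_def by simp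
      ultimately have "mix_norm (c f) k a \<le> 2^M * mix_norm (c g) k a" for k a
        by (simp add: field_simps power_divide)
      then show ?thesis unfolding f_def g_def by blast
    qed
    fix C
    show "\<exists>k a. mix_norm (c (h \<eta>)) k a > C * mix_norm (c (h \<zeta>)) k a"
    proof -
      \<comment> \<open>The 4 is the loss in \<open>upper\<close>. A single \<open>n\<close> with
        \<open>g n + K \<le> f n\<close> refutes the constant \<open>C\<close>, at the peak vector
        \<open>a n\<close>.\<close>
      obtain K where K: "4 * \<bar>C\<bar> < 2 ^ K" using real_arch_pow[of 2 "4 * \<bar>C\<bar>"] by auto
      from slower obtain n where n: "g n + K \<le> f n"
        unfolding slower_def eventually_sequentially by (meson order_refl)
      have "C * mix_norm (c f) (k n) (a n) \<le> \<bar>C\<bar> * mix_norm (c f) (k n) (a n)"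
        using lower[of f n] c0[of f n] by (intro mult_right_mono) auto
      also have "\<dots> \<le> \<bar>C\<bar> * (4 * c f n)"
        using f by (intro mult_left_mono upper) (auto simp: slow_functions_def)
      also have "\<dots> < 2 ^ K * c f n" using K c0[of f n] by simp
      also have "\<dots> \<le> c g n"
      proof -
        have "(1/2::real) ^ f n \<le> (1/2) ^ (g n + K)" by (intro power_decreasing n) auto
        then have "2 ^ K * (1/2::real) ^ f n \<le> (1/2) ^ g n"
          by (simp add: power_add power_divide field_simps)
        then have "(\<beta> n * (1/2)^n) * (2 ^ K * (1/2::real) ^ f n) \<le> (\<beta> n * (1/2)^n) * (1/2) ^ g n"
          using \<beta>(1)[of n] by (intro mult_left_mono) auto
        then show ?thesis by (simp add: c_def mult_ac)
      qed
      also have "\<dots> \<le> mix_norm (c g) (k n) (a n)" by (rule lower)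
      finally show ?thesis unfolding f_def g_def by blast
    qed
  qed
qed

end

section \<open>From spreading norms to equivalence classes of spreading models\<close>

lemma ex_class_in_SPw:
  assumes "z \<in> spreading_models_w X"
  shows "\<exists>p. p \<in> SPw X \<and> z \<in> p"
  unfolding SPw_def
  using assms equiv_class_self[OF equiv_SPw assms] quotientI[OF assms] by blast

lemma SPw_ex_representative:
  assumes "p \<in> SPw X"
  shows "\<exists>z. z \<in> p \<and> z \<in> spreading_models_w X"
proof -
  obtain z where z: "z \<in> spreading_models_w X"
    "p = {(y, z). y \<in> spreading_models_w X \<and> z \<in> spreading_models_w X \<and> equivalent_seq y z} `` {z}"
    using assms unfolding SPw_def by (elim quotientE)
  then show ?thesis using equiv_class_self[OF equiv_SPw z(1)] by blast
qed

lemma SP_less_iff: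
  assumes "p \<in> SPw X" "y \<in> p" "q \<in> SPw X" "z \<in> q"
  shows "SP_less p q \<longleftrightarrow> dominated y z \<and> \<not> dominated z y"
  unfolding SP_less_def using SP_le_iff[OF assms] SP_le_iff[OF assms(3,4,1,2)] by simp

lemma spreading_model_data:
  assumes "y \<in> spreading_models_w TYPE('a::banach)"
  obtains x :: "nat \<Rightarrow> 'a::banach" and m B where "weakly_null x" "m > 0" "\<And>i. m \<le> norm (x i)" "\<And>i. norm (x i) \<le> B"
    "has_spreading_norm x (\<lambda>k a. norm (\<Sum>j<k. a j *\<^sub>R y j))"
proof -
  obtain x :: "nat \<Rightarrow> 'a" where x: "weakly_null x" "generates_spreading_model x y"
    using assms unfolding spreading_models_w_def by blast
  then have s: "0 < (INF n. norm (x n))" "bdd_above (range (\<lambda>n. norm (x n)))"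
    unfolding generates_spreading_model_def seminormalized_def by auto
  obtain B where "\<And>i. norm (x i) \<le> B" using s(2) unfolding bdd_above_def by blast
  moreover have "(INF n. norm (x n)) \<le> norm (x i)" for i
    by (rule cINF_lower) (auto intro: bdd_belowI[of _ 0])
  ultimately show thesis
    using that[OF x(1) s(1)] generates_imp_has_spreading_norm[OF x(2)] by blast
qed

lemma increasing_sequence_imp_omega1:
  assumes "SPw_has_increasing TYPE('a::banach) natLeq"
  shows "SPw_has_increasing TYPE('a) omega1"
proof -
  obtain p where "\<forall>n\<in>Field natLeq. p n \<in> SPw TYPE('a)"
    and "\<forall>m n. (m, n) \<in> natLeq \<and> m \<noteq> n \<longrightarrow> SP_less (p m) (p n)"
    using assms unfolding SPw_has_increasing_def by (elim exE conjE)
  then have p: "p n \<in> SPw TYPE('a)" and less: "m < n \<Longrightarrow> SP_less (p m) (p n)" for m n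
    unfolding Field_natLeq by (auto simp: natLeq_def)
  obtain y where y: "\<And>n. y n \<in> p n" "\<And>n. y n \<in> spreading_models_w TYPE('a)"
    using SPw_ex_representative[OF p] by metis
  have dom: "dominated (y m) (y n)" "\<not> dominated (y n) (y m)" if "m < n" for m n
    using less[OF that] SP_less_iff[OF p y(1) p y(1)] by auto
  define D where "D n x B \<longleftrightarrow> weakly_null x \<and> B > 0 \<and> (\<forall>i. norm (x i) \<le> B) \<and> norm (y n 0) > 0 \<and>
      has_spreading_norm x (\<lambda>k a. norm (\<Sum>j<k. a j *\<^sub>R y n j))" for n and x :: "nat \<Rightarrow> 'a" and B
  have "\<exists>x B. D n x B" for n
  proof -
    obtain x :: "nat \<Rightarrow> 'a" and m B where x: "weakly_null x" "m > 0" "\<And>i. m \<le> norm (x i)"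
      "\<And>i. norm (x i) \<le> B" "has_spreading_norm x (\<lambda>k a. norm (\<Sum>j<k. a j *\<^sub>R y n j))"
      using spreading_model_data[OF y(2)] by blast
    have "B > 0" using x(2) x(3)[of 0] x(4)[of 0] by linarith
    moreover have "m \<le> norm (\<Sum>j<1. 1 *\<^sub>R y n j)"
      by (rule tendsto_lowerbound[OF has_spreading_norm_tendsto_norm[OF x(5)]]) (use x(3) in auto)
    ultimately show ?thesis using x unfolding D_def by (intro exI[of _ x] exI[of _ B]) auto
  qed
  then obtain x B where "\<And>n. D n (x n) (B n)" by metis
  then have x: "\<And>n. weakly_null (x n)" "\<And>n. B n > 0"
    "\<And>n i. norm (x n i) \<le> B n" "\<And>n. norm (y n 0) > 0"
    "\<And>n. has_spreading_norm (x n) (\<lambda>k a. norm (\<Sum>j<k. a j *\<^sub>R y n j))"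
    unfolding D_def by blast+
  \<comment> \<open>The array needs the common bound 1. A positive factor multiplies the spreading
    norm of a row by a constant, so the rows are ordered by domination just as the
    \<open>y n\<close> are.\<close>
  define u where "u n i = inverse (B n) *\<^sub>R x n i" for n i
  have u: "norm (u n i) \<le> 1" for n i
    using x(2)[of n] x(3)[of n i] by (simp add: u_def field_simps)
  obtain \<phi> where \<phi>: "strict_mono \<phi>"
    "\<And>k \<nu> a. \<exists>l. ((\<lambda>n. norm (\<Sum>j<k. a j *\<^sub>R u (\<nu> j) (\<phi> (n j)))) \<longlongrightarrow> l) incr_seqs"
    by (rule Brunel_Sucheston_array[OF u]) (rule that)
  define \<Lambda> where "\<Lambda> k \<nu> a = (SOME l. ((\<lambda>n. norm (\<Sum>j<k. a j *\<^sub>R u (\<nu> j) (\<phi> (n j)))) \<longlongrightarrow> l) incr_seqs)" for k \<nu> a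
  have \<Lambda>: "\<And>k \<nu> a. ((\<lambda>n. norm (\<Sum>j<k. a j *\<^sub>R u (\<nu> j) (\<phi> (n j)))) \<longlongrightarrow> \<Lambda> k \<nu> a) incr_seqs"
    unfolding \<Lambda>_def by (rule someI_ex[OF \<phi>(2)])
  define w where "w n = u n \<circ> \<phi>" for n
  interpret weakly_null_array w \<Lambda>
  proof
    show "has_joint_norm w \<Lambda>" using \<Lambda> unfolding has_joint_norm_def w_def by simp
    show "norm (w m i) \<le> 1" for m i by (simp add: w_def u)
    show "weakly_null (w m)" for m
      unfolding w_def
    proof (rule weakly_null_subseq[OF _ \<phi>(1)])
      show "weakly_null (u m)"
        unfolding weakly_null_def
      proof (intro allI impI)
        fix f :: "'a \<Rightarrow> real" assume f: "bounded_linear f"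
        interpret f: bounded_linear f by (rule f)
        have "(\<lambda>n. f (x m n)) \<longlonglongrightarrow> 0" using x(1) f unfolding weakly_null_def by blast
        from tendsto_mult_left[OF this, of "inverse (B m)"]
        show "(\<lambda>n. f (u m n)) \<longlonglongrightarrow> 0" by (simp add: u_def f.scaleR)
      qed
    qed
  qed
  have rn: "row_norm n k a = inverse (B n) * norm (\<Sum>j<k. a j *\<^sub>R y n j)" for n k a
  proof -
    have "has_spreading_norm (w n) (\<lambda>k a. \<bar>inverse (B n)\<bar> * norm (\<Sum>j<k. a j *\<^sub>R y n j))"
      unfolding w_def u_def by (intro has_spreading_norm_subseq \<phi> has_spreading_norm_scale x)
    from tendsto_unique[OF incr_seqs_neq_bot has_spreading_normD[OF row_norm] has_spreading_normD[OF this]]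
    show ?thesis using x(2)[of n] by simp
  qed
  interpret increasing_array w \<Lambda>
  proof
    fix m
    obtain K where K: "\<And>k a. norm (\<Sum>j<k. a j *\<^sub>R y m j) \<le> K * norm (\<Sum>j<(k::nat). a j *\<^sub>R y (Suc m) j)"
      using dom(1)[of m "Suc m"] unfolding dominated_iff by auto
    have "row_norm m k a \<le> (inverse (B m) * K * B (Suc m)) * row_norm (Suc m) k a" for k a
      unfolding rn using K[of a k] x(2)[of m] x(2)[of "Suc m"] by (simp add: field_simps)
    then show "\<exists>K. \<forall>k a. row_norm m k a \<le> K * row_norm (Suc m) k a" by blast
    fix C
    obtain k a where "\<not> norm (\<Sum>j<(k::nat). a j *\<^sub>R y (Suc m) j) \<le> (B (Suc m) * C * inverse (B m)) * norm (\<Sum>j<k. a j *\<^sub>R y m j)"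
      using dom(2)[of m "Suc m"] unfolding dominated_iff by blast
    then have "row_norm (Suc m) k a > C * row_norm m k a"
      unfolding rn using x(2)[of m] x(2)[of "Suc m"] by (simp add: field_simps)
    then show "\<exists>k a. row_norm (Suc m) k a > C * row_norm m k a" by blast
  next
    show "row_norm 0 1 (\<lambda>_. 1) > 0" unfolding rn using x(2)[of 0] x(4)[of 0] by simp
  qed
  obtain c where c: "\<And>\<zeta>. \<zeta> \<in> Field omega1 \<Longrightarrow> c \<zeta> \<in> weights"
    "\<And>\<zeta>. \<zeta> \<in> Field omega1 \<Longrightarrow> mix_norm (c \<zeta>) 1 (\<lambda>_. 1) > 0"
    "\<And>\<zeta> \<eta>. (\<zeta>, \<eta>) \<in> omega1 \<Longrightarrow> \<zeta> \<noteq> \<eta> \<Longrightarrow> \<exists>C. \<forall>k a. mix_norm (c \<zeta>) k a \<le> C * mix_norm (c \<eta>) k a"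
    "\<And>\<zeta> \<eta> C. (\<zeta>, \<eta>) \<in> omega1 \<Longrightarrow> \<zeta> \<noteq> \<eta> \<Longrightarrow> \<exists>k a. mix_norm (c \<eta>) k a > C * mix_norm (c \<zeta>) k a"
    using mixtures_omega1_chain by blast
  have "\<exists>q z. q \<in> SPw TYPE('a) \<and> z \<in> q \<and> (\<forall>k a. norm (\<Sum>j<k. a j *\<^sub>R z j) = mix_norm (c \<zeta>) k a)"
    if \<zeta>: "\<zeta> \<in> Field omega1" for \<zeta>
  proof -
    obtain z where z: "z \<in> spreading_models_w TYPE('a)" "\<And>k a. norm (\<Sum>j<k. a j *\<^sub>R z j) = mix_norm (c \<zeta>) k a"
      using spreading_model_of_norm[OF weakly_null_mix[OF c(1)[OF \<zeta>]] norm_mix_le[OF c(1)[OF \<zeta>]] mix_norm[OF c(1)[OF \<zeta>]] c(2)[OF \<zeta>]]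
      by blast
    with ex_class_in_SPw[OF z(1)] show ?thesis by blast
  qed
  then obtain q z where q: "\<And>\<zeta>. \<zeta> \<in> Field omega1 \<Longrightarrow> q \<zeta> \<in> SPw TYPE('a)"
    and z: "\<And>\<zeta>. \<zeta> \<in> Field omega1 \<Longrightarrow> z \<zeta> \<in> q \<zeta>"
    "\<And>\<zeta> k a. \<zeta> \<in> Field omega1 \<Longrightarrow> norm (\<Sum>j<k. a j *\<^sub>R z \<zeta> j) = mix_norm (c \<zeta>) k a" by metis
  have "SP_less (q \<zeta>) (q \<eta>)" if *: "(\<zeta>, \<eta>) \<in> omega1" "\<zeta> \<noteq> \<eta>" for \<zeta> \<eta>
  proof -
    have F: "\<zeta> \<in> Field omega1" "\<eta> \<in> Field omega1" using * by (auto simp: Field_def)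
    have "dominated (z \<zeta>) (z \<eta>)" unfolding dominated_iff z(2)[OF F(1)] z(2)[OF F(2)] by (rule c(3)[OF *])
    moreover have "\<not> dominated (z \<eta>) (z \<zeta>)"
      unfolding dominated_iff z(2)[OF F(1)] z(2)[OF F(2)] using c(4)[OF *] by (meson not_less)
    ultimately show ?thesis using SP_less_iff[OF q z(1) q z(1)] F by blast
  qed
  then show ?thesis unfolding SPw_has_increasing_def using q by (intro exI[of _ q]) auto
qed

subsection \<open>The Kleene-Brouwer order and a Kunen-Martin bound\<close>

text \<open>The image of \<open>f\<close> need not be an initial segment. If \<open>r'\<close> were
  shorter, then \<open>f\<close> followed by an isomorphism onto an initial segment of
  \<open>r\<close> would be a strictly increasing self-map of \<open>r\<close> that moves some point
  down; the least such point is moved to a smaller one that is also moved down.\<close>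

lemma strict_mono_imp_ordLeq:
  assumes r: "Well_order r" and r': "Well_order r'"
    and f: "\<And>a. a \<in> Field r \<Longrightarrow> f a \<in> Field r'"
    and mono: "\<And>a b. (a, b) \<in> r \<Longrightarrow> a \<noteq> b \<Longrightarrow> (f a, f b) \<in> r' \<and> f a \<noteq> f b"
  shows "r \<le>o r'"
proof (rule ccontr)
  assume "\<not> r \<le>o r'"
  then have "r' <o r" using ordLess_or_ordLeq[OF r' r] by blast
  then obtain a where a: "a \<in> Field r" "r' =o Restr r (underS r a)"
    using ordLess_iff_ordIso_Restr[OF r r'] by blast
  then obtain g where g: "iso r' (Restr r (underS r a)) g" unfolding ordIso_def by blast
  have bij: "bij_betw g (Field r') (Field (Restr r (underS r a)))"
    using g[unfolded iso_iff2] by (rule conjunct1)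
  have ord: "\<forall>x\<in>Field r'. \<forall>y\<in>Field r'. (x, y) \<in> r' \<longleftrightarrow> (g x, g y) \<in> Restr r (underS r a)"
    using g[unfolded iso_iff2] by (rule conjunct2)
  define h where "h = g \<circ> f"
  have g_less: "(g x, a) \<in> r - Id" "g x \<in> Field r" if "x \<in> Field r'" for x
  proof -
    have "g x \<in> Field (Restr r (underS r a))" by (rule bij_betw_apply[OF bij that])
    then have "g x \<in> underS r a" by (rule subsetD[OF Field_Restr_subset])
    then show "(g x, a) \<in> r - Id" "g x \<in> Field r" unfolding underS_def Field_def by auto
  qed
  have h_mono: "(h x, h y) \<in> r - Id" if "(x, y) \<in> r - Id" for x y
  proof -
    have xy: "f x \<in> Field r'" "f y \<in> Field r'" using that f by (auto simp: Field_def)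
    have "(g (f x), g (f y)) \<in> Restr r (underS r a)"
      using ord[rule_format, OF xy] mono[of x y] that by simp
    moreover have "g (f x) \<noteq> g (f y)"
      using inj_on_eq_iff[OF bij_betw_imp_inj_on[OF bij] xy] mono[of x y] that by simp
    ultimately show ?thesis by (simp add: h_def)
  qed
  have "wf (r - Id)" using r by (simp add: well_order_on_def)
  moreover have "a \<in> {x. (h x, x) \<in> r - Id}" using g_less(1)[OF f[OF a(1)]] by (simp add: h_def)
  ultimately obtain x where x: "(h x, x) \<in> r - Id" and min: "\<And>y. (y, x) \<in> r - Id \<Longrightarrow> (h y, y) \<notin> r - Id"
    by (rule wfE_min) blast
  show False using min[OF x] h_mono[OF x] by blast
qed

text \<open>Appending the symbol \<open>\<infinity>\<close> makes the lexicographic order put extensions before their prefixes.\<close>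

definition Kleene_Brouwer :: "(nat list \<times> nat list) set" where
  "Kleene_Brouwer = {(x, y). (map enat x @ [\<infinity>], map enat y @ [\<infinity>]) \<in> lexord {(a, b). a < b}}"

lemma Kleene_Brouwer_trans: "trans Kleene_Brouwer"
proof -
  have "trans {(a :: enat, b). a < b}" by (auto simp: trans_def)
  from lexord_transI[OF this] show ?thesis
    unfolding Kleene_Brouwer_def trans_def by blast
qed

lemma Kleene_Brouwer_irrefl: "(x, x) \<notin> Kleene_Brouwer"
  unfolding Kleene_Brouwer_def using lexord_irreflexive[of "{(a :: enat, b). a < b}"] by auto

lemma Kleene_Brouwer_total: "x \<noteq> y \<Longrightarrow> (x, y) \<in> Kleene_Brouwer \<or> (y, x) \<in> Kleene_Brouwer"
proof -
  assume "x \<noteq> y"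
  then have "map enat x @ [\<infinity>] \<noteq> map enat y @ [\<infinity>]"
    by (simp add: inj_map_eq_map inj_on_def)
  moreover have "total (lexord {(a :: enat, b). a < b})"
    by (rule total_lexord) (auto simp: total_on_def)
  ultimately show ?thesis unfolding Kleene_Brouwer_def total_on_def by blast
qed

lemma Kleene_Brouwer_extension: "(u @ a # x, u) \<in> Kleene_Brouwer"
  by (simp add: Kleene_Brouwer_def lexord_same_pref_iff)

lemma Kleene_Brouwer_branch: "a < b \<Longrightarrow> (u @ a # x, u @ b # y) \<in> Kleene_Brouwer"
  by (simp add: Kleene_Brouwer_def lexord_same_pref_iff)

text \<open>Without infinite branches the tree is well-founded in the direction of extension, which
  allows induction on a common prefix \<open>u\<close> of \<open>S\<close>: if some member extends
  \<open>u\<close>, follow the least possible next symbol; otherwise \<open>S\<close> is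
  \<open>{u}\<close>.\<close>

lemma Kleene_Brouwer_minimum:
  assumes pref: "\<forall>u x. u @ x \<in> T \<longrightarrow> u \<in> T"
    and nobranch: "\<And>b. \<exists>k. map b [0..<k] \<notin> T"
    and S: "S \<subseteq> T" "S \<noteq> {}"
  obtains m where "m \<in> S" "\<And>s. s \<in> S \<Longrightarrow> s \<noteq> m \<Longrightarrow> (m, s) \<in> Kleene_Brouwer"
proof -
  define X where "X = {(v, u). v \<in> T \<and> u \<in> T \<and> (\<exists>a :: nat. v = u @ [a])}"
  have "wf X"
    unfolding wf_iff_no_infinite_down_chain
  proof
    assume "\<exists>f. \<forall>i. (f (Suc i), f i) \<in> X"
    then obtain f where f: "\<And>i. f i \<in> T" "\<And>i. \<exists>a. f (Suc i) = f i @ [a]" unfolding X_def by blast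
    \<comment> \<open>The chain may begin at a nonempty node, so \<open>f k\<close> has length at
      least \<open>k\<close>, and only its first \<open>k\<close> symbols are compared with
      \<open>b\<close>.\<close>
    define b where "b j = f (Suc j) ! j" for j
    have len: "length (f i) = length (f 0) + i" for i
    proof (induction i)
      case (Suc i)
      with f(2)[of i] show ?case by auto
    qed simp
    have pre: "prefix (f i) (f (i + d))" for i d
    proof (induction d)
      case (Suc d)
      with f(2)[of "i + d"] show ?case by (auto simp: prefix_def)
    qed simp
    have "map b [0..<k] \<in> T" for k
    proof -
      have "b j = f k ! j" if "j < k" for j
        using pre[of "Suc j" "k - Suc j"] that len[of "Suc j"]
        by (auto simp: b_def prefix_def nth_append)
      then have "map b [0..<k] = take k (f k)"
        using len[of k] by (intro nth_equalityI) auto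
      then show ?thesis using pref[rule_format, of "take k (f k)" "drop k (f k)"] f(1)[of k] by simp
    qed
    with nobranch show False by blast
  qed
  have "\<exists>m\<in>S. \<forall>s\<in>S. s \<noteq> m \<longrightarrow> (m, s) \<in> Kleene_Brouwer"
    if "S \<subseteq> T" "S \<noteq> {}" "\<forall>s\<in>S. prefix u s" for S u
    using \<open>wf X\<close> that
  proof (induction u arbitrary: S)
    case (less u)
    show ?case
    proof (cases "\<exists>a. \<exists>s\<in>S. prefix (u @ [a]) s")
      case False
      have "s = u" if "s \<in> S" for s
      proof (rule ccontr)
        assume "s \<noteq> u"
        with less.prems(3) that obtain z where "s = u @ z" "z \<noteq> []" by (auto simp: prefix_def)
        then have "prefix (u @ [hd z]) s" by (cases z) (auto simp: prefix_def)
        with False that show False by blast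
      qed
      with less.prems(2) show ?thesis by blast
    next
      case True
      define a where "a = (LEAST a. \<exists>s\<in>S. prefix (u @ [a]) s)"
      define S' where "S' = {s \<in> S. prefix (u @ [a]) s}"
      have S': "S' \<noteq> {}" using LeastI_ex[OF True] unfolding S'_def a_def by blast
      then obtain s0 where s0: "s0 \<in> S" "prefix (u @ [a]) s0" unfolding S'_def by blast
      have "(u @ [a], u) \<in> X"
        using s0 less.prems(1) pref unfolding X_def prefix_def by fastforce
      from less.IH[OF this, of S'] S' less.prems(1) obtain m where
        m: "m \<in> S'" "\<And>s. s \<in> S' \<Longrightarrow> s \<noteq> m \<Longrightarrow> (m, s) \<in> Kleene_Brouwer"
        unfolding S'_def by blast
      obtain x where x: "m = u @ a # x" using m(1) unfolding S'_def prefix_def by auto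
      have "(m, s) \<in> Kleene_Brouwer" if s: "s \<in> S" "s \<noteq> m" for s
      proof -
        obtain z where z: "s = u @ z" using less.prems(3) s(1) by (auto simp: prefix_def)
        show ?thesis
        proof (cases z)
          case Nil
          then show ?thesis using z x Kleene_Brouwer_extension by simp
        next
          case (Cons b y)
          then have "prefix (u @ [b]) s" using z by (auto simp: prefix_def)
          then have "a \<le> b" unfolding a_def using s(1) by (intro Least_le) blast
          show ?thesis
          proof (cases "a = b")
            case True
            then have "s \<in> S'" using s z Cons unfolding S'_def by (auto simp: prefix_def)
            with m(2) s(2) show ?thesis by blast
          next
            case False
            with \<open>a \<le> b\<close> have "a < b" by simp
            then show ?thesis using x z Cons Kleene_Brouwer_branch by simp
          qed
        qed
      qed
      then show ?thesis using m(1) unfolding S'_def by blast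
    qed
  qed
  from this[of S "[]"] S show thesis using that by auto
qed

lemma Kleene_Brouwer_Well_order:
  assumes pref: "\<forall>u x. u @ x \<in> T \<longrightarrow> u \<in> T"
    and nobranch: "\<And>b. \<exists>k. map b [0..<k] \<notin> T"
  defines "r \<equiv> {(x, y). x \<in> T \<and> y \<in> T \<and> (x = y \<or> (x, y) \<in> Kleene_Brouwer)}"
  shows "Field r = T" "Well_order r"
proof -
  show F: "Field r = T" unfolding Field_def r_def by auto
  have "wf (r - Id)"
  proof (rule wfI_min)
    fix x and Q :: "nat list set" assume x: "x \<in> Q"
    show "\<exists>z\<in>Q. \<forall>y. (y, z) \<in> r - Id \<longrightarrow> y \<notin> Q"
    proof (cases "Q \<inter> T = {}")
      case True
      with x show ?thesis unfolding r_def by blast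
    next
      case False
      from Kleene_Brouwer_minimum[OF pref nobranch Int_lower2 False] obtain m where
        m: "m \<in> Q \<inter> T" "\<And>s. s \<in> Q \<inter> T \<Longrightarrow> s \<noteq> m \<Longrightarrow> (m, s) \<in> Kleene_Brouwer" by blast
      have "y \<notin> Q" if y: "(y, m) \<in> r - Id" for y
      proof
        assume "y \<in> Q"
        with y m(2)[of y] have "(m, y) \<in> Kleene_Brouwer" "(y, m) \<in> Kleene_Brouwer" unfolding r_def by auto
        with Kleene_Brouwer_trans Kleene_Brouwer_irrefl show False unfolding trans_def by blast
      qed
      with m(1) show ?thesis by blast
    qed
  qed
  moreover have "refl_on T r" by (rule refl_onI) (auto simp: r_def)
  moreover have "trans r"
    using Kleene_Brouwer_trans unfolding r_def trans_def by blast
  moreover have "antisym r"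
    using Kleene_Brouwer_trans Kleene_Brouwer_irrefl unfolding r_def trans_def antisym_def by blast
  moreover have "total_on T r"
    using Kleene_Brouwer_total unfolding r_def total_on_def by blast
  moreover have "r \<subseteq> T \<times> T" unfolding r_def by auto
  ultimately show "Well_order r"
    unfolding F order_on_defs by simp
qed

section \<open>The tree of finite attempts and the Kunen-Martin embedding\<close>

text \<open>Each entry is one natural number recording a whole square of values, and the squares
  grow with \<open>i\<close>. So an entry depends on finitely many values only, while an infinite
  branch determines all functions completely.\<close>

definition attempt_entry :: "(nat \<Rightarrow> nat \<Rightarrow> nat) \<Rightarrow> (nat \<Rightarrow> nat \<Rightarrow> nat) \<Rightarrow> nat \<Rightarrow> nat" where
  "attempt_entry c v i = to_nat (map (\<lambda>j. map (\<lambda>l. (c j l, v j l)) [0..<Suc i]) [0..<Suc i])"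

lemma attempt_entry_eq_iff:
  "attempt_entry c v i = attempt_entry c' v' i \<longleftrightarrow>
    (\<forall>j\<le>i. \<forall>l\<le>i. c j l = c' j l \<and> v j l = v' j l)"
  unfolding attempt_entry_def by (auto simp del: upt_Suc)

text \<open>An attempt that runs down in \<open>r\<close> is a finite increasing
  \<open>E\<close>-chain. Send \<open>\<zeta>\<close> to the Kleene-Brouwer least attempt ending at
  \<open>\<zeta>\<close>. For \<open>\<eta>\<close> below \<open>\<zeta>\<close> that attempt can be
  prolonged by \<open>\<eta>\<close>, and extensions come first in the order, so the map is strictly
  increasing.\<close>

lemma descending_family_bound:
  fixes E :: "(nat \<Rightarrow> nat) \<Rightarrow> (nat \<Rightarrow> nat) \<Rightarrow> (nat \<Rightarrow> nat) \<Rightarrow> bool"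
  assumes closed: "\<And>c c' v. (\<And>N. \<exists>d d' u. E d d' u \<and> (\<forall>l\<le>N. d l = c l \<and> d' l = c' l \<and> u l = v l)) \<Longrightarrow> E c c' v"
    and nochain: "\<And>c v. \<exists>n. \<not> E (c n) (c (Suc n)) (v n)"
  shows "\<exists>\<xi> :: nat rel. Well_order \<xi> \<and> (\<forall>(r :: 'i rel) c. Well_order r \<longrightarrow>
    (\<forall>\<zeta> \<eta>. (\<zeta>, \<eta>) \<in> r \<and> \<zeta> \<noteq> \<eta> \<longrightarrow> (\<exists>v. E (c \<eta>) (c \<zeta>) v)) \<longrightarrow> r \<le>o \<xi>)"
proof -
  \<comment> \<open>The witness of the step from \<open>j\<close> to \<open>Suc j\<close> is stored
    at index \<open>Suc j\<close>. It is then known only with the later of the two nodes, and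
    prolonging an attempt leaves its earlier entries unchanged (\<open>F_snoc\<close>).\<close>
  define T where "T = {map (attempt_entry c v) [0..<k] | c v k. \<forall>j. Suc j < k \<longrightarrow> E (c j) (c (Suc j)) (v (Suc j))}"
  have pref: "\<forall>u x. u @ x \<in> T \<longrightarrow> u \<in> T"
  proof (intro allI impI)
    fix u x assume "u @ x \<in> T"
    then obtain c v k where *: "u @ x = map (attempt_entry c v) [0..<k]"
      "\<forall>j. Suc j < k \<longrightarrow> E (c j) (c (Suc j)) (v (Suc j))" unfolding T_def by blast
    have le: "length u \<le> k" using arg_cong[OF *(1), of length] by simp
    have "u = take (length u) (u @ x)" by simp
    also have "\<dots> = map (attempt_entry c v) [0..<length u]" unfolding *(1) using le by (simp add: take_map)
    finally show "u \<in> T" unfolding T_def mem_Collect_eq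
      using *(2) le by (intro exI[of _ "length u"] exI[of _ "v"] exI[of _ "c"] conjI) auto
  qed
  have nobranch: "\<exists>k. map b [0..<k] \<notin> T" for b
  proof (rule ccontr)
    assume "\<nexists>k. map b [0..<k] \<notin> T"
    then have "\<exists>c v. map b [0..<k] = map (attempt_entry c v) [0..<k] \<and>
        (\<forall>j. Suc j < k \<longrightarrow> E (c j) (c (Suc j)) (v (Suc j)))" for k
    proof -
      have "map b [0..<k] \<in> T" using \<open>\<nexists>k. map b [0..<k] \<notin> T\<close> by blast
      then obtain c v k' where *: "map b [0..<k] = map (attempt_entry c v) [0..<k']"
        "\<forall>j. Suc j < k' \<longrightarrow> E (c j) (c (Suc j)) (v (Suc j))" unfolding T_def by blast
      moreover have "k' = k" using arg_cong[OF *(1), of length] by simp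
      ultimately show ?thesis by blast
    qed
    then obtain C V where CV: "\<And>k. map b [0..<k] = map (attempt_entry (C k) (V k)) [0..<k]"
      "\<And>k j. Suc j < k \<Longrightarrow> E (C k j) (C k (Suc j)) (V k (Suc j))" by metis
    have b: "b i = attempt_entry (C k) (V k) i" if "i < k" for i k
      using CV(1)[of k] that by (simp add: list_eq_iff_nth_eq)
    have agree: "C k j l = C k' j l \<and> V k j l = V k' j l" if "max j l < k" "max j l < k'" for k k' j l
      using b[OF that(1)] b[OF that(2)] attempt_entry_eq_iff[of "C k" "V k" "max j l" "C k'" "V k'"]
      by auto
    \<comment> \<open>The value at \<open>(j, l)\<close> is read from the attempt of length
      \<open>Suc (max j l)\<close>, the first one long enough to record it; all longer attempts
      agree.\<close>
    define c where "c j l = C (Suc (max j l)) j l" for j l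
    define v where "v j l = V (Suc (max j l)) j l" for j l
    have "E (c j) (c (Suc j)) (v (Suc j))" for j
    proof (rule closed)
      fix N
      define k where "k = Suc (Suc (j + N))"
      have "E (C k j) (C k (Suc j)) (V k (Suc j))" by (rule CV(2)) (simp add: k_def)
      moreover have "C k i l = c i l \<and> V k i l = v i l" if "i \<le> Suc j" "l \<le> N" for i l
        unfolding c_def v_def by (rule agree) (use that in \<open>auto simp: k_def\<close>)
      ultimately show "\<exists>d d' u. E d d' u \<and> (\<forall>l\<le>N. d l = c j l \<and> d' l = c (Suc j) l \<and> u l = v (Suc j) l)"
        by (intro exI[of _ "C k j"] exI[of _ "C k (Suc j)"] exI[of _ "V k (Suc j)"]) auto
    qed
    with nochain[of c "\<lambda>n. v (Suc n)"] show False by blast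
  qed
  define \<rho> where "\<rho> = {(x, y). x \<in> T \<and> y \<in> T \<and> (x = y \<or> (x, y) \<in> Kleene_Brouwer)}"
  have \<rho>: "Field \<rho> = T" "Well_order \<rho>"
    unfolding \<rho>_def by (rule Kleene_Brouwer_Well_order[OF pref nobranch])+
  have inj: "inj_on (to_nat :: nat list \<Rightarrow> nat) (Field \<rho>)" by (simp add: inj_on_def)
  define \<xi> where "\<xi> = dir_image \<rho> (to_nat :: nat list \<Rightarrow> nat)"
  have \<xi>: "Well_order \<xi>" "\<rho> =o \<xi>"
    unfolding \<xi>_def using Well_order_dir_image[OF \<rho>(2) inj] dir_image_ordIso[OF \<rho>(2) inj] .
  have bound: "r \<le>o \<xi>" if r: "Well_order r"
    and c: "\<And>\<zeta> \<eta>. (\<zeta>, \<eta>) \<in> r \<Longrightarrow> \<zeta> \<noteq> \<eta> \<Longrightarrow> \<exists>v. E (c \<eta>) (c \<zeta>) v" for r :: "'i rel" and c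
  proof -
    define W where "W \<eta> \<zeta> = (SOME v. E (c \<eta>) (c \<zeta>) v)" for \<eta> \<zeta>
    have W: "E (c \<eta>) (c \<zeta>) (W \<eta> \<zeta>)" if "(\<zeta>, \<eta>) \<in> r" "\<zeta> \<noteq> \<eta>" for \<eta> \<zeta>
      unfolding W_def by (rule someI_ex[OF c[OF that]])
    define desc where "desc \<sigma> \<longleftrightarrow> (\<forall>j. Suc j < length \<sigma> \<longrightarrow> (\<sigma> ! Suc j, \<sigma> ! j) \<in> r - Id)" for \<sigma> :: "'i list"
    \<comment> \<open>At \<open>j = 0\<close> the truncated subtraction yields the filler
      \<open>W (\<sigma> ! 0) (\<sigma> ! 0)\<close>; the conditions in \<open>T\<close> begin with
      the witness at index 1.\<close>
    define F where "F \<sigma> = map (attempt_entry (\<lambda>j. c (\<sigma> ! j)) (\<lambda>j. W (\<sigma> ! (j - 1)) (\<sigma> ! j))) [0..<length \<sigma>]" for \<sigma>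
    have FT: "F \<sigma> \<in> T" if "desc \<sigma>" for \<sigma>
      unfolding F_def T_def mem_Collect_eq
    proof (rule exI[of _ "\<lambda>j. c (\<sigma> ! j)"], rule exI[of _ "\<lambda>j. W (\<sigma> ! (j - 1)) (\<sigma> ! j)"],
        rule exI[of _ "length \<sigma>"], intro conjI allI impI refl)
      fix j assume "Suc j < length \<sigma>"
      then have *: "(\<sigma> ! Suc j, \<sigma> ! j) \<in> r - Id" using that unfolding desc_def by blast
      then show "E (c (\<sigma> ! j)) (c (\<sigma> ! Suc j)) (W (\<sigma> ! (Suc j - 1)) (\<sigma> ! Suc j))"
        using W[of "\<sigma> ! Suc j" "\<sigma> ! j"] by simp
    qed
    have F_snoc: "F (\<sigma> @ [\<eta>]) = F \<sigma> @ [last (F (\<sigma> @ [\<eta>]))]" for \<sigma> \<eta>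
    proof -
      have "attempt_entry (\<lambda>j. c ((\<sigma> @ [\<eta>]) ! j)) (\<lambda>j. W ((\<sigma> @ [\<eta>]) ! (j - 1)) ((\<sigma> @ [\<eta>]) ! j)) i
          = attempt_entry (\<lambda>j. c (\<sigma> ! j)) (\<lambda>j. W (\<sigma> ! (j - 1)) (\<sigma> ! j)) i" if "i < length \<sigma>" for i
        unfolding attempt_entry_eq_iff using that by (auto simp: nth_append)
      then show ?thesis by (simp add: F_def)
    qed
    define S where "S \<zeta> = {F \<sigma> | \<sigma>. desc \<sigma> \<and> \<sigma> \<noteq> [] \<and> last \<sigma> = \<zeta>}" for \<zeta>
    have S_sub: "S \<zeta> \<subseteq> T" for \<zeta> unfolding S_def using FT by auto
    define min where "min \<zeta> m \<longleftrightarrow> m \<in> S \<zeta> \<and> (\<forall>s\<in>S \<zeta>. s \<noteq> m \<longrightarrow> (m, s) \<in> Kleene_Brouwer)" for \<zeta> m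
    have "\<exists>m. min \<zeta> m" for \<zeta>
    proof -
      have "F [\<zeta>] \<in> S \<zeta>" unfolding S_def desc_def by auto
      then have ne: "S \<zeta> \<noteq> {}" by blast
      show ?thesis unfolding min_def by (rule Kleene_Brouwer_minimum[OF pref nobranch S_sub ne]) blast
    qed
    then obtain M where "\<And>\<zeta>. min \<zeta> (M \<zeta>)" by metis
    then have M: "\<And>\<zeta>. M \<zeta> \<in> S \<zeta>"
      "\<And>\<zeta> s. s \<in> S \<zeta> \<Longrightarrow> s \<noteq> M \<zeta> \<Longrightarrow> (M \<zeta>, s) \<in> Kleene_Brouwer"
      unfolding min_def by blast+
    have MT: "M \<zeta> \<in> T" for \<zeta> by (rule subsetD[OF S_sub M(1)])
    have "r \<le>o \<rho>"
    proof (rule strict_mono_imp_ordLeq[OF r \<rho>(2)])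
      show "M \<zeta> \<in> Field \<rho>" for \<zeta> using MT \<rho>(1) by simp
      fix \<eta> \<zeta> assume *: "(\<eta>, \<zeta>) \<in> r" "\<eta> \<noteq> \<zeta>"
      obtain \<sigma> where \<sigma>: "M \<zeta> = F \<sigma>" "desc \<sigma>" "\<sigma> \<noteq> []" "last \<sigma> = \<zeta>" using M(1)[of \<zeta>] unfolding S_def by blast
      have "desc (\<sigma> @ [\<eta>])"
        unfolding desc_def
      proof (intro allI impI)
        fix j assume j: "Suc j < length (\<sigma> @ [\<eta>])"
        show "((\<sigma> @ [\<eta>]) ! Suc j, (\<sigma> @ [\<eta>]) ! j) \<in> r - Id"
        proof (cases "Suc j < length \<sigma>")
          case True
          then show ?thesis using \<sigma>(2) unfolding desc_def by (auto simp: nth_append)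
        next
          case False
          then have "j = length \<sigma> - 1" using j by simp
          then show ?thesis using * \<sigma>(3,4) by (auto simp: nth_append last_conv_nth)
        qed
      qed
      then have "F (\<sigma> @ [\<eta>]) \<in> S \<eta>" unfolding S_def by auto
      moreover have "(F (\<sigma> @ [\<eta>]), M \<zeta>) \<in> Kleene_Brouwer"
        by (subst F_snoc) (simp add: \<sigma>(1) Kleene_Brouwer_extension)
      ultimately have "(M \<eta>, M \<zeta>) \<in> Kleene_Brouwer"
        using M(2)[of "F (\<sigma> @ [\<eta>])" \<eta>] transD[OF Kleene_Brouwer_trans, of "M \<eta>" "F (\<sigma> @ [\<eta>])" "M \<zeta>"]
        by (cases "F (\<sigma> @ [\<eta>]) = M \<eta>") simp_all
      then show "(M \<eta>, M \<zeta>) \<in> \<rho> \<and> M \<eta> \<noteq> M \<zeta>"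
        using MT[of \<eta>] MT[of \<zeta>] Kleene_Brouwer_irrefl[of "M \<eta>"] unfolding \<rho>_def by auto
    qed
    then show ?thesis using \<xi>(2) by (rule ordLeq_ordIso_trans)
  qed
  show ?thesis
  proof (rule exI[of _ \<xi>], intro conjI allI impI)
    fix r :: "'i rel" and c
    assume r: "Well_order r" and c: "\<forall>\<zeta> \<eta>. (\<zeta>, \<eta>) \<in> r \<and> \<zeta> \<noteq> \<eta> \<longrightarrow> (\<exists>v. E (c \<eta>) (c \<zeta>) v)"
    show "r \<le>o \<xi>" by (rule bound[OF r c[rule_format, OF conjI]])
  qed (rule \<xi>(1))
qed

subsection \<open>Codes of spreading models\<close>

text \<open>A functional bounded away from \<open>0\<close> on a subsequence bounds the spreading norm of
  nonnegative vectors from below by the \<open>\<ell>\<^sub>1\<close> norm.\<close>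

lemma weakly_null_of_suppression:
  assumes L: "has_spreading_norm x L"
    and supp: "\<And>k a F. L k (\<lambda>j. if j \<in> F then a j else 0) \<le> L k a"
    and not_l1: "\<not> (\<exists>C. \<forall>k a. (\<Sum>j<k. \<bar>a j\<bar>) \<le> C * L k a)"
  shows "weakly_null x"
  unfolding weakly_null_def
proof (intro allI impI, rule ccontr)
  fix f :: "'a \<Rightarrow> real" assume f: "bounded_linear f" and "\<not> (\<lambda>n. f (x n)) \<longlonglongrightarrow> 0"
  interpret f: bounded_linear f by (rule f)
  obtain K where K: "K > 0" "\<And>y. norm (f y) \<le> norm y * K" using f.pos_bounded by blast
  from \<open>\<not> (\<lambda>n. f (x n)) \<longlonglongrightarrow> 0\<close> obtain \<delta> where \<delta>: "\<delta> > 0" "\<And>N. \<exists>n\<ge>N. \<delta> \<le> \<bar>f (x n)\<bar>"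
    unfolding LIMSEQ_iff by (auto simp: not_less)
  have "infinite {n. \<delta> \<le> \<bar>f (x n)\<bar>}" unfolding infinite_nat_iff_unbounded_le using \<delta>(2) by auto
  moreover have "{n. \<delta> \<le> \<bar>f (x n)\<bar>} = {n. \<delta> \<le> f (x n)} \<union> {n. \<delta> \<le> - f (x n)}" by (auto simp: abs_if)
  ultimately have "infinite {n. \<delta> \<le> 1 * f (x n)} \<or> infinite {n. \<delta> \<le> (-1) * f (x n)}" by simp
  then obtain s :: real where s: "\<bar>s\<bar> = 1" and inf: "infinite {n. \<delta> \<le> s * f (x n)}"
    by (metis abs_minus_cancel abs_one)
  define \<phi> where "\<phi> = enumerate {n. \<delta> \<le> s * f (x n)}"
  have \<phi>: "strict_mono \<phi>" unfolding \<phi>_def by (rule strict_mono_enumerate[OF inf])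
  have f\<phi>: "\<delta> \<le> s * f (x (\<phi> i))" for i using enumerate_in_set[OF inf, of i] by (simp add: \<phi>_def)
  have lower: "(\<Sum>j<k. a j) * \<delta> \<le> K * L k a" if a: "\<And>j. a j \<ge> 0" for k a
  proof (rule tendsto_lowerbound)
    show "((\<lambda>n. K * norm (\<Sum>j<k. a j *\<^sub>R (x \<circ> \<phi>) (n j))) \<longlongrightarrow> K * L k a) incr_seqs"
      by (intro tendsto_mult_left has_spreading_normD has_spreading_norm_subseq L \<phi>)
    have "(\<Sum>j<k. a j) * \<delta> \<le> K * norm (\<Sum>j<k. a j *\<^sub>R x (\<phi> (n j)))" for n
    proof -
      let ?y = "\<Sum>j<k. a j *\<^sub>R x (\<phi> (n j))"
      have "(\<Sum>j<k. a j) * \<delta> = (\<Sum>j<k. a j * \<delta>)" by (simp add: sum_distrib_right)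
      also have "\<dots> \<le> (\<Sum>j<k. a j * (s * f (x (\<phi> (n j)))))" by (intro sum_mono mult_left_mono f\<phi> a)
      also have "\<dots> = s * f ?y"
        by (simp add: f.sum f.scaleR sum_distrib_left mult_ac)
      also have "\<dots> \<le> \<bar>s\<bar> * norm (f ?y)"
        by (metis abs_ge_self abs_mult real_norm_def)
      also have "\<dots> \<le> K * norm ?y"
        using K(2)[of ?y] s by (simp add: mult.commute)
      finally show ?thesis .
    qed
    then show "\<forall>\<^sub>F n in incr_seqs. (\<Sum>j<k. a j) * \<delta> \<le> K * norm (\<Sum>j<k. a j *\<^sub>R (x \<circ> \<phi>) (n j))" by simp
  qed simp
  \<comment> \<open>Suppression removes the restriction to nonnegative vectors: the positive and the
    negative part of \<open>a\<close> each have norm at most \<open>L k a\<close>, whence the factor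
    2.\<close>
  have "(\<Sum>j<k. \<bar>a j\<bar>) \<le> (2 * K / \<delta>) * L k a" for k a
  proof -
    define b where "b j = (if j \<in> {j. 0 \<le> a j} then a j else 0)" for j
    define c where "c j = (if j \<in> {j. a j < 0} then a j else 0)" for j
    have nonneg: "0 \<le> (-1) * c j" "0 \<le> b j" for j by (simp_all add: b_def c_def)
    have "(\<Sum>j<k. (-1) * c j) * \<delta> \<le> K * L k (\<lambda>j. (-1) * c j)" by (rule lower) (rule nonneg)
    also have "L k (\<lambda>j. (-1) * c j) = L k c" using has_spreading_norm_homogeneous[OF L, of k "-1" c] by simp
    also have "K * L k c \<le> K * L k a"
      using K(1) supp[of k "{j. a j < 0}" a] unfolding c_def by (intro mult_left_mono) auto
    finally have "(\<Sum>j<k. (-1) * c j) * \<delta> \<le> K * L k a" .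
    moreover have "(\<Sum>j<k. b j) * \<delta> \<le> K * L k a"
      using lower[of b k, OF nonneg(2)] mult_left_mono[OF supp[of k "{j. 0 \<le> a j}" a], of K] K(1)
      unfolding b_def by linarith
    moreover have "(\<Sum>j<k. \<bar>a j\<bar>) = (\<Sum>j<k. b j) + (\<Sum>j<k. (-1) * c j)"
      unfolding sum.distrib[symmetric] by (rule sum.cong) (auto simp: b_def c_def)
    ultimately have "(\<Sum>j<k. \<bar>a j\<bar>) * \<delta> \<le> 2 * K * L k a" by (simp add: algebra_simps)
    then show ?thesis using \<delta>(1) by (simp add: field_simps)
  qed
  with not_l1 show False by blast
qed

section \<open>Codes over a dense sequence and the closed relation between them\<close>

locale dense_sequence =
  fixes d :: "nat \<Rightarrow> 'a::banach"
  assumes dense: "\<And>x e. e > 0 \<Longrightarrow> \<exists>i. norm (x - d i) < e"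
begin

definition code_norm :: "(nat \<Rightarrow> nat) \<Rightarrow> nat \<Rightarrow> (nat \<Rightarrow> real) \<Rightarrow> real" where
  "code_norm c k a = Lim incr_seqs (\<lambda>n. norm (\<Sum>j<k. a j *\<^sub>R d (c (n j))))"

text \<open>Far-out combinations are compared with one another instead of with their limit, so each
  instance involves finitely many values of \<open>c\<close> and the condition is closed. The bound
  is twice the rate of \<open>has_spreading_norm_fast_subseq\<close>.\<close>

definition uniform_code :: "(nat \<Rightarrow> nat) \<Rightarrow> bool" where
  "uniform_code c \<longleftrightarrow> (\<forall>i. 1 \<le> norm (d (c i))) \<and>
    (\<forall>k n n' a. strict_mono n \<and> strict_mono n' \<and> k \<le> n 0 \<and> k \<le> n' 0 \<and> (\<forall>j<k. \<bar>a j\<bar> \<le> 1) \<longrightarrow>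
      \<bar>norm (\<Sum>j<k. a j *\<^sub>R d (c (n j))) - norm (\<Sum>j<k. a j *\<^sub>R d (c (n' j)))\<bar> \<le> 2 / Suc k)"

text \<open>The second clause follows from weak nullness but, unlike it, passes to limits of
  codes.\<close>

definition good_code :: "(nat \<Rightarrow> nat) \<Rightarrow> bool" where
  "good_code c \<longleftrightarrow> uniform_code c \<and>
    (\<forall>k a F. code_norm c k (\<lambda>j. if j \<in> F then a j else 0) \<le> code_norm c k a)"

lemma uniform_codeD:
  assumes "uniform_code c" "strict_mono n" "strict_mono n'" "k \<le> n 0" "k \<le> n' 0" "\<And>j. j < k \<Longrightarrow> \<bar>a j\<bar> \<le> 1"
  shows "\<bar>norm (\<Sum>j<k. a j *\<^sub>R d (c (n j))) - norm (\<Sum>j<k. a j *\<^sub>R d (c (n' j)))\<bar> \<le> 2 / Suc k"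
  using assms unfolding uniform_code_def by blast

lemma uniform_codeD_pad:
  assumes c: "uniform_code c" and n: "strict_mono n" "strict_mono n'" "K \<le> n 0" "K \<le> n' 0"
    and a: "\<And>j. j < k \<Longrightarrow> \<bar>a j\<bar> \<le> s" and s: "s > 0" and K: "k \<le> K"
  shows "\<bar>norm (\<Sum>j<k. a j *\<^sub>R d (c (n j))) - norm (\<Sum>j<k. a j *\<^sub>R d (c (n' j)))\<bar> \<le> s * (2 / Suc K)"
proof -
  let ?b = "\<lambda>j. if j < k then a j / s else 0"
  have eq: "norm (\<Sum>j<K. ?b j *\<^sub>R d (c (n j))) = norm (\<Sum>j<k. a j *\<^sub>R d (c (n j))) / s" for n
  proof -
    have "(\<Sum>j<k. (a j / s) *\<^sub>R d (c (n j))) = (1 / s) *\<^sub>R (\<Sum>j<k. a j *\<^sub>R d (c (n j)))"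
      by (simp add: scaleR_sum_right)
    then show ?thesis using s by (simp add: sum_pad_zero[OF K])
  qed
  have "\<bar>norm (\<Sum>j<K. ?b j *\<^sub>R d (c (n j)))
      - norm (\<Sum>j<K. ?b j *\<^sub>R d (c (n' j)))\<bar> \<le> 2 / Suc K"
  proof (rule uniform_codeD[OF c n])
    fix j
    show "\<bar>?b j\<bar> \<le> 1" using a[of j] s by auto
  qed
  then have "\<bar>(norm (\<Sum>j<k. a j *\<^sub>R d (c (n j))) - norm (\<Sum>j<k. a j *\<^sub>R d (c (n' j)))) / s\<bar> \<le> 2 / Suc K"
    unfolding eq by (simp add: diff_divide_distrib)
  then show ?thesis using s by (simp add: abs_divide pos_divide_le_eq mult.commute)
qed

lemma coefficient_bound:
  fixes a :: "nat \<Rightarrow> real"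
  shows "\<exists>s::real. s > 0 \<and> (\<forall>j<k. \<bar>a j\<bar> \<le> s)"
  by (rule exI[of _ "(\<Sum>j<k. \<bar>a j\<bar>) + 1"])
    (auto intro!: add_nonneg_pos sum_nonneg add_increasing2 member_le_sum)

lemma tendsto_over_Suc: "(\<lambda>K. s * (2 / real (Suc K))) \<longlonglongrightarrow> 0"
  using tendsto_mult_left[OF LIMSEQ_inverse_real_of_nat, of "s * 2"] by (simp add: field_simps)

lemma code_norm:
  assumes c: "uniform_code c"
  shows "has_spreading_norm (d \<circ> c) (code_norm c)"
  unfolding has_spreading_norm_def
proof (intro allI)
  fix k :: nat and a :: "nat \<Rightarrow> real"
  let ?f = "\<lambda>n. norm (\<Sum>j<k. a j *\<^sub>R d (c (n j)))"
  obtain s where s: "s > 0" "\<And>j. j < k \<Longrightarrow> \<bar>a j\<bar> \<le> s" using coefficient_bound by blast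
  have "\<exists>l. (?f \<longlongrightarrow> l) incr_seqs"
    unfolding convergent_incr_seqs_iff_Cauchy
  proof (intro allI impI)
    fix e :: real assume "e > 0"
    with order_tendstoD(2)[OF tendsto_over_Suc, of e s] have
      "\<forall>\<^sub>F K in sequentially. s * (2 / real (Suc K)) < e \<and> k \<le> K"
      using eventually_ge_at_top[of k] by (simp add: eventually_conj)
    then obtain K where K: "s * (2 / real (Suc K)) < e" "k \<le> K" unfolding eventually_sequentially by blast
    show "\<exists>m. \<forall>n n'. strict_mono n \<and> strict_mono n' \<and> m \<le> n 0 \<and> m \<le> n' 0 \<longrightarrow>
        \<bar>?f n - ?f n'\<bar> < e"
    proof (intro exI[of _ K] allI impI, elim conjE)
      fix n n' :: "nat \<Rightarrow> nat" assume "strict_mono n" "strict_mono n'" "K \<le> n 0" "K \<le> n' 0"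
      from uniform_codeD_pad[OF c this, of k a s, OF s(2,1) K(2)] K(1)
      show "\<bar>?f n - ?f n'\<bar> < e" by linarith
    qed
  qed
  then obtain l where l: "(?f \<longlongrightarrow> l) incr_seqs" ..
  then show "((\<lambda>n. norm (\<Sum>j<k. a j *\<^sub>R (d \<circ> c) (n j))) \<longlongrightarrow> code_norm c k a) incr_seqs"
    unfolding code_norm_def o_def tendsto_Lim[OF incr_seqs_neq_bot l] .
qed

lemma code_norm_near:
  assumes c: "uniform_code c" and a: "\<And>j. j < k \<Longrightarrow> \<bar>a j\<bar> \<le> s" and s: "s > 0" and K: "k \<le> K"
  shows "\<bar>norm (\<Sum>j<k. a j *\<^sub>R d (c (K + j))) - code_norm c k a\<bar> \<le> s * (2 / Suc K)"
proof (rule tendsto_upperbound)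
  let ?x = "norm (\<Sum>j<k. a j *\<^sub>R d (c (K + j)))"
  show "((\<lambda>n. \<bar>?x - norm (\<Sum>j<k. a j *\<^sub>R (d \<circ> c) (n j))\<bar>)
      \<longlongrightarrow> \<bar>?x - code_norm c k a\<bar>) incr_seqs"
    by (intro tendsto_rabs tendsto_diff tendsto_const has_spreading_normD code_norm c)
  show "\<forall>\<^sub>F n in incr_seqs. \<bar>?x - norm (\<Sum>j<k. a j *\<^sub>R (d \<circ> c) (n j))\<bar>
      \<le> s * (2 / Suc K)"
  proof (rule eventually_incr_seqsI)
    fix n :: "nat \<Rightarrow> nat" assume n: "strict_mono n" "K \<le> n 0"
    have "strict_mono ((+) K)" by (simp add: strict_mono_def)
    from uniform_codeD_pad[OF c this n(1) _ n(2), of k a s, OF _ a s K]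
    show "\<bar>?x - norm (\<Sum>j<k. a j *\<^sub>R (d \<circ> c) (n j))\<bar> \<le> s * (2 / Suc K)"
      by simp
  qed
qed simp

text \<open>Up to \<open>e / 2\<close> the limit is the norm of one combination with indices
  \<open>K, ..., K + k - 1\<close>, for a \<open>K\<close> that depends on \<open>k\<close>,
  \<open>a\<close> and \<open>e\<close> but not on the code.\<close>

lemma code_norm_continuous:
  assumes c: "uniform_code c" and e: "e > 0"
  shows "\<exists>N. \<forall>c'. uniform_code c' \<and> (\<forall>l\<le>N. c' l = c l) \<longrightarrow> \<bar>code_norm c' k a - code_norm c k a\<bar> \<le> e"
proof -
  obtain s where s: "s > 0" "\<And>j. j < k \<Longrightarrow> \<bar>a j\<bar> \<le> s" using coefficient_bound by blast
  from e have "e / 2 > 0" by simp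
  with order_tendstoD(2)[OF tendsto_over_Suc, of "e / 2" s] have
    "\<forall>\<^sub>F K in sequentially. s * (2 / real (Suc K)) < e / 2 \<and> k \<le> K"
    using eventually_ge_at_top[of k] by (simp add: eventually_conj)
  then obtain K where K: "s * (2 / real (Suc K)) < e / 2" "k \<le> K" unfolding eventually_sequentially by blast
  show ?thesis
  proof (intro exI[of _ "K + k"] allI impI, elim conjE)
    fix c' assume c': "uniform_code c'" and eq: "\<forall>l\<le>K + k. c' l = c l"
    have "(\<Sum>j<k. a j *\<^sub>R d (c' (K + j))) = (\<Sum>j<k. a j *\<^sub>R d (c (K + j)))"
      by (rule sum.cong) (auto simp: eq)
    then have 1: "norm (\<Sum>j<k. a j *\<^sub>R d (c' (K + j))) = norm (\<Sum>j<k. a j *\<^sub>R d (c (K + j)))" by simp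
    have 2: "\<bar>norm (\<Sum>j<k. a j *\<^sub>R d (c (K + j))) - code_norm c k a\<bar> \<le> s * (2 / Suc K)"
      by (rule code_norm_near[OF c s(2) s(1) K(2)])
    have 3: "\<bar>norm (\<Sum>j<k. a j *\<^sub>R d (c' (K + j))) - code_norm c' k a\<bar> \<le> s * (2 / Suc K)"
      by (rule code_norm_near[OF c' s(2) s(1) K(2)])
    show "\<bar>code_norm c' k a - code_norm c k a\<bar> \<le> e" using 1 2 3 K(1) by linarith
  qed
qed

text \<open>The parameters \<open>t\<close>, \<open>p\<close>, \<open>q\<close> let one statement
  cover suppression, domination with a given constant, and both halves of
  \<open>refutes_domination\<close>.\<close>

lemma code_norm_inequality_closed:
  assumes c: "uniform_code c" "uniform_code c'" and p: "p \<ge> 0" "q \<ge> 0"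
    and approx: "\<And>N. \<exists>b b'. uniform_code b \<and> uniform_code b' \<and> (\<forall>l\<le>N. b l = c l \<and> b' l = c' l) \<and>
      t + p * code_norm b k a \<le> q * code_norm b' k' a'"
  shows "t + p * code_norm c k a \<le> q * code_norm c' k' a'"
proof (rule field_le_epsilon)
  fix e :: real assume "e > 0"
  define e' where "e' = e / (p + q + 1)"
  have e': "e' > 0" using \<open>e > 0\<close> p by (simp add: e'_def add_nonneg_pos)
  obtain N where N: "\<forall>b. uniform_code b \<and> (\<forall>l\<le>N. b l = c l) \<longrightarrow> \<bar>code_norm b k a - code_norm c k a\<bar> \<le> e'"
    using code_norm_continuous[OF c(1) e', of k a] by (elim exE)
  obtain N' where N': "\<forall>b. uniform_code b \<and> (\<forall>l\<le>N'. b l = c' l) \<longrightarrow> \<bar>code_norm b k' a' - code_norm c' k' a'\<bar> \<le> e'"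
    using code_norm_continuous[OF c(2) e', of k' a'] by (elim exE)
  obtain b b' where b: "uniform_code b" "uniform_code b'" "\<forall>l\<le>max N N'. b l = c l \<and> b' l = c' l"
    "t + p * code_norm b k a \<le> q * code_norm b' k' a'" using approx[of "max N N'"] by (elim exE conjE)
  have "code_norm c k a \<le> code_norm b k a + e'" using N[rule_format, of b] b by (simp add: abs_le_iff)
  then have "p * code_norm c k a \<le> p * (code_norm b k a + e')" using p by (intro mult_left_mono)
  moreover have "code_norm b' k' a' \<le> code_norm c' k' a' + e'" using N'[rule_format, of b'] b by (simp add: abs_le_iff)
  then have "q * code_norm b' k' a' \<le> q * (code_norm c' k' a' + e')" using p by (intro mult_left_mono)
  ultimately have "t + p * code_norm c k a \<le> q * code_norm c' k' a' + (p + q) * e'"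
    using b(4) by (simp add: algebra_simps)
  also have "(p + q) * e' \<le> (p + q + 1) * e'" using e' by (intro mult_right_mono) auto
  also have "\<dots> = e" using p by (simp add: e'_def add_nonneg_pos less_imp_neq[symmetric])
  finally show "t + p * code_norm c k a \<le> q * code_norm c' k' a' + e" by simp
qed

lemma uniform_code_closed:
  assumes approx: "\<And>N. \<exists>b. uniform_code b \<and> (\<forall>l\<le>N. b l = c l)"
  shows "uniform_code c"
  unfolding uniform_code_def
proof (intro conjI allI impI)
  fix i
  obtain b where "uniform_code b" "\<forall>l\<le>i. b l = c l" using approx by blast
  then show "1 \<le> norm (d (c i))" unfolding uniform_code_def by (metis order_refl)
next
  fix k :: nat and n n' :: "nat \<Rightarrow> nat" and a :: "nat \<Rightarrow> real"
  assume *: "strict_mono n \<and> strict_mono n' \<and> k \<le> n 0 \<and> k \<le> n' 0 \<and> (\<forall>j<k. \<bar>a j\<bar> \<le> 1)"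
  obtain b where b: "uniform_code b" "\<forall>l\<le>max (n k) (n' k). b l = c l" using approx by blast
  have "n j \<le> n k" "n' j \<le> n' k" if "j < k" for j
    using * that by (auto simp: strict_mono_less_eq)
  then have eq: "d (b (n j)) = d (c (n j))" "d (b (n' j)) = d (c (n' j))" if "j < k" for j
    using b(2) that by (auto simp: le_max_iff_disj)
  have "\<bar>norm (\<Sum>j<k. a j *\<^sub>R d (b (n j))) - norm (\<Sum>j<k. a j *\<^sub>R d (b (n' j)))\<bar> \<le> 2 / Suc k"
    using * by (intro uniform_codeD b) auto
  then show "\<bar>norm (\<Sum>j<k. a j *\<^sub>R d (c (n j))) - norm (\<Sum>j<k. a j *\<^sub>R d (c (n' j)))\<bar> \<le> 2 / Suc k"
    by (simp add: eq)
qed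

lemma good_code_closed:
  assumes approx: "\<And>N. \<exists>b. good_code b \<and> (\<forall>l\<le>N. b l = c l)"
  shows "good_code c"
  unfolding good_code_def
proof (intro conjI allI)
  have "\<exists>b. uniform_code b \<and> (\<forall>l\<le>N. b l = c l)" for N using approx[of N] unfolding good_code_def by blast
  then show c: "uniform_code c" by (rule uniform_code_closed)
  fix k a F
  have "0 + 1 * code_norm c k (\<lambda>j. if j \<in> F then a j else 0) \<le> 1 * code_norm c k a"
  proof (rule code_norm_inequality_closed[OF c c])
    fix N
    obtain b where b: "good_code b" "\<forall>l\<le>N. b l = c l" using approx[of N] by blast
    then show "\<exists>b b'. uniform_code b \<and> uniform_code b' \<and> (\<forall>l\<le>N. b l = c l \<and> b' l = c l) \<and>
        0 + 1 * code_norm b k (\<lambda>j. if j \<in> F then a j else 0) \<le> 1 * code_norm b' k a"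
      unfolding good_code_def by (intro exI[of _ b]) simp
  qed simp_all
  then show "code_norm c k (\<lambda>j. if j \<in> F then a j else 0) \<le> code_norm c k a" by simp
qed

lemma uniform_code_bounded:
  assumes c: "uniform_code c"
  shows "\<exists>B. \<forall>i. norm (d (c i)) \<le> B"
proof (intro exI allI)
  fix i
  \<comment> \<open>Single terms of index at least 1 differ in norm by at most
    \<open>2 / Suc 1 = 1\<close>; the condition for \<open>k = 1\<close> does not reach index 0,
    which is added separately.\<close>
  show "norm (d (c i)) \<le> max (norm (d (c 0))) (norm (d (c 1)) + 1)"
  proof (cases "i = 0")
    case False
    have "\<bar>norm (\<Sum>j<1. 1 *\<^sub>R d (c (i + j))) - norm (\<Sum>j<1. 1 *\<^sub>R d (c (1 + j)))\<bar> \<le> 2 / Suc 1"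
      by (rule uniform_codeD[OF c]) (use False in \<open>auto simp: strict_mono_def\<close>)
    then show ?thesis by (auto simp: abs_le_iff)
  qed simp
qed

lemma spreading_model_has_good_code:
  assumes y: "y \<in> spreading_models_w TYPE('a)"
  shows "\<exists>c s. good_code c \<and> s > 0 \<and> (\<forall>k a. code_norm c k a = s * norm (\<Sum>j<k. a j *\<^sub>R y j))"
proof -
  obtain x :: "nat \<Rightarrow> 'a" and m B where x: "weakly_null x" "m > 0" "\<And>i. m \<le> norm (x i)" "\<And>i. norm (x i) \<le> B"
    "has_spreading_norm x (\<lambda>k a. norm (\<Sum>j<k. a j *\<^sub>R y j))"
    using spreading_model_data[OF y] by blast
  \<comment> \<open>With this factor all norms are at least 2, so approximants within distance 1
    still have norm at least 1.\<close>
  define s where "s = 2 / m"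
  have s: "s > 0" using x(2) by (simp add: s_def)
  define L where "L k a = s * norm (\<Sum>j<k. a j *\<^sub>R y j)" for k a
  have "\<exists>l. norm (s *\<^sub>R x i - d l) < 1 / Suc i" for i by (rule dense) simp
  then obtain c0 where c0: "\<And>i. norm (s *\<^sub>R x i - d (c0 i)) < 1 / Suc i" by metis
  then have c0_le: "norm (s *\<^sub>R x i - d (c0 i)) \<le> 1" for i
    using order_trans[OF less_imp_le[OF c0[of i]]] by (simp add: field_simps)
  have norm_sx: "norm (s *\<^sub>R x i) \<ge> 2" for i
    using mult_left_mono[OF x(3)[of i], of s] s x(2) by (simp add: s_def)
  have ge: "1 \<le> norm (d (c0 i))" for i
    using norm_sx[of i] c0_le[of i] norm_triangle_ineq2[of "s *\<^sub>R x i" "d (c0 i)"] by linarith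
  have le: "norm (d (c0 i)) \<le> s * B + 1" for i
  proof -
    have "norm (d (c0 i)) \<le> norm (s *\<^sub>R x i) + norm (s *\<^sub>R x i - d (c0 i))"
      using norm_triangle_sub[of "d (c0 i)" "s *\<^sub>R x i"] by (simp add: norm_minus_commute)
    also have "\<dots> \<le> s * B + 1"
      unfolding norm_scaleR using c0_le[of i] s by (intro add_mono mult_mono x(4)) auto
    finally show ?thesis .
  qed
  have "has_spreading_norm (\<lambda>i. s *\<^sub>R x i) L"
    using has_spreading_norm_scale[OF x(5), of s] s unfolding L_def by simp
  moreover have "(\<lambda>i. norm (s *\<^sub>R x i - d (c0 i))) \<longlonglongrightarrow> 0"
  proof (rule Lim_null_comparison[OF _ LIMSEQ_inverse_real_of_nat])
    show "\<forall>\<^sub>F i in sequentially. norm (norm (s *\<^sub>R x i - d (c0 i))) \<le> inverse (real (Suc i))"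
      using less_imp_le[OF c0] by (simp add: inverse_eq_divide)
  qed
  ultimately have L: "has_spreading_norm (\<lambda>i. d (c0 i)) L" by (rule has_spreading_norm_perturb)
  obtain \<phi> where \<phi>: "strict_mono \<phi>" and "0 \<le> \<phi> 0" and near: "\<And>k n a. strict_mono n \<Longrightarrow> k \<le> n 0 \<Longrightarrow> (\<And>j. j < k \<Longrightarrow> \<bar>a j\<bar> \<le> 1) \<Longrightarrow>
      \<bar>norm (\<Sum>j<k. a j *\<^sub>R ((\<lambda>i. d (c0 i)) \<circ> \<phi>) (n j)) - L k a\<bar> < 1 / Suc k"
    by (rule has_spreading_norm_fast_subseq[OF L le]) (rule that; blast)
  define c where "c = c0 \<circ> \<phi>"
  have "uniform_code c"
    unfolding uniform_code_def
  proof (intro conjI allI impI)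
    show "1 \<le> norm (d (c i))" for i by (simp add: c_def ge)
    fix k :: nat and n n' :: "nat \<Rightarrow> nat" and a :: "nat \<Rightarrow> real"
    assume "strict_mono n \<and> strict_mono n' \<and> k \<le> n 0 \<and> k \<le> n' 0 \<and> (\<forall>j<k. \<bar>a j\<bar> \<le> 1)"
    then have "\<bar>norm (\<Sum>j<k. a j *\<^sub>R d (c (n j))) - L k a\<bar> < 1 / Suc k"
      "\<bar>norm (\<Sum>j<k. a j *\<^sub>R d (c (n' j))) - L k a\<bar> < 1 / Suc k"
      using near[of n k a] near[of n' k a] by (auto simp: c_def)
    moreover have "2 / real (Suc k) = 1 / Suc k + 1 / Suc k" by simp
    ultimately show "\<bar>norm (\<Sum>j<k. a j *\<^sub>R d (c (n j))) - norm (\<Sum>j<k. a j *\<^sub>R d (c (n' j)))\<bar> \<le> 2 / Suc k"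
      by linarith
  qed
  moreover have cn: "code_norm c k a = L k a" for k a
  proof (rule tendsto_unique[OF incr_seqs_neq_bot has_spreading_normD[OF code_norm[OF \<open>uniform_code c\<close>]]])
    show "((\<lambda>n. norm (\<Sum>j<k. a j *\<^sub>R (d \<circ> c) (n j))) \<longlongrightarrow> L k a) incr_seqs"
      using has_spreading_normD[OF has_spreading_norm_subseq[OF L \<phi>], of a k] by (simp add: c_def)
  qed
  moreover have "L k (\<lambda>j. if j \<in> F then a j else 0) \<le> L k a" for k a F
  proof -
    have joint: "has_joint_norm (\<lambda>_. x) (\<lambda>k _ a. norm (\<Sum>j<k. a j *\<^sub>R y j))"
      using x(5) unfolding has_joint_norm_def has_spreading_norm_def by blast
    have eq: "(if j \<in> F then a j else 0) = (if j \<in> F then 1 else 0) * a j" for j by simp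
    have "norm (\<Sum>j<k. (if j \<in> F then a j else 0) *\<^sub>R y j) \<le> norm (\<Sum>j<k. a j *\<^sub>R y j)"
      unfolding eq
      by (rule joint_norm_multiplier[OF _ joint, where t = "\<lambda>j. if j \<in> F then 1 else 0"]) (use x(1) in auto)
    then show ?thesis unfolding L_def using s by (intro mult_left_mono) auto
  qed
  ultimately have "good_code c" unfolding good_code_def by simp
  then show ?thesis using cn s unfolding L_def by blast
qed

text \<open>The lower bound 1 excludes the zero vector and can be reached by scaling; it replaces a
  strict inequality, which would not be closed. Rational coefficients allow the vector to be coded
  by a natural number.\<close>

definition refutes_domination :: "(nat \<Rightarrow> nat) \<Rightarrow> (nat \<Rightarrow> nat) \<Rightarrow> nat \<Rightarrow> rat list \<Rightarrow> bool" where
  "refutes_domination c c' m qs \<longleftrightarrow>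
    1 \<le> code_norm c' (length qs) (\<lambda>j. of_rat (qs ! j)) \<and>
    m * code_norm c (length qs) (\<lambda>j. of_rat (qs ! j)) \<le> code_norm c' (length qs) (\<lambda>j. of_rat (qs ! j))"

text \<open>The sequence \<open>v\<close> witnesses that \<open>c\<close> is strictly below \<open>c'\<close>: its first entry is a constant of
  domination, the others are codes of vectors that refute domination in the other direction.\<close>

definition code_less :: "(nat \<Rightarrow> nat) \<Rightarrow> (nat \<Rightarrow> nat) \<Rightarrow> (nat \<Rightarrow> nat) \<Rightarrow> bool" where
  "code_less c c' v \<longleftrightarrow> good_code c \<and> good_code c' \<and>
    (\<forall>k a. code_norm c k a \<le> v 0 * code_norm c' k a) \<and>
    (\<forall>m. refutes_domination c c' m (from_nat (v (Suc m))))"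

text \<open>Approximating triples that agree far enough share the witness entry in question, so each
  inequality has fixed parameters and passes to the limit.\<close>

lemma code_less_closed:
  assumes approx: "\<And>N. \<exists>b b' u. code_less b b' u \<and> (\<forall>l\<le>N. b l = c l \<and> b' l = c' l \<and> u l = v l)"
  shows "code_less c c' v"
proof -
  have "\<exists>b. good_code b \<and> (\<forall>l\<le>N. b l = c l)" for N
    using approx[of N] unfolding code_less_def by blast
  then have c: "good_code c" by (rule good_code_closed)
  have "\<exists>b. good_code b \<and> (\<forall>l\<le>N. b l = c' l)" for N
    using approx[of N] unfolding code_less_def by blast
  then have c': "good_code c'" by (rule good_code_closed)
  have u: "uniform_code c" "uniform_code c'" using c c' unfolding good_code_def by auto
  have near: "\<exists>b b' u. code_less b b' u \<and> uniform_code b \<and> uniform_code b' \<and>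
      (\<forall>l\<le>N. b l = c l \<and> b' l = c' l) \<and> u l = v l" if "l \<le> N" for N l
  proof -
    obtain b b' u where b: "code_less b b' u" "\<forall>l\<le>N. b l = c l \<and> b' l = c' l \<and> u l = v l"
      using approx[of N] by (elim exE conjE)
    moreover from b(1) have "uniform_code b" "uniform_code b'" unfolding code_less_def good_code_def by simp_all
    ultimately show ?thesis using that by - (rule exI[of _ b], rule exI[of _ b'], rule exI[of _ u], simp)
  qed
  show ?thesis
    unfolding code_less_def
  proof (intro conjI allI impI c c')
    fix k a
    have "0 + 1 * code_norm c k a \<le> real (v 0) * code_norm c' k a"
    proof (rule code_norm_inequality_closed[OF u])
      fix N
      obtain b b' w where b: "code_less b b' w" "uniform_code b" "uniform_code b'"
        "\<forall>l\<le>N. b l = c l \<and> b' l = c' l" "w 0 = v 0" using near[of 0 N] by blast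
      then have "code_norm b k a \<le> real (v 0) * code_norm b' k a" unfolding code_less_def by metis
      with b show "\<exists>b b'. uniform_code b \<and> uniform_code b' \<and> (\<forall>l\<le>N. b l = c l \<and> b' l = c' l) \<and>
          0 + 1 * code_norm b k a \<le> real (v 0) * code_norm b' k a"
        by - (rule exI[of _ b], rule exI[of _ b'], simp)
    qed simp_all
    then show "code_norm c k a \<le> real (v 0) * code_norm c' k a" by simp
  next
    fix m
    define qs :: "rat list" where "qs = from_nat (v (Suc m))"
    have near': "\<exists>b b'. uniform_code b \<and> uniform_code b' \<and> (\<forall>l\<le>N. b l = c l \<and> b' l = c' l) \<and>
        refutes_domination b b' m qs" for N
    proof -
      obtain b b' w where b: "code_less b b' w" "uniform_code b" "uniform_code b'"
        "\<forall>l\<le>max N (Suc m). b l = c l \<and> b' l = c' l" "w (Suc m) = v (Suc m)"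
        using near[of "Suc m" "max N (Suc m)"] by auto
      from b(1) have "refutes_domination b b' m (from_nat (w (Suc m)))" unfolding code_less_def by blast
      then have "refutes_domination b b' m qs" unfolding qs_def b(5) .
      with b(2,3,4) show ?thesis by - (rule exI[of _ b], rule exI[of _ b'], simp)
    qed
    let ?q = "\<lambda>j. of_rat (qs ! j) :: real"
    have "refutes_domination c c' m qs"
      unfolding refutes_domination_def
    proof
      have "1 + 0 * code_norm c 0 (\<lambda>_. 0) \<le> 1 * code_norm c' (length qs) ?q"
      proof (rule code_norm_inequality_closed[OF u])
        fix N
        show "\<exists>b b'. uniform_code b \<and> uniform_code b' \<and> (\<forall>l\<le>N. b l = c l \<and> b' l = c' l) \<and>
            1 + 0 * code_norm b 0 (\<lambda>_. 0) \<le> 1 * code_norm b' (length qs) ?q"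
          using near'[of N] unfolding refutes_domination_def by auto
      qed simp_all
      then show "1 \<le> code_norm c' (length qs) ?q" by simp
      have "0 + m * code_norm c (length qs) ?q \<le> 1 * code_norm c' (length qs) ?q"
      proof (rule code_norm_inequality_closed[OF u])
        fix N
        show "\<exists>b b'. uniform_code b \<and> uniform_code b' \<and> (\<forall>l\<le>N. b l = c l \<and> b' l = c' l) \<and>
            0 + m * code_norm b (length qs) ?q \<le> 1 * code_norm b' (length qs) ?q"
          using near'[of N] unfolding refutes_domination_def by auto
      qed simp_all
      then show "m * code_norm c (length qs) ?q \<le> code_norm c' (length qs) ?q"
        by simp
    qed
    then show "refutes_domination c c' m (from_nat (v (Suc m)))" unfolding qs_def .
  qed
qed

lemma code_less_not_dominated:
  assumes "code_less c c' v"
  shows "\<exists>k a. C * code_norm c k a < code_norm c' k a"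
proof -
  obtain m :: nat where m: "m > C" using reals_Archimedean2 by blast
  define qs :: "rat list" where "qs = from_nat (v (Suc m))"
  define a where "a j = (of_rat (qs ! j) :: real)" for j
  have *: "1 \<le> code_norm c' (length qs) a" "m * code_norm c (length qs) a \<le> code_norm c' (length qs) a"
    using assms unfolding code_less_def refutes_domination_def a_def qs_def by blast+
  have "0 \<le> code_norm c (length qs) a"
    using assms code_norm has_spreading_norm_nonneg unfolding code_less_def good_code_def by blast
  then consider "code_norm c (length qs) a = 0" | "code_norm c (length qs) a > 0" by linarith
  then have "C * code_norm c (length qs) a < code_norm c' (length qs) a"
  proof cases
    case 2
    with m have "C * code_norm c (length qs) a < m * code_norm c (length qs) a" by (rule mult_strict_right_mono)
    with *(2) show ?thesis by linarith
  qed (use *(1) in simp)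
  then show ?thesis by blast
qed

text \<open>The spreading norm of \<open>c'\<close> is at most a multiple of the
  \<open>\<ell>\<^sub>1\<close> norm. If \<open>c\<close> dominated \<open>\<ell>\<^sub>1\<close>,
  it would dominate \<open>c'\<close>.\<close>

lemma code_less_weakly_null:
  assumes less: "code_less c c' v"
  shows "weakly_null (d \<circ> c)"
proof (rule weakly_null_of_suppression)
  have c: "uniform_code c" "uniform_code c'" "good_code c" using less unfolding code_less_def good_code_def by auto
  show "has_spreading_norm (d \<circ> c) (code_norm c)" by (rule code_norm[OF c(1)])
  show "code_norm c k (\<lambda>j. if j \<in> F then a j else 0) \<le> code_norm c k a" for k a F
    using c(3) unfolding good_code_def by blast
  show "\<not> (\<exists>C. \<forall>k a. (\<Sum>j<k. \<bar>a j\<bar>) \<le> C * code_norm c k a)"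
  proof
    assume "\<exists>C. \<forall>k a. (\<Sum>j<k. \<bar>a j\<bar>) \<le> C * code_norm c k a"
    then obtain C where C: "\<And>k a. (\<Sum>j<k. \<bar>a j\<bar>) \<le> C * code_norm c k a" by blast
    obtain B where B: "\<And>i. norm (d (c' i)) \<le> B" using uniform_code_bounded[OF c(2)] by blast
    then have B0: "B \<ge> 0" using norm_ge_zero order_trans by blast
    obtain k a where ka: "(B * C) * code_norm c k a < code_norm c' k a"
      using code_less_not_dominated[OF less] by blast
    have "code_norm c' k a \<le> (\<Sum>j<k. \<bar>a j\<bar>) * B"
      by (rule has_spreading_norm_le_l1[OF code_norm[OF c(2)]]) (simp add: B)
    also have "\<dots> \<le> (C * code_norm c k a) * B" by (intro mult_right_mono C B0)
    finally show False using ka by (simp add: mult_ac)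
  qed
qed

lemma code_less_chain:
  assumes less: "\<And>n. code_less (c n) (c (Suc n)) (v n)"
  shows "SPw_has_increasing TYPE('a) natLeq"
proof -
  define P where "P n q z \<longleftrightarrow> q \<in> SPw TYPE('a) \<and> z \<in> q \<and>
      (\<forall>k a. norm (\<Sum>j<k. a j *\<^sub>R z j) = code_norm (c n) k a)" for n q z
  have "\<exists>q z. P n q z" for n
  proof -
    have u: "uniform_code (c n)" using less[of n] unfolding code_less_def good_code_def by auto
    obtain B where B: "\<And>i. norm (d (c n i)) \<le> B" using uniform_code_bounded[OF u] by blast
    have "1 \<le> code_norm (c n) 1 (\<lambda>_. 1)"
      by (rule tendsto_lowerbound[OF has_spreading_norm_tendsto_norm[OF code_norm[OF u]]])
        (use u in \<open>auto simp: uniform_code_def\<close>)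
    then have pos: "0 < code_norm (c n) 1 (\<lambda>_. 1)" by simp
    have B': "norm ((d \<circ> c n) i) \<le> B" for i by (simp add: B)
    obtain z where z: "z \<in> spreading_models_w TYPE('a)" "\<And>k a. norm (\<Sum>j<k. a j *\<^sub>R z j) = code_norm (c n) k a"
      by (rule spreading_model_of_norm[OF code_less_weakly_null[OF less] B' code_norm[OF u] pos]) (rule that)
    obtain q where "q \<in> SPw TYPE('a)" "z \<in> q" using ex_class_in_SPw[OF z(1)] by blast
    with z(2) show ?thesis unfolding P_def by blast
  qed
  then obtain q z where P: "\<And>n. P n (q n) (z n)" by metis
  then have q: "q n \<in> SPw TYPE('a)" and z: "z n \<in> q n"
    "norm (\<Sum>j<k. a j *\<^sub>R z n j) = code_norm (c n) k a" for n k a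
    unfolding P_def by blast+
  have step: "dominated (z n) (z (Suc n))" "\<not> dominated (z (Suc n)) (z n)" for n
  proof -
    show "dominated (z n) (z (Suc n))"
      using less[of n] unfolding dominated_iff z(2) code_less_def by (elim conjE) (rule exI)
    show "\<not> dominated (z (Suc n)) (z n)"
    proof
      assume "dominated (z (Suc n)) (z n)"
      then obtain C where C: "\<And>k a. code_norm (c (Suc n)) k a \<le> C * code_norm (c n) k a"
        unfolding dominated_iff z(2) by blast
      obtain k a where "C * code_norm (c n) k a < code_norm (c (Suc n)) k a"
        using code_less_not_dominated[OF less[of n]] by blast
      with C[of k a] show False by simp
    qed
  qed
  have dom: "dominated (z m) (z n)" if "m \<le> n" for m n
    using that
  proof (induction rule: dec_induct)
    case base
    show ?case by (rule dominated_refl)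
  next
    case (step i)
    then show ?case using dominated_trans \<open>\<And>n. dominated (z n) (z (Suc n))\<close> by blast
  qed
  have "SP_less (q m) (q n)" if "m < n" for m n
  proof -
    have "\<not> dominated (z n) (z m)"
    proof
      assume "dominated (z n) (z m)"
      with dom[of "Suc m" n] that have "dominated (z (Suc m)) (z m)" by (auto intro: dominated_trans)
      with step(2) show False by blast
    qed
    with dom[of m n] that show ?thesis using SP_less_iff[OF q z(1) q z(1)] by auto
  qed
  then show ?thesis unfolding SPw_has_increasing_def using q
    by (intro exI[of _ q]) (auto simp: natLeq_def)
qed

lemma code_lessI:
  assumes c: "good_code c" "good_code c'"
    and dom: "\<And>k a. code_norm c k a \<le> C * code_norm c' k a"
    and not_dom: "\<And>C. \<exists>k a. C * code_norm c k a < code_norm c' k a"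
  shows "\<exists>v. code_less c c' v"
proof -
  have u: "uniform_code c" "uniform_code c'" using c unfolding good_code_def by auto
  note N = code_norm[OF u(1)] and N' = code_norm[OF u(2)]
  have "\<exists>qs. refutes_domination c c' m qs" for m
  proof -
    obtain k a where ka: "m * code_norm c k a < code_norm c' k a" using not_dom by blast
    obtain B1 where B1: "\<And>i. norm (d (c i)) \<le> B1" using uniform_code_bounded[OF u(1)] by blast
    obtain B2 where B2: "\<And>i. norm (d (c' i)) \<le> B2" using uniform_code_bounded[OF u(2)] by blast
    define B where "B = max (max B1 B2) 1"
    have B: "norm ((d \<circ> c) i) \<le> B" "norm ((d \<circ> c') i) \<le> B" "B > 0" for i
      using B1[of i] B2[of i] by (auto simp: B_def)
    define g where "g = code_norm c' k a - m * code_norm c k a"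
    \<comment> \<open>Rounding \<open>a\<close> to \<open>b\<close> changes the gap \<open>g\<close>
      by at most \<open>S * (m + 1)\<close>; an error below \<open>g / D\<close> in each coefficient
      keeps this change smaller than \<open>g\<close>.\<close>
    define D where "D = real k * B * (real m + 1) + 1"
    have D: "D > 0" using B(3) by (simp add: D_def add_nonneg_pos)
    have gD: "g / D > 0" using ka D by (simp add: g_def)
    have "\<exists>q. \<bar>a j - of_rat q\<bar> < g / D" for j
    proof -
      have "a j - g / D < a j + g / D" using gD by simp
      from of_rat_dense[OF this] show ?thesis by (auto simp: abs_less_iff algebra_simps)
    qed
    then obtain q where q: "\<And>j. \<bar>a j - of_rat (q j)\<bar> < g / D" by metis
    define b where "b j = (of_rat (q j) :: real)" for j
    define S where "S = (\<Sum>j<k. \<bar>a j - b j\<bar>) * B"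
    have "(\<Sum>j<k. \<bar>a j - b j\<bar>) \<le> (\<Sum>j<k. g / D)"
      by (intro sum_mono) (use q in \<open>auto simp: b_def intro: less_imp_le\<close>)
    then have "S \<le> (real k * (g / D)) * B" unfolding S_def using B(3) by (intro mult_right_mono) auto
    then have "S * (real m + 1) \<le> ((real k * (g / D)) * B) * (real m + 1)" by (intro mult_right_mono) auto
    also have "\<dots> = (D - 1) * (g / D)" by (simp add: D_def)
    also have "\<dots> < D * (g / D)" using gD by (intro mult_strict_right_mono) auto
    also have "\<dots> = g" using D by simp
    finally have Sg: "S * (real m + 1) < g" .
    have l1: "\<bar>code_norm c k a - code_norm c k b\<bar> \<le> S"
      unfolding S_def by (rule has_spreading_norm_Lipschitz[OF N B(1)])
    have l2: "\<bar>code_norm c' k a - code_norm c' k b\<bar> \<le> S"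
      unfolding S_def by (rule has_spreading_norm_Lipschitz[OF N' B(2)])
    have "m * code_norm c k b \<le> m * (code_norm c k a + S)" using l1 by (intro mult_left_mono) auto
    also have "\<dots> = code_norm c' k a - g + m * S" by (simp add: g_def algebra_simps)
    also have "\<dots> < code_norm c' k b" using l2 Sg by (simp add: algebra_simps)
    finally have mb: "m * code_norm c k b < code_norm c' k b" .
    moreover have "0 \<le> m * code_norm c k b" using has_spreading_norm_nonneg[OF N] by simp
    ultimately have pos: "code_norm c' k b > 0" by linarith
    \<comment> \<open>Multiplying the vector by \<open>M\<close> lifts its norm above 1 and
      preserves the other inequality by homogeneity.\<close>
    obtain M :: nat where M: "1 / code_norm c' k b < M" using reals_Archimedean2 by blast
    then have M1: "1 < M * code_norm c' k b" using pos by (simp add: field_simps)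
    define qs where "qs = map (\<lambda>j. of_nat M * q j) [0..<k]"
    have scaled: "code_norm e k (\<lambda>j. of_rat (qs ! j)) = M * code_norm e k b" if e: "uniform_code e" for e
    proof -
      have "code_norm e k (\<lambda>j. of_rat (qs ! j)) = code_norm e k (\<lambda>j. real M * b j)"
      proof -
        have "(\<Sum>j<k. of_rat (qs ! j) *\<^sub>R d (e (n j))) = (\<Sum>j<k. (real M * b j) *\<^sub>R d (e (n j)))" for n
          by (rule sum.cong) (auto simp: qs_def b_def of_rat_mult)
        then show ?thesis unfolding code_norm_def by simp
      qed
      then show ?thesis using has_spreading_norm_homogeneous[OF code_norm[OF e], of k "real M" b] by simp
    qed
    have len: "length qs = k" by (simp add: qs_def)
    have "M * (m * code_norm c k b) \<le> M * code_norm c' k b" using mb by (intro mult_left_mono) auto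
    then have "refutes_domination c c' m qs" unfolding refutes_domination_def len scaled[OF u(1)] scaled[OF u(2)] using M1 by (simp add: mult_ac)
    then show ?thesis by blast
  qed
  then obtain qs where qs: "\<And>m. refutes_domination c c' m (qs m)" by metis
  obtain C' :: nat where C': "C < C'" using reals_Archimedean2 by blast
  define v where "v n = (case n of 0 \<Rightarrow> C' | Suc m \<Rightarrow> to_nat (qs m))" for n
  have "code_norm c k a \<le> C' * code_norm c' k a" for k a
    using dom[of k a] mult_right_mono[OF less_imp_le[OF C'] has_spreading_norm_nonneg[OF N', of k a]] by linarith
  then have "code_less c c' v"
    unfolding code_less_def using c qs by (auto simp: v_def)
  then show ?thesis by blast
qed

end

section \<open>The countable bound and the theorem\<close>

lemma separable_imp_dense_sequence:
  assumes "separable_space (euclidean :: 'a::banach topology)"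
  obtains d :: "nat \<Rightarrow> 'a::banach" where "dense_sequence d"
proof -
  obtain D :: "'a set" where D: "countable D" "closure D = UNIV"
    using assms unfolding separable_space_def by auto
  have "D \<noteq> {}" using D(2) by auto
  show thesis
  proof (rule that[of "from_nat_into D"], unfold_locales)
    fix x :: 'a and e :: real assume "e > 0"
    have "x \<in> closure D" using D(2) by simp
    then obtain y where y: "y \<in> D" "dist y x < e" using \<open>e > 0\<close> unfolding closure_approachable by blast
    then obtain i where "from_nat_into D i = y" using from_nat_into_surj[OF D(1)] by blast
    with y show "\<exists>i. norm (x - from_nat_into D i) < e"
      by (intro exI[of _ i]) (simp add: dist_norm norm_minus_commute)
  qed
qed

text \<open>The index type \<open>'i\<close> is left open: (a) takes it to be
  \<open>nat set\<close>, the type of \<open>omega1\<close>, and (b) the type of equivalence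
  classes.\<close>

lemma decreasing_length_bound:
  assumes sep: "separable_space (euclidean :: 'a::banach topology)"
    and no_incr: "\<not> SPw_has_increasing TYPE('a) natLeq"
  shows "\<exists>\<xi> :: nat rel. Well_order \<xi> \<and>
    (\<forall>r :: 'i rel. \<xi> <o r \<longrightarrow> \<not> SPw_has_decreasing TYPE('a) r)"
proof -
  obtain d :: "nat \<Rightarrow> 'a" where "dense_sequence d" using separable_imp_dense_sequence[OF sep] .
  then interpret dense_sequence d .
  have nochain: "\<exists>n. \<not> code_less (c n) (c (Suc n)) (v n)" for c v
  proof (rule ccontr)
    assume "\<nexists>n. \<not> code_less (c n) (c (Suc n)) (v n)"
    then have "code_less (c n) (c (Suc n)) (v n)" for n by simp
    then have "SPw_has_increasing TYPE('a) natLeq" by (rule code_less_chain)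
    with no_incr show False ..
  qed
  have "\<exists>\<xi> :: nat rel. Well_order \<xi> \<and> (\<forall>(r :: 'i rel) c. Well_order r \<longrightarrow>
    (\<forall>\<zeta> \<eta>. (\<zeta>, \<eta>) \<in> r \<and> \<zeta> \<noteq> \<eta> \<longrightarrow> (\<exists>v. code_less (c \<eta>) (c \<zeta>) v)) \<longrightarrow> r \<le>o \<xi>)"
  proof (rule descending_family_bound)
    show "code_less c c' v"
      if "\<And>N. \<exists>b b' u. code_less b b' u \<and> (\<forall>l\<le>N. b l = c l \<and> b' l = c' l \<and> u l = v l)" for c c' v
      by (rule code_less_closed[OF that])
  qed (rule nochain)
  then obtain \<xi> :: "nat rel" where \<xi>: "Well_order \<xi>" and bound: "\<forall>(r :: 'i rel) c. Well_order r \<longrightarrow>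
    (\<forall>\<zeta> \<eta>. (\<zeta>, \<eta>) \<in> r \<and> \<zeta> \<noteq> \<eta> \<longrightarrow> (\<exists>v. code_less (c \<eta>) (c \<zeta>) v)) \<longrightarrow> r \<le>o \<xi>"
    by (elim exE conjE)
  have "\<not> SPw_has_decreasing TYPE('a) r" if less: "\<xi> <o r" for r :: "'i rel"
  proof
    assume "SPw_has_decreasing TYPE('a) r"
    then obtain p where "\<forall>\<zeta>\<in>Field r. p \<zeta> \<in> SPw TYPE('a)"
      "\<forall>\<zeta> \<eta>. (\<zeta>, \<eta>) \<in> r \<and> \<zeta> \<noteq> \<eta> \<longrightarrow> SP_less (p \<eta>) (p \<zeta>)"
      unfolding SPw_has_decreasing_def by (elim exE conjE)
    then have p: "\<zeta> \<in> Field r \<Longrightarrow> p \<zeta> \<in> SPw TYPE('a)"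
      "(\<zeta>, \<eta>) \<in> r \<Longrightarrow> \<zeta> \<noteq> \<eta> \<Longrightarrow> SP_less (p \<eta>) (p \<zeta>)" for \<zeta> \<eta> by simp_all
    define R where "R \<zeta> y c s \<longleftrightarrow> y \<in> p \<zeta> \<and> good_code c \<and> s > 0 \<and>
      (\<forall>k a. code_norm c k a = s * norm (\<Sum>j<k. a j *\<^sub>R y j))" for \<zeta> y c and s :: real
    have "\<exists>y c s. R \<zeta> y c s" if F: "\<zeta> \<in> Field r" for \<zeta>
    proof -
      obtain y where y: "y \<in> p \<zeta>" "y \<in> spreading_models_w TYPE('a)"
        using SPw_ex_representative[OF p(1)[OF F]] by blast
      obtain c s where "good_code c \<and> s > 0 \<and> (\<forall>k a. code_norm c k a = s * norm (\<Sum>j<k. a j *\<^sub>R y j))"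
        using spreading_model_has_good_code[OF y(2)] by (elim exE)
      with y(1) have "R \<zeta> y c s" unfolding R_def by (rule conjI)
      then show ?thesis by blast
    qed
    then obtain y c s where ycs: "\<And>\<zeta>. \<zeta> \<in> Field r \<Longrightarrow> R \<zeta> (y \<zeta>) (c \<zeta>) (s \<zeta>)" by metis
    have "\<exists>v. code_less (c \<eta>) (c \<zeta>) v" if *: "(\<zeta>, \<eta>) \<in> r" "\<zeta> \<noteq> \<eta>" for \<zeta> \<eta>
    proof -
      have F: "\<zeta> \<in> Field r" "\<eta> \<in> Field r" using * by (auto simp: Field_def)
      have y: "y \<zeta> \<in> p \<zeta>" "y \<eta> \<in> p \<eta>" and g: "good_code (c \<zeta>)" "good_code (c \<eta>)"
        and s: "s \<zeta> > 0" "s \<eta> > 0"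
        and n: "code_norm (c \<zeta>) k a = s \<zeta> * norm (\<Sum>j<k. a j *\<^sub>R y \<zeta> j)"
        "code_norm (c \<eta>) k a = s \<eta> * norm (\<Sum>j<k. a j *\<^sub>R y \<eta> j)" for k a
        using ycs[OF F(1)] ycs[OF F(2)] unfolding R_def by simp_all
      have "dominated (y \<eta>) (y \<zeta>)" "\<not> dominated (y \<zeta>) (y \<eta>)"
        using p(2)[OF *] SP_less_iff[OF p(1)[OF F(2)] y(2) p(1)[OF F(1)] y(1)] by auto
      then obtain C where C: "\<forall>k a. norm (\<Sum>j<k. a j *\<^sub>R y \<eta> j) \<le> C * norm (\<Sum>j<(k::nat). a j *\<^sub>R y \<zeta> j)"
        and nd: "\<And>C. \<exists>k a. \<not> norm (\<Sum>j<k. a j *\<^sub>R y \<zeta> j) \<le> C * norm (\<Sum>j<(k::nat). a j *\<^sub>R y \<eta> j)"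
        unfolding dominated_iff by auto
      show ?thesis
      proof (rule code_lessI[OF g(2,1)])
        show "code_norm (c \<eta>) k a \<le> (s \<eta> * C / s \<zeta>) * code_norm (c \<zeta>) k a" for k a
          using mult_left_mono[OF C[rule_format, of a k], of "s \<eta>"] s unfolding n by simp
        show "\<exists>k a. C' * code_norm (c \<eta>) k a < code_norm (c \<zeta>) k a" for C'
        proof -
          obtain k a where "\<not> norm (\<Sum>j<k. a j *\<^sub>R y \<zeta> j) \<le> (C' * s \<eta> / s \<zeta>) * norm (\<Sum>j<(k::nat). a j *\<^sub>R y \<eta> j)"
            using nd by blast
          then have "C' * code_norm (c \<eta>) k a < code_norm (c \<zeta>) k a" using s unfolding n by (simp add: field_simps)
          then show ?thesis by blast
        qed
      qed
    qed
    moreover have "Well_order r" using less unfolding ordLess_def by blast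
    ultimately have "r \<le>o \<xi>" using bound[rule_format, of r c] by simp
    with less show False using not_ordLess_ordLeq by blast
  qed
  with \<xi> show ?thesis by blast
qed

lemma countable_ordLess_omega1:
  fixes \<xi> :: "nat rel"
  assumes "Well_order \<xi>"
  shows "\<xi> <o omega1"
proof (rule ccontr)
  assume "\<not> \<xi> <o omega1"
  then have "omega1 \<le>o \<xi>" using ordLess_or_ordLeq[OF assms omega1_Well_order] by blast
  then have "|Field omega1| \<le>o |Field \<xi>|" by (rule card_of_mono2)
  moreover have "|Field \<xi>| \<le>o natLeq" unfolding countable_card_le_natLeq[symmetric] by simp
  ultimately have "|Field omega1| \<le>o natLeq" by (rule ordLeq_transitive)
  moreover have "natLeq <o omega1" by (rule cardSuc_greater[OF natLeq_Card_order])
  moreover have "omega1 \<le>o |Field omega1|"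
    using cardSuc_Card_order[OF natLeq_Card_order] unfolding Card_order_iff_ordLeq_card_of .
  ultimately show False using not_ordLess_ordLeq ordLeq_transitive by blast
qed

theorem theorem3:
  assumes "separable_space (euclidean :: 'a::banach topology)"
  shows "(SPw_has_decreasing TYPE('a) omega1 \<longrightarrow> SPw_has_increasing TYPE('a) omega1) \<and>
         (\<not> SPw_has_increasing TYPE('a) natLeq \<longrightarrow>
           (\<exists>\<xi> :: nat rel. Well_order \<xi> \<and>
              (\<forall>r :: (nat \<Rightarrow> linfty) set rel. \<xi> <o r \<longrightarrow> \<not> SPw_has_decreasing TYPE('a) r)))"
proof (intro conjI impI)
  assume dec: "SPw_has_decreasing TYPE('a) omega1"
  have "SPw_has_increasing TYPE('a) natLeq"
  proof (rule ccontr)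
    assume "\<not> SPw_has_increasing TYPE('a) natLeq"
    then obtain \<xi> :: "nat rel" where "Well_order \<xi>"
      "\<forall>r :: nat set rel. \<xi> <o r \<longrightarrow> \<not> SPw_has_decreasing TYPE('a) r"
      using decreasing_length_bound[OF assms] by blast
    with dec countable_ordLess_omega1 show False by blast
  qed
  then show "SPw_has_increasing TYPE('a) omega1" by (rule increasing_sequence_imp_omega1)
next
  assume "\<not> SPw_has_increasing TYPE('a) natLeq"
  then show "\<exists>\<xi> :: nat rel. Well_order \<xi> \<and>
      (\<forall>r :: (nat \<Rightarrow> linfty) set rel. \<xi> <o r \<longrightarrow> \<not> SPw_has_decreasing TYPE('a) r)"
    by (rule decreasing_length_bound[OF assms])
qed

end
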